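(* Let $K$ be a division ring, let $G$ be a locally indicable group and let $K\ast G$ be a crossed product of $G$ over $K$. Suppose that $K\ast G$ has a Hughes-free division ring of fractions $D$. Then any involution on $K\ast G$ extends to a unique involution on $D$.
   Context: An involution on a ring $A$ is an additive map ${}^\star\colon A\to A$ with $(ab)^\star=b^\star a^\star$ and $(a^\star)^\star=a$ for all $a,b\in A$. A crossed product $K\ast G$ of a group $G$ over a ring $K$ is an associative ring containing $K$ as a subring which is a free right $K$-module with basis $\overline{G}=\{\bar x: x\in G\}$, a set in bijection with $G$, with multiplication satisfying $\bar x\bar y=\overline{xy}\,\tau(x,y)$ and $a\bar x=\bar x a^{\sigma(x)}$ for all $x,y\in G$, $a\in K$, where $\tau\colon G\times G\to U(K)$ and $\sigma\colon G\to\operatorname{Aut}(K)$ are maps and $U(K)$ is the group of units of $K$. It is assumed that $\bar 1$ is the unity element. For a subgroup $N$ of $G$, $K\ast N$ denotes the subring $\bigoplus_{x\in N}\bar xK$ of $K\ast G$. A group is locally indicable if every nontrivial finitely generated subgroup $H$ has a normal subgroup $N$ with $H/N$ infinite cyclic. Let $G$ be locally indicable, $K$ a division ring, and $K\ast G\hookrightarrow D$ a ring embedding into a division ring. For a subgroup $N$ of $G$, let $D(K,N)$ be the division subring of $D$ generated by $K\ast N$. The embedding is Hughes-free if for each nontrivial finitely generated subgroup $H$ of $G$, each normal subgroup $N$ of $H$ with $H/N$ infinite cyclic, and each $t\in H$ with $H/N=\langle tN\rangle$, the set $\{\bar t^n: n\geq 0\}$ is right $D(K,N)$-linearly independent in $D$.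 If moreover $D=D(K,G)$, then $D$ is a Hughes-free division ring of fractions of $K\ast G$. *)

theory Defs
  imports "HOL-Algebra.Coset" "HOL-Algebra.Elementary_Groups"
begin

text \<open>Groups are HOL-Algebra groups, because subgroups and quotients of \<open>G\<close> occur. Rings are types of
  class \<open>ring_1\<close> or \<open>division_ring\<close>, and subrings are sets.\<close>

section \<open>Rings\<close>

definition involution :: "('a::ring_1 \<Rightarrow> 'a) \<Rightarrow> bool" where
  "involution s \<longleftrightarrow>
     (\<forall>a b. s (a + b) = s a + s b) \<and> (\<forall>a b. s (a * b) = s b * s a) \<and> (\<forall>a. s (s a) = a)"

definition ring_embedding :: "('a::ring_1 \<Rightarrow> 'b::ring_1) \<Rightarrow> bool" where
  "ring_embedding f \<longleftrightarrow>
     (\<forall>a b. f (a + b) = f a + f b) \<and> (\<forall>a b. f (a * b) = f a * f b) \<and> f 1 = 1 \<and> inj f"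

definition unital_subring :: "'a::ring_1 set \<Rightarrow> bool" where
  "unital_subring R \<longleftrightarrow> 1 \<in> R \<and> (\<forall>a\<in>R. \<forall>b\<in>R. a - b \<in> R \<and> a * b \<in> R)"

definition ring_units :: "'a::ring_1 set \<Rightarrow> 'a set" where
  "ring_units R = {u \<in> R. \<exists>v\<in>R. u * v = 1 \<and> v * u = 1}"

definition division_subring :: "'a::ring_1 set \<Rightarrow> bool" where
  "division_subring R \<longleftrightarrow> unital_subring R \<and> R - {0} \<subseteq> ring_units R"

definition division_subring_generated :: "'d::division_ring set \<Rightarrow> 'd set" where
  "division_subring_generated X = \<Inter>{R. division_subring R \<and> X \<subseteq> R}"

text \<open>Automorphisms of a subring; values outside \<open>R\<close> are irrelevant.\<close>

definition ring_automorphism_on :: "'a::ring_1 set \<Rightarrow> ('a \<Rightarrow> 'a) \<Rightarrow> bool" where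
  "ring_automorphism_on R s \<longleftrightarrow> bij_betw s R R \<and> s 1 = 1 \<and>
     (\<forall>a\<in>R. \<forall>b\<in>R. s (a + b) = s a + s b \<and> s (a * b) = s a * s b)"

text \<open>Linear combinations with coefficients in a subring \<open>R\<close> acting from the right. The library's
  modules have commutative scalars and its vector spaces have a type of scalars, so they do not apply.\<close>

definition right_span :: "'a::ring_1 set \<Rightarrow> 'a set \<Rightarrow> 'a set" where
  "right_span R B = {\<Sum>b\<in>S. b * c b | S c. finite S \<and> S \<subseteq> B \<and> c ` S \<subseteq> R}"

definition right_independent :: "'a::ring_1 set \<Rightarrow> 'a set \<Rightarrow> bool" where
  "right_independent R B \<longleftrightarrow>
     (\<forall>S c. finite S \<and> S \<subseteq> B \<and> c ` S \<subseteq> R \<and> (\<Sum>b\<in>S. b * c b) = 0 \<longrightarrow> (\<forall>b\<in>S. c b = 0))"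

section \<open>Crossed products\<close>

text \<open>The type \<open>'a\<close> is a crossed product of \<open>G\<close> over its subring \<open>K\<close>; \<open>bar x\<close> is the basis element
  indexed by \<open>x\<close>, and \<open>\<sigma> x a\<close> is written \<open>a\<close> to the power \<open>\<sigma>(x)\<close> in the literature.\<close>

locale crossed_product = group G for G (structure) +
  fixes K :: "'a::ring_1 set" and bar :: "'g \<Rightarrow> 'a"
    and \<tau> :: "'g \<Rightarrow> 'g \<Rightarrow> 'a" and \<sigma> :: "'g \<Rightarrow> 'a \<Rightarrow> 'a"
  assumes subring: "unital_subring K"
    and bar_inj: "inj_on bar (carrier G)"
    and bar_independent: "right_independent K (bar ` carrier G)"
    and bar_span: "right_span K (bar ` carrier G) = UNIV"
    and twist_unit: "\<lbrakk>x \<in> carrier G; y \<in> carrier G\<rbrakk> \<Longrightarrow> \<tau> x y \<in> ring_units K"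
    and action_aut: "x \<in> carrier G \<Longrightarrow> ring_automorphism_on K (\<sigma> x)"
    and bar_mult: "\<lbrakk>x \<in> carrier G; y \<in> carrier G\<rbrakk> \<Longrightarrow> bar x * bar y = bar (x \<otimes> y) * \<tau> x y"
    and mult_bar: "\<lbrakk>x \<in> carrier G; a \<in> K\<rbrakk> \<Longrightarrow> a * bar x = bar x * \<sigma> x a"
    and bar_one: "bar \<one> = 1"

text \<open>The subring \<open>K * N\<close> of the crossed product.\<close>

definition sub_crossed_product :: "'a::ring_1 set \<Rightarrow> ('g \<Rightarrow> 'a) \<Rightarrow> 'g set \<Rightarrow> 'a set" where
  "sub_crossed_product K bar N = right_span K (bar ` N)"

section \<open>Locally indicable groups\<close>

definition nontrivial_fg_subgroup :: "'g set \<Rightarrow> ('g, 'm) monoid_scheme \<Rightarrow> bool" where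
  "nontrivial_fg_subgroup H G \<longleftrightarrow> subgroup H G \<and> H \<noteq> {\<one>\<^bsub>G\<^esub>} \<and>
     (\<exists>S. finite S \<and> S \<subseteq> carrier G \<and> H = generate G S)"

definition infinite_cyclic :: "'g monoid \<Rightarrow> bool" where
  "infinite_cyclic Q \<longleftrightarrow> cyclic_group Q \<and> infinite (carrier Q)"

definition locally_indicable :: "('g, 'm) monoid_scheme \<Rightarrow> bool" where
  "locally_indicable G \<longleftrightarrow> group G \<and>
     (\<forall>H. nontrivial_fg_subgroup H G \<longrightarrow>
        (\<exists>N. N \<lhd> G\<lparr>carrier := H\<rparr> \<and> infinite_cyclic (G\<lparr>carrier := H\<rparr> Mod N)))"

section \<open>Hughes-free division rings of fractions\<close>

text \<open>\<open>D(K,N)\<close>, for an embedding \<open>\<phi>\<close> of the crossed product into a division ring.\<close>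

definition division_closure ::
  "'a::ring_1 set \<Rightarrow> ('g \<Rightarrow> 'a) \<Rightarrow> ('a \<Rightarrow> 'd::division_ring) \<Rightarrow> 'g set \<Rightarrow> 'd set" where
  "division_closure K bar \<phi> N = division_subring_generated (\<phi> ` sub_crossed_product K bar N)"

definition hughes_free_embedding ::
  "('g, 'm) monoid_scheme \<Rightarrow> 'a::ring_1 set \<Rightarrow> ('g \<Rightarrow> 'a) \<Rightarrow> ('a \<Rightarrow> 'd::division_ring) \<Rightarrow> bool" where
  "hughes_free_embedding G K bar \<phi> \<longleftrightarrow> ring_embedding \<phi> \<and>
     (\<forall>H N t. nontrivial_fg_subgroup H G \<and> N \<lhd> G\<lparr>carrier := H\<rparr> \<and>
        infinite_cyclic (G\<lparr>carrier := H\<rparr> Mod N) \<and> t \<in> H \<and>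
        carrier (G\<lparr>carrier := H\<rparr> Mod N) = generate (G\<lparr>carrier := H\<rparr> Mod N) {N #>\<^bsub>G\<^esub> t} \<longrightarrow>
        right_independent (division_closure K bar \<phi> N) {\<phi> (bar t) ^ n | n. True})"

definition hughes_free_division_ring_of_fractions ::
  "('g, 'm) monoid_scheme \<Rightarrow> 'a::ring_1 set \<Rightarrow> ('g \<Rightarrow> 'a) \<Rightarrow> ('a \<Rightarrow> 'd::division_ring) \<Rightarrow> bool" where
  "hughes_free_division_ring_of_fractions G K bar \<phi> \<longleftrightarrow>
     hughes_free_embedding G K bar \<phi> \<and> division_closure K bar \<phi> (carrier G) = UNIV"

end

theory Submission
  imports "HOL-Library.Multiset" "HOL-Library.Product_Plus" "HOL-Algebra.Multiplicative_Group" Defs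
begin

text \<open>An involution \<open>\<star>\<close> of \<open>K * G\<close> composed with \<open>\<phi>\<close> is an embedding of \<open>K * G\<close> into the opposite ring of
  \<open>D\<close>. If this second embedding is Hughes-free, then Hughes' theorem, that a Hughes-free division ring
  of fractions is unique up to an isomorphism over \<open>K * G\<close>, yields a homomorphism from \<open>D\<close> to its
  opposite ring that extends \<open>\<star>\<close>. Its square, and the quotient of any two such extensions, fix \<open>K * G\<close>,
  hence all of \<open>D\<close>; so the extension is an involution and is unique. Two things must be proved: that
  \<open>\<star>\<close> respects the crossed product structure, and Hughes' theorem.

  For the first, a locally indicable group has two unique products (\<open>two_unique_products\<close>), so every
  unit of \<open>K * G\<close> is trivial, that is of the form \<open>bar x * a\<close> (\<open>unit_is_trivial\<close>). It follows that
  \<open>\<star>\<close> preserves \<open>K\<close> and induces an involutive antiautomorphism of \<open>G\<close>, and hence that the second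
  embedding is as good as the first (\<open>adic_embedding_opposite\<close>).

  For Hughes' theorem (\<open>hughes_uniqueness\<close>), let \<open>D\<close> and \<open>D'\<close> carry Hughes-free embeddings and embed
  \<open>K * G\<close> diagonally into \<open>D \<times> D'\<close>. All that is needed is that every element obtained from the image by
  ring operations and by inverting units of \<open>D \<times> D'\<close> is either zero or a unit: then these elements form
  a division ring, which is the graph of a homomorphism. The proof is an induction on the complexity of
  the expression for such an element \<open>p\<close>. The elements of \<open>G\<close> that occur in it, suitably normalised,
  generate a subgroup \<open>H\<close> with a surjection to the integers, with kernel \<open>N\<close> say. Hughes-freeness means that
  \<open>D(K,H)\<close> embeds into the skew Laurent series in \<open>t\<close> over \<open>D(K,N)\<close>; the coefficients of the series of
  \<open>p\<close> have expressions of smaller complexity (\<open>normal_sum_expansion\<close>), so each is zero or a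
  unit; and a series with such coefficients is zero or has an invertible leading coefficient and is
  a unit (\<open>cl_zero_or_unit\<close>). This is \<open>expr_zero_or_unit\<close>.

  The complexity is a hereditary multiset, since the expansion of one inverse consists of sums of products of
  many inverses of smaller elements. Series are avoided: the valuation ring of \<open>D(K,H)\<close> is constructed
  directly as a ring of fractions (\<open>adic_V\<close>), and one works with approximations by Laurent polynomials.\<close>

section \<open>Hereditary multisets\<close>

text \<open>Hereditary multisets under the iterated multiset order, a notation for the ordinals below
  \<open>\<epsilon>\<^sub>0\<close> with natural sum. They measure rational expressions: a product is measured by the multiset of
  the elements that it inverts, a sum by the multiset of its summands.\<close>

datatype hmultiset = HMS "hmultiset multiset"

inductive hlessp :: "hmultiset \<Rightarrow> hmultiset \<Rightarrow> bool" where
  "multp hlessp A B \<Longrightarrow> hlessp (HMS A) (HMS B)"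

definition hless :: "(hmultiset \<times> hmultiset) set" where
  "hless = {(x, y). hlessp x y}"

abbreviation hmult :: "(hmultiset multiset \<times> hmultiset multiset) set" where
  "hmult \<equiv> Multiset.mult hless"

lemma hless_HMS_iff [simp]: "(HMS A, HMS B) \<in> hless \<longleftrightarrow> (A, B) \<in> hmult"
  by (auto simp: hless_def simp flip: multp_def elim: hlessp.cases intro: hlessp.intros)

lemma hless_cases:
  assumes "(x, y) \<in> hless"
  obtains A B where "x = HMS A" "y = HMS B" "(A, B) \<in> hmult"
  using assms by (cases x, cases y) auto

text \<open>Every \<open>HMS B\<close> is accessible, by induction on its structure: the members of \<open>B\<close> are accessible, so
  the predecessors of \<open>HMS B\<close> are compared by the multiset extension of a well-founded relation.\<close>

lemma wf_hless: "wf hless"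
proof -
  have acc: "h \<in> Wellfounded.acc hless" for h
  proof (induction h)
    case (HMS B)
    define r where "r = {(a, b) \<in> hless. b \<in> Wellfounded.acc hless}"
    have "wf r"
    proof (rule wfI_min)
      fix x :: hmultiset and Q assume x: "x \<in> Q"
      show "\<exists>z\<in>Q. \<forall>y. (y, z) \<in> r \<longrightarrow> y \<notin> Q"
      proof (cases "\<exists>z\<in>Q. z \<in> Wellfounded.acc hless")
        case True
        then obtain z where z: "z \<in> Wellfounded.acc hless" "z \<in> Q" by blast
        have "z \<in> Q \<longrightarrow> ?thesis"
          using z(1) by (rule acc_induct) (unfold r_def, blast)
        then show ?thesis using z(2) by blast
      next
        case False
        then show ?thesis using x by (auto simp: r_def)
      qed
    qed
    then have "wf (Multiset.mult r)" by (rule wf_mult)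
    moreover have "set_mset B \<subseteq> Wellfounded.acc hless" using HMS by blast
    ultimately show ?case
    proof (induction B rule: wf_induct_rule)
      case (less B)
      show ?case
      proof (rule accI)
        fix y assume "(y, HMS B) \<in> hless"
        then obtain A where y: "y = HMS A" and AB: "(A, B) \<in> hmult"
          by (auto elim: hless_cases)
        have "(A, B) \<in> Multiset.mult r \<and> set_mset A \<subseteq> Wellfounded.acc hless"
          using AB unfolding Multiset.mult_def
        proof (induction rule: converse_trancl_induct)
          case (base A)
          then have "set_mset A \<subseteq> Wellfounded.acc hless" "(A, B) \<in> Multiset.mult1 r"
            using less.prems
            by (fastforce simp: Multiset.mult1_def r_def intro: acc_downward)+
          then show ?case by auto
        next
          case (step A C)
          then have "set_mset A \<subseteq> Wellfounded.acc hless" "(A, C) \<in> Multiset.mult1 r"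
            by (fastforce simp: Multiset.mult1_def r_def intro: acc_downward)+
          then show ?case using step by (auto intro: trancl_into_trancl2)
        qed
        then show "y \<in> Wellfounded.acc hless" unfolding y using less.IH by blast
      qed
    qed
  qed
  show ?thesis by (rule acc_wfI) (use acc in auto)
qed

lemma trans_hless: "trans hless"
proof (rule transI)
  fix x y z assume "(x, y) \<in> hless" "(y, z) \<in> hless"
  then show "(x, z) \<in> hless"
    by (auto elim!: hless_cases simp: Multiset.mult_def intro: trancl_trans)
qed

lemma hless_irrefl: "(x, x) \<notin> hless"
  using wf_hless by auto

lemma hless_multI:
  assumes "J \<noteq> {#}" "\<And>k. k \<in># K \<Longrightarrow> \<exists>j\<in>#J. (k, j) \<in> hless"
  shows "(I + K, I + J) \<in> hmult"
  using assms by (intro one_step_implies_mult) auto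

lemma hmult_trans: "(A, B) \<in> hmult \<Longrightarrow> (B, C) \<in> hmult \<Longrightarrow> (A, C) \<in> hmult"
  by (auto simp: Multiset.mult_def)

lemma hmult_add_left: "(A, B) \<in> hmult \<Longrightarrow> (C + A, C + B) \<in> hmult"
  using mult_cancel[OF trans_hless, of C A B] by (auto simp: irrefl_on_def hless_irrefl ac_simps)

lemma hmult_add_right: "(A, B) \<in> hmult \<Longrightarrow> (A + C, B + C) \<in> hmult"
  using hmult_add_left[of A B C] by (simp add: ac_simps)

lemma hmult_empty: "B \<noteq> {#} \<Longrightarrow> ({#}, B) \<in> hmult"
  using hless_multI[of B "{#}" "{#}"] by simp

text \<open>The inequality \<open>\<alpha> < \<omega>\<^sup>\<alpha>\<close> of ordinals below \<open>\<epsilon>\<^sub>0\<close>. It makes subexpressions smaller than the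
  expressions in which they occur.\<close>

lemma hless_singleton: "(h, HMS {#h#}) \<in> hless"
proof (induction h)
  case (HMS A)
  have "\<exists>j\<in>#{#HMS A#}. (a, j) \<in> hless" if "a \<in># A" for a
  proof -
    have "{#a#} \<subseteq># A" using that by simp
    then obtain B where "A = {#a#} + B" by (metis subset_mset.add_diff_inverse)
    then have "A = {#a#} \<or> ({#a#}, A) \<in> hmult"
      using hless_multI[of B "{#}" "{#a#}"] by auto
    then show ?thesis
      using HMS[OF that] transD[OF trans_hless, of a "HMS {#a#}" "HMS A"] by auto
  qed
  then show ?case using hless_multI[of "{#HMS A#}" A "{#}"] by auto
qed

lemma hless_member:
  assumes "a \<in># A"
  shows "(a, HMS A) \<in> hless"
proof -
  obtain B where "A = {#a#} + B" using assms by (metis mset_add add_mset_add_single add.commute)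
  then have "A = {#a#} \<or> ({#a#}, A) \<in> hmult"
    using hless_multI[of B "{#}" "{#a#}"] by auto
  then show ?thesis
    using hless_singleton[of a] transD[OF trans_hless, of a "HMS {#a#}" "HMS A"] by auto
qed

section \<open>Completions along a valuation\<close>

definition invertible :: "'a::ring_1 \<Rightarrow> bool" where
  "invertible x \<longleftrightarrow> (\<exists>y. x * y = 1 \<and> y * x = 1)"

lemma two_sided_inverse_unique:
  fixes x :: "'a::ring_1"
  assumes "x * y = 1" "z * x = 1"
  shows "y = z"
  by (metis assms mult.assoc mult_1_left mult_1_right)

lemma unital_subringD:
  assumes "unital_subring R"
  shows "0 \<in> R" "1 \<in> R" "a \<in> R \<Longrightarrow> b \<in> R \<Longrightarrow> a - b \<in> R" "a \<in> R \<Longrightarrow> b \<in> R \<Longrightarrow> a * b \<in> R"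
    "a \<in> R \<Longrightarrow> - a \<in> R" "a \<in> R \<Longrightarrow> b \<in> R \<Longrightarrow> a + b \<in> R"
proof -
  show 1: "1 \<in> R" and d: "a \<in> R \<Longrightarrow> b \<in> R \<Longrightarrow> a - b \<in> R" for a b
    using assms by (auto simp: unital_subring_def)
  show "a \<in> R \<Longrightarrow> b \<in> R \<Longrightarrow> a * b \<in> R"
    using assms by (auto simp: unital_subring_def)
  show 0: "0 \<in> R" using d[OF 1 1] by simp
  show neg: "a \<in> R \<Longrightarrow> - a \<in> R" for a using d[OF 0, of a] by simp
  show "a \<in> R \<Longrightarrow> b \<in> R \<Longrightarrow> a + b \<in> R" using d[of a "- b"] neg[of b] by simp
qed

lemma unital_subring_sum:
  assumes "unital_subring R" "\<And>i. i \<in> I \<Longrightarrow> f i \<in> R"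
  shows "sum f I \<in> R"
  using assms(2) by (induction I rule: infinite_finite_induct) (auto intro: unital_subringD[OF assms(1)])

text \<open>The \<open>t\<close>-adic filtration of a ring of skew Laurent series over \<open>F\<close>, or of a subring of it:
  \<open>T n\<close> stands for the \<open>n\<close>-th power of \<open>t\<close>, and \<open>V\<close> for the elements without negative powers. The ring \<open>F\<close> of
  coefficients need not be a division ring, so that the product of two such structures is
  again one.\<close>

locale adic =
  fixes T :: "int \<Rightarrow> 'r::ring_1" and V F :: "'r set"
  assumes T_0 [simp]: "T 0 = 1" and T_add: "T (m + n) = T m * T n"
    and V: "unital_subring V" and F: "unital_subring F" and F_V: "F \<subseteq> V"
    and T_V: "T 1 \<in> V"
    and V_conj: "v \<in> V \<Longrightarrow> T n * v * T (- n) \<in> V"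
    and F_conj: "c \<in> F \<Longrightarrow> T n * c * T (- n) \<in> F"
    and F_inverse: "c \<in> F \<Longrightarrow> c * c' = 1 \<Longrightarrow> c' * c = 1 \<Longrightarrow> c' \<in> F"
    and V_unit: "v \<in> V \<Longrightarrow> \<exists>w\<in>V. (1 + T 1 * v) * w = 1 \<and> w * (1 + T 1 * v) = 1"
    and separated: "(\<And>n. \<exists>v\<in>V. x = T n * v) \<Longrightarrow> x = 0"
begin

lemma T_inv [simp]: "T n * T (- n) = 1" "T (- n) * T n = 1"
  using T_add[of n "- n"] T_add[of "- n" n] by auto

lemma T_cancel [simp]: "T n * (T (- n) * x) = x" "T (- n) * (T n * x) = x"
  by (simp_all flip: mult.assoc)

lemma T_nonneg:
  assumes "n \<ge> 0" shows "T n \<in> V"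
proof -
  have "T (int k) \<in> V" for k
    by (induction k) (use T_V T_add in \<open>auto intro: unital_subringD[OF V]\<close>)
  then show ?thesis using assms by (metis nonneg_int_cases)
qed

definition level :: "int \<Rightarrow> 'r set" where
  "level m = {T m * v | v. v \<in> V}"

lemma level_iff: "x \<in> level m \<longleftrightarrow> T (- m) * x \<in> V"
proof
  assume "T (- m) * x \<in> V"
  then show "x \<in> level m" unfolding level_def
    by (intro CollectI exI[of _ "T (- m) * x"]) simp
qed (auto simp: level_def)

lemma level_0: "level 0 = V"
  by (auto simp: level_iff)

lemma level_zero [simp]: "0 \<in> level m"
  by (simp add: level_iff unital_subringD[OF V])

lemma level_add: "x \<in> level m \<Longrightarrow> y \<in> level m \<Longrightarrow> x + y \<in> level m"
  by (simp add: level_iff distrib_left unital_subringD[OF V])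

lemma level_minus: "x \<in> level m \<Longrightarrow> - x \<in> level m"
  by (simp add: level_iff unital_subringD[OF V])

lemma level_mono:
  assumes "m \<le> n" "x \<in> level n" shows "x \<in> level m"
proof -
  have "T (- m) * x = T (n - m) * (T (- n) * x)"
    using T_add[of "n - m" "- n"] by (simp add: mult.assoc)
  then show ?thesis
    using assms T_nonneg[of "n - m"] by (auto simp: level_iff intro: unital_subringD[OF V])
qed

lemma level_mult:
  assumes "x \<in> level m" "y \<in> level n" shows "x * y \<in> level (m + n)"
proof -
  obtain v w where vw: "x = T m * v" "y = T n * w" "v \<in> V" "w \<in> V"
    using assms by (auto simp: level_def)
  have "T m * v * (T n * w) = T (m + n) * ((T (- n) * v * T (- (- n))) * w)"
    unfolding T_add by (simp add: mult.assoc)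
  moreover have "(T (- n) * v * T (- (- n))) * w \<in> V"
    using V_conj[of v "- n"] vw by (auto intro: unital_subringD[OF V])
  ultimately show ?thesis using vw by (auto simp: level_def)
qed

lemma level_T: "T m \<in> level m"
  by (simp add: level_iff unital_subringD[OF V])

lemma level_sum: "(\<And>i. i \<in> I \<Longrightarrow> f i \<in> level m) \<Longrightarrow> sum f I \<in> level m"
  by (induction I rule: infinite_finite_induct) (auto intro: level_add)

lemma level_term: "c \<in> V \<Longrightarrow> m \<le> n \<Longrightarrow> T n * c \<in> level m"
  using level_mono[of m n] by (auto simp: level_def)

text \<open>In the completion, \<open>cl C\<close> would be the set of Laurent series with coefficients in \<open>C\<close>. The order of
  quantifiers allows the approximating Laurent polynomials to be unrelated to each other, which
  makes explicit formulas for the coefficients of products and inverses unnecessary.\<close>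

definition laurent :: "'r set \<Rightarrow> 'r set" where
  "laurent C = {\<Sum>n\<in>I. T n * c n | I c. finite I \<and> (\<forall>n\<in>I. c n \<in> C)}"

definition cl :: "'r set \<Rightarrow> 'r set" where
  "cl C = {x. \<forall>m. \<exists>p\<in>laurent C. x - p \<in> level m}"

lemma laurentI: "finite I \<Longrightarrow> (\<And>n. n \<in> I \<Longrightarrow> c n \<in> C) \<Longrightarrow> (\<Sum>n\<in>I. T n * c n) \<in> laurent C"
  by (auto simp: laurent_def)

lemma laurentE:
  assumes "p \<in> laurent C"
  obtains c I where "p = (\<Sum>n\<in>I. T n * c n)" "finite I" "\<forall>n\<in>I. c n \<in> C"
  using assms by (auto simp: laurent_def)

lemma laurent_single: "c \<in> C \<Longrightarrow> T n * c \<in> laurent C"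
  using laurentI[of "{n}" "\<lambda>_. c" C] by simp

lemma laurent_mono: "C \<subseteq> C' \<Longrightarrow> laurent C \<subseteq> laurent C'"
  by (fastforce simp: laurent_def)

lemma laurent_add:
  assumes "p \<in> laurent C" "q \<in> laurent C'" "0 \<in> C" "0 \<in> C'"
    and C'': "\<And>c c'. c \<in> C \<Longrightarrow> c' \<in> C' \<Longrightarrow> c + c' \<in> C''"
  shows "p + q \<in> laurent C''"
proof -
  obtain c I where p: "p = (\<Sum>n\<in>I. T n * c n)" "finite I" "\<forall>n\<in>I. c n \<in> C"
    using assms(1) by (rule laurentE)
  obtain d J where q: "q = (\<Sum>n\<in>J. T n * d n)" "finite J" "\<forall>n\<in>J. d n \<in> C'"
    using assms(2) by (rule laurentE)
  define c' where "c' n = (if n \<in> I then c n else 0)" for n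
  define d' where "d' n = (if n \<in> J then d n else 0)" for n
  have "p = (\<Sum>n\<in>I \<union> J. T n * c' n)" "q = (\<Sum>n\<in>I \<union> J. T n * d' n)"
    unfolding p q c'_def d'_def by (rule sum.mono_neutral_cong_left; use p q in auto)+
  then have "p + q = (\<Sum>n\<in>I \<union> J. T n * (c' n + d' n))"
    by (simp add: sum.distrib distrib_left)
  also have "\<dots> \<in> laurent C''"
    using p q assms by (intro laurentI C'') (auto simp: c'_def d'_def)
  finally show ?thesis .
qed

lemma laurent_sum:
  assumes "0 \<in> C" "\<And>c d. c \<in> C \<Longrightarrow> d \<in> C \<Longrightarrow> c + d \<in> C" "\<And>i. i \<in> I \<Longrightarrow> f i \<in> laurent C"
  shows "sum f I \<in> laurent C"
  using assms(3)
proof (induction I rule: infinite_finite_induct)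
  case (insert i I)
  then show ?case using laurent_add[of "f i" C "sum f I" C C] assms(1,2) by simp
qed (use laurentI[of "{}"] in auto)

lemma laurent_mult:
  assumes "p \<in> laurent C" "q \<in> laurent C'" "0 \<in> C''"
    and add: "\<And>c d. c \<in> C'' \<Longrightarrow> d \<in> C'' \<Longrightarrow> c + d \<in> C''"
    and mult: "\<And>c c' n. c \<in> C \<Longrightarrow> c' \<in> C' \<Longrightarrow> T (- n) * c * T n * c' \<in> C''"
  shows "p * q \<in> laurent C''"
proof -
  obtain c I where p: "p = (\<Sum>n\<in>I. T n * c n)" "finite I" "\<forall>n\<in>I. c n \<in> C"
    using assms(1) by (rule laurentE)
  obtain d J where q: "q = (\<Sum>n\<in>J. T n * d n)" "finite J" "\<forall>n\<in>J. d n \<in> C'"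
    using assms(2) by (rule laurentE)
  have "p * q = (\<Sum>i\<in>I. \<Sum>j\<in>J. T i * c i * (T j * d j))"
    unfolding p q by (simp add: sum_product)
  also have "\<dots> = (\<Sum>i\<in>I. \<Sum>j\<in>J. T (i + j) * (T (- j) * c i * T j * d j))"
    unfolding T_add by (simp add: mult.assoc)
  also have "\<dots> \<in> laurent C''"
    using p q by (intro laurent_sum laurent_single mult add assms(3)) auto
  finally show ?thesis .
qed

lemma laurent_bounded:
  assumes "p \<in> laurent C" "C \<subseteq> F"
  obtains m where "p \<in> level m"
proof -
  obtain c I where p: "p = (\<Sum>n\<in>I. T n * c n)" "finite I" "\<forall>n\<in>I. c n \<in> C"
    using assms(1) by (rule laurentE)
  have "p \<in> level (Min (insert 0 I))" unfolding p
    by (intro level_sum level_term) (use p assms F_V in auto)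
  then show ?thesis by (rule that)
qed

lemma clI: "(\<And>m. \<exists>p\<in>laurent C. x - p \<in> level m) \<Longrightarrow> x \<in> cl C"
  by (auto simp: cl_def)

lemma clE:
  assumes "x \<in> cl C"
  obtains p where "p \<in> laurent C" "x - p \<in> level m"
  using assms by (auto simp: cl_def)

lemma laurent_cl: "p \<in> laurent C \<Longrightarrow> p \<in> cl C"
  by (rule clI) (auto intro!: bexI[of _ p])

lemma cl_mono: "C \<subseteq> C' \<Longrightarrow> cl C \<subseteq> cl C'"
  using laurent_mono[of C C'] by (fastforce simp: cl_def)

lemma cl_bounded:
  assumes "x \<in> cl C" "C \<subseteq> F"
  obtains m where "x \<in> level m"
proof -
  obtain p where p: "p \<in> laurent C" "x - p \<in> level 0" using assms(1) by (rule clE)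
  obtain m where "p \<in> level m" using p(1) assms(2) by (rule laurent_bounded)
  then have "(x - p) + p \<in> level (min m 0)"
    using p by (intro level_add) (auto intro: level_mono[rotated])
  then show ?thesis using that by simp
qed

lemma cl_add:
  assumes "x \<in> cl C" "y \<in> cl C'" "0 \<in> C" "0 \<in> C'"
    and "\<And>c c'. c \<in> C \<Longrightarrow> c' \<in> C' \<Longrightarrow> c + c' \<in> C''"
  shows "x + y \<in> cl C''"
proof (rule clI)
  fix m
  obtain p where p: "p \<in> laurent C" "x - p \<in> level m" using assms(1) by (rule clE)
  obtain q where q: "q \<in> laurent C'" "y - q \<in> level m" using assms(2) by (rule clE)
  have "x + y - (p + q) \<in> level m" using level_add[OF p(2) q(2)] by (simp add: algebra_simps)
  then show "\<exists>p\<in>laurent C''. x + y - p \<in> level m"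
    using laurent_add[OF p(1) q(1) assms(3-5)] by blast
qed

lemma cl_mult:
  assumes "x \<in> cl C" "y \<in> cl C'" "C \<subseteq> F" "C' \<subseteq> F" "0 \<in> C''"
    and add: "\<And>c d. c \<in> C'' \<Longrightarrow> d \<in> C'' \<Longrightarrow> c + d \<in> C''"
    and mult: "\<And>c c' n. c \<in> C \<Longrightarrow> c' \<in> C' \<Longrightarrow> T (- n) * c * T n * c' \<in> C''"
  shows "x * y \<in> cl C''"
proof (rule clI)
  fix m
  obtain b where b: "y \<in> level b" using assms(2,4) by (rule cl_bounded)
  obtain p where p: "p \<in> laurent C" "x - p \<in> level (m - b)" using assms(1) by (rule clE)
  obtain a where a: "p \<in> level a" using p(1) assms(3) by (rule laurent_bounded)
  obtain q where q: "q \<in> laurent C'" "y - q \<in> level (m - a)" using assms(2) by (rule clE)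
  have "(x - p) * y + p * (y - q) \<in> level m"
    using level_mult[OF p(2) b] level_mult[OF a q(2)] by (intro level_add) auto
  then have "x * y - p * q \<in> level m" by (simp add: algebra_simps)
  then show "\<exists>p\<in>laurent C''. x * y - p \<in> level m"
    using laurent_mult[OF p(1) q(1) assms(5) add mult] by blast
qed

lemma cl_closed:
  assumes "\<And>m. \<exists>y\<in>cl C. x - y \<in> level m"
  shows "x \<in> cl C"
proof (rule clI)
  fix m
  obtain y where y: "y \<in> cl C" "x - y \<in> level m" using assms by blast
  obtain p where p: "p \<in> laurent C" "y - p \<in> level m" using y(1) by (rule clE)
  have "x - p \<in> level m" using level_add[OF y(2) p(2)] by simp
  then show "\<exists>p\<in>laurent C. x - p \<in> level m" using p(1) by blast
qed

lemma unital_subring_cl: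
  assumes C: "unital_subring C" "C \<subseteq> F" and conj: "\<And>c n. c \<in> C \<Longrightarrow> T (- n) * c * T n \<in> C"
  shows "unital_subring (cl C)"
proof -
  note R = unital_subringD[OF C(1)]
  have 1: "- 1 \<in> cl C" using laurent_cl[OF laurent_single[of "-1" C 0]] R by simp
  have mult: "x * y \<in> cl C" if "x \<in> cl C" "y \<in> cl C" for x y
    by (rule cl_mult[OF that C(2) C(2)]) (auto intro: R(1,4,6) conj)
  have "x - y \<in> cl C" if "x \<in> cl C" "y \<in> cl C" for x y
    using cl_add[OF that(1) mult[OF 1 that(2)], of C] R by auto
  moreover have "1 \<in> cl C" using mult[OF 1 1] by simp
  ultimately show ?thesis using mult by (auto simp: unital_subring_def)
qed

text \<open>A nonzero \<open>x\<close> has a leading term \<open>T k * c\<close>, read off from a sufficiently close Laurent polynomial.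
  As its coefficient is invertible, \<open>x\<close> is \<open>T k * c\<close> times an element \<open>1 - y\<close> with \<open>y\<close> of positive
  valuation, and the inverse of \<open>1 - y\<close> is the limit of the partial sums of the geometric series, which stay
  in the closed subring \<open>cl C\<close>.\<close>

lemma cl_zero_or_unit:
  assumes x: "x \<in> cl B" and B: "B \<subseteq> C"
    and C: "unital_subring C" "C \<subseteq> F" and conj: "\<And>c n. c \<in> C \<Longrightarrow> T (- n) * c * T n \<in> C"
    and zu: "\<And>b. b \<in> B \<Longrightarrow> b = 0 \<or> (\<exists>b'\<in>C. b * b' = 1 \<and> b' * b = 1)"
  shows "x = 0 \<or> (\<exists>y\<in>cl C. x * y = 1 \<and> y * x = 1)"
proof (cases "x = 0")
  case False
  then obtain m where m: "x \<notin> level m"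
    using separated[of x] by (auto simp: level_def)
  obtain p where p: "p \<in> laurent B" "x - p \<in> level m" using x by (rule clE)
  obtain c I where I: "p = (\<Sum>n\<in>I. T n * c n)" "finite I" "\<forall>n\<in>I. c n \<in> B"
    using p(1) by (rule laurentE)
  have cV: "c n \<in> V" if "n \<in> I" for n using bspec[OF I(3) that] B C(2) F_V by blast
  \<comment> \<open>The exponents from \<open>m\<close> on are absorbed by the error term; one of the others remains, as \<open>x\<close> is not in \<open>level m\<close>.\<close>
  define J where "J = {n \<in> I. n < m \<and> c n \<noteq> 0}"
  have "finite J" using I(2) by (simp add: J_def)
  have rest: "x - (\<Sum>n\<in>J. T n * c n) \<in> level m"
  proof -
    have eq: "p = (\<Sum>n\<in>I - J. T n * c n) + (\<Sum>n\<in>J. T n * c n)"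
      unfolding I(1) by (rule sum.subset_diff) (use I(2) in \<open>auto simp: J_def\<close>)
    have "(\<Sum>n\<in>I - J. T n * c n) \<in> level m"
    proof (rule level_sum)
      fix n assume "n \<in> I - J"
      then show "T n * c n \<in> level m" by (cases "c n = 0") (auto simp: J_def intro!: level_term cV)
    qed
    from level_add[OF p(2) this] show ?thesis unfolding eq by simp
  qed
  have "J \<noteq> {}" using rest m by auto
  define k where "k = Min J"
  have k: "k \<in> J" "\<And>n. n \<in> J \<Longrightarrow> k \<le> n"
    using \<open>finite J\<close> \<open>J \<noteq> {}\<close> by (auto simp: k_def)
  obtain b where b: "b \<in> C" "c k * b = 1" "b * c k = 1"
    using zu[OF bspec[OF I(3)], of k] k(1) by (auto simp: J_def)
  have bV: "b \<in> V" using b C(2) F_V by blast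
  have "x - T k * c k \<in> level (k + 1)"
  proof -
    have eq: "(\<Sum>n\<in>J. T n * c n) = T k * c k + (\<Sum>n\<in>J - {k}. T n * c n)"
      using \<open>finite J\<close> k(1) by (rule sum.remove)
    have "(\<Sum>n\<in>J - {k}. T n * c n) \<in> level (k + 1)"
    proof (rule level_sum)
      fix n assume n: "n \<in> J - {k}"
      then have "k < n" using k(2)[of n] by auto
      then show "T n * c n \<in> level (k + 1)"
        using n by (intro level_term) (auto simp: J_def intro: cV)
    qed
    moreover have "x - (\<Sum>n\<in>J. T n * c n) \<in> level (k + 1)"
      using k(1) by (intro level_mono[OF _ rest]) (auto simp: J_def)
    ultimately have "(\<Sum>n\<in>J - {k}. T n * c n) + (x - (\<Sum>n\<in>J. T n * c n)) \<in> level (k + 1)"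
      by (rule level_add)
    then show ?thesis unfolding eq by simp
  qed
  then have "(b * T (- k)) * (x - T k * c k) \<in> level (0 + (- k) + (k + 1))"
    by (intro level_mult) (auto simp: level_T level_0 bV)
  then have lead: "b * T (- k) * x - 1 \<in> level 1"
    using b by (simp add: right_diff_distrib mult.assoc)
  have cl_C: "unital_subring (cl C)" using C conj by (rule unital_subring_cl)
  note S = unital_subringD[OF cl_C]
  have "T (- k) \<in> cl C" "T k \<in> cl C" "b \<in> cl C"
    using laurent_cl[OF laurent_single[of 1 C]] laurent_cl[OF laurent_single[of b C 0]] b(1)
      unital_subringD(2)[OF C(1)] by auto
  define z where "z = b * T (- k) * x"
  have z: "z \<in> cl C" unfolding z_def
    using \<open>T (- k) \<in> cl C\<close> \<open>b \<in> cl C\<close> x cl_mono[OF B] by (intro S(4)) auto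
  obtain v where v: "v \<in> V" "z = 1 + T 1 * v"
    using lead by (auto simp: z_def level_def algebra_simps)
  obtain w where w: "w \<in> V" "z * w = 1" "w * z = 1"
    using V_unit[OF v(1)] v(2) by auto
  define y where "y = 1 - z"
  have y: "y \<in> level 1" "y \<in> cl C"
    using level_minus[OF level_term[OF v(1), of 1 1]] S(3)[OF S(2) z] v(2) by (auto simp: y_def)
  have pow: "y ^ n \<in> level (int n)" "y ^ n \<in> cl C" for n
  proof (induction n)
    case (Suc n)
    then show "y ^ Suc n \<in> level (int (Suc n))" "y ^ Suc n \<in> cl C"
      using level_mult[OF y(1), of "y ^ n" "int n"] y(2) S by auto
  qed (auto simp: level_0 unital_subringD[OF V] S)
  have geom: "(\<Sum>i<n. y ^ i) = w - y ^ n * w" for n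
  proof (induction n)
    case (Suc n)
    have "y ^ n = y ^ n * (z * w)" using w by simp
    then have "(\<Sum>i<Suc n. y ^ i) = w - y ^ n * w + y ^ n * (z * w)" using Suc by simp
    also have "\<dots> = w - y ^ n * y * w" by (simp add: y_def algebra_simps)
    finally show ?case by (simp add: power_commutes)
  qed simp
  have "w \<in> cl C"
  proof (rule cl_closed)
    fix m
    have "y ^ nat m * w \<in> level (int (nat m) + 0)"
      by (rule level_mult[OF pow(1)]) (simp add: level_0 w(1))
    then have "w - (\<Sum>i<nat m. y ^ i) \<in> level m"
      unfolding geom by (auto intro: level_mono[rotated])
    moreover have "(\<Sum>i<nat m. y ^ i) \<in> cl C"
      using pow by (intro unital_subring_sum[OF cl_C]) auto
    ultimately show "\<exists>y\<in>cl C. w - y \<in> level m" by blast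
  qed
  have cb: "c k * (b * y) = y" for y using b by (simp flip: mult.assoc)
  have "x * (w * b * T (- k)) = T k * c k * (b * T (- k) * x) * (w * b * T (- k))"
    by (simp add: mult.assoc cb)
  also have "\<dots> = T k * (c k * (z * w) * b) * T (- k)" by (simp add: z_def mult.assoc)
  also have "\<dots> = 1" using w b by simp
  finally have "x * (w * b * T (- k)) = 1" .
  moreover have "w * b * T (- k) * x = 1" using w by (simp add: z_def mult.assoc)
  moreover have "w * b * T (- k) \<in> cl C"
    using \<open>w \<in> cl C\<close> \<open>b \<in> cl C\<close> \<open>T (- k) \<in> cl C\<close> by (intro S(4))
  ultimately show ?thesis by blast
qed simp

end

section \<open>Rational expressions in graded units\<close>

text \<open>The trivial units of a crossed product, graded by the group; \<open>insert 0 (U \<one>)\<close> is the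
  coefficient division ring. This is all that the argument needs to know of the crossed product, and it
  survives embedding the crossed product into another ring.\<close>

locale graded_units = Group.group G for G :: "('g, 'm) monoid_scheme" (structure) +
  fixes U :: "'g \<Rightarrow> 'r::ring_1 set"
  assumes U_mult: "x \<in> carrier G \<Longrightarrow> y \<in> carrier G \<Longrightarrow> u \<in> U x \<Longrightarrow> v \<in> U y \<Longrightarrow> u * v \<in> U (x \<otimes> y)"
    and U_inverse: "x \<in> carrier G \<Longrightarrow> u \<in> U x \<Longrightarrow> \<exists>v\<in>U (inv x). u * v = 1 \<and> v * u = 1"
    and U_nonempty: "x \<in> carrier G \<Longrightarrow> U x \<noteq> {}"
    and U_minus_one: "- 1 \<in> U \<one>"
    and U_add: "u \<in> U \<one> \<Longrightarrow> v \<in> U \<one> \<Longrightarrow> u + v \<in> insert 0 (U \<one>)"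
begin

lemma U_one: "1 \<in> U \<one>"
  using U_mult[OF one_closed one_closed U_minus_one U_minus_one] by simp

text \<open>In \<open>monomial X m p g\<close> the element \<open>p\<close> is a unit of degree \<open>g\<close> times a product of inverses of normal
  sums, whose measures form \<open>m\<close>; in \<open>normal_sum X h p\<close> it is a sum of monomials, whose measures form \<open>h\<close>.
  The set \<open>X\<close> collects the degrees that occur. A normal sum is required to have a first summand of degree
  one. Hence a degree map that is constant on the summands of every normal sum that occurs vanishes on
  \<open>X\<close>, and so on the group that \<open>X\<close> generates.\<close>

inductive monomial :: "'g set \<Rightarrow> hmultiset multiset \<Rightarrow> 'r \<Rightarrow> 'g \<Rightarrow> bool"
  and normal_sum :: "'g set \<Rightarrow> hmultiset multiset \<Rightarrow> 'r \<Rightarrow> bool" where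
  monomial_unit: "g \<in> carrier G \<Longrightarrow> u \<in> U g \<Longrightarrow> monomial {} {#} u g"
| monomial_div: "monomial X m p g \<Longrightarrow> normal_sum Y h q \<Longrightarrow> q * r = 1 \<Longrightarrow> r * q = 1 \<Longrightarrow>
    monomial (X \<union> Y) (add_mset (HMS h) m) (p * r) g"
| normal_sum_single: "monomial X m p \<one> \<Longrightarrow> normal_sum X {#HMS m#} p"
| normal_sum_add: "normal_sum X h p \<Longrightarrow> monomial Y m q g \<Longrightarrow>
    normal_sum (insert g (X \<union> Y)) (add_mset (HMS m) h) (p + q)"

text \<open>Sums of monomials of arbitrary degrees, as they occur as coefficients of expansions.\<close>

inductive expr :: "hmultiset multiset \<Rightarrow> 'r \<Rightarrow> bool" where
  expr_zero: "expr {#} 0"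
| expr_add: "expr h p \<Longrightarrow> monomial X m q g \<Longrightarrow> expr (add_mset (HMS m) h) (p + q)"

lemma monomial_carrier: "monomial X m p g \<Longrightarrow> finite X \<and> X \<subseteq> carrier G \<and> g \<in> carrier G"
  and normal_sum_carrier: "normal_sum X h p \<Longrightarrow> finite X \<and> X \<subseteq> carrier G"
  by (induction rule: monomial_normal_sum.inducts) auto

lemma normal_sum_nonempty: "normal_sum X h p \<Longrightarrow> h \<noteq> {#}"
  by (auto elim: normal_sum.cases)

lemma monomial_unit_mult:
  "monomial X m p g \<Longrightarrow> x \<in> carrier G \<Longrightarrow> u \<in> U x \<Longrightarrow> monomial X m (u * p) (x \<otimes> g)"
  "normal_sum X h q \<Longrightarrow> True"
proof (induction rule: monomial_normal_sum.inducts)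
  case (monomial_div X m p g Y h q r)
  then show ?case
    using monomial_normal_sum.monomial_div[of X m "u * p" "x \<otimes> g" Y h q r] by (simp add: mult.assoc)
qed (auto intro: monomial_unit U_mult)

lemma conj_monomial:
  "monomial X m p g \<Longrightarrow> x \<in> carrier G \<Longrightarrow> u \<in> U x \<Longrightarrow> v \<in> U (inv x) \<Longrightarrow> v * u = 1 \<Longrightarrow> u * v = 1 \<Longrightarrow>
     monomial ((\<lambda>y. x \<otimes> y \<otimes> inv x) ` X) m (u * p * v) (x \<otimes> g \<otimes> inv x)"
  and conj_normal_sum:
  "normal_sum X h q \<Longrightarrow> x \<in> carrier G \<Longrightarrow> u \<in> U x \<Longrightarrow> v \<in> U (inv x) \<Longrightarrow> v * u = 1 \<Longrightarrow> u * v = 1 \<Longrightarrow>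
     normal_sum ((\<lambda>y. x \<otimes> y \<otimes> inv x) ` X) h (u * q * v)"
proof (induction rule: monomial_normal_sum.inducts)
  case (monomial_unit g w)
  then have "u * w * v \<in> U (x \<otimes> g \<otimes> inv x)" by (intro U_mult) auto
  then show ?case
    using monomial_normal_sum.monomial_unit[of "x \<otimes> g \<otimes> inv x" "u * w * v"] monomial_unit by auto
next
  case (monomial_div X m p g Y h q r)
  have cancel: "v * (u * y) = y" for y using monomial_div.prems by (simp flip: mult.assoc)
  have "u * q * v * (u * r * v) = u * (q * r) * v" "u * r * v * (u * q * v) = u * (r * q) * v"
    by (simp_all add: mult.assoc cancel)
  then have "u * q * v * (u * r * v) = 1" "u * r * v * (u * q * v) = 1"
    using monomial_div by auto
  then have "monomial ((\<lambda>y. x \<otimes> y \<otimes> inv x) ` X \<union> (\<lambda>y. x \<otimes> y \<otimes> inv x) ` Y)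
      (add_mset (HMS h) m) (u * p * v * (u * r * v)) (x \<otimes> g \<otimes> inv x)"
    using monomial_div.IH(2)[OF monomial_div.prems] monomial_div.IH(4)[OF monomial_div.prems]
    by (intro monomial_normal_sum.monomial_div) auto
  moreover have "u * p * v * (u * r * v) = u * (p * r) * v"
    by (simp add: mult.assoc cancel)
  ultimately show ?case by (simp add: image_Un)
next
  case (normal_sum_single X m p)
  then show ?case by (auto intro: monomial_normal_sum.normal_sum_single)
next
  case (normal_sum_add X h p Y m q g)
  then show ?case
    using monomial_normal_sum.normal_sum_add[OF normal_sum_add.IH(2)[OF normal_sum_add.prems]
        normal_sum_add.IH(4)[OF normal_sum_add.prems]]
    by (simp add: image_Un distrib_left distrib_right)
qed

lemma monomial_mult_unit:
  "monomial X m p g \<Longrightarrow> x \<in> carrier G \<Longrightarrow> u \<in> U x \<Longrightarrow> \<exists>Y. monomial Y m (p * u) (g \<otimes> x)"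
  "normal_sum X h q \<Longrightarrow> True"
proof (induction rule: monomial_normal_sum.inducts)
  case (monomial_unit g w)
  then show ?case using monomial_normal_sum.monomial_unit[of "g \<otimes> x" "w * u"] U_mult by auto
next
  case (monomial_div X m p g Y h q r)
  obtain v where v: "v \<in> U (inv x)" "u * v = 1" "v * u = 1"
    using U_inverse monomial_div.prems by blast
  have c: "u * (v * y) = y" for y using v by (simp flip: mult.assoc)
  obtain Z where Z: "monomial Z m (p * u) (g \<otimes> x)" using monomial_div.IH(2) monomial_div.prems by blast
  have "v * q * u * (v * r * u) = v * (q * r) * u" "v * r * u * (v * q * u) = v * (r * q) * u"
    by (simp_all add: mult.assoc c)
  then have "v * q * u * (v * r * u) = 1" "v * r * u * (v * q * u) = 1"
    using monomial_div v by auto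
  moreover have "normal_sum ((\<lambda>y. inv x \<otimes> y \<otimes> inv (inv x)) ` Y) h (v * q * u)"
    using v monomial_div.prems by (intro conj_normal_sum[OF monomial_div.IH(3)]) auto
  ultimately have "monomial (Z \<union> (\<lambda>y. inv x \<otimes> y \<otimes> inv (inv x)) ` Y) (add_mset (HMS h) m)
      (p * u * (v * r * u)) (g \<otimes> x)"
    using Z by (intro monomial_normal_sum.monomial_div)
  then show ?case by (auto simp: mult.assoc c)
qed auto

text \<open>Dividing by a unit of the degree of some summand makes an expression normal. Here and in
  \<open>monomial_inverse\<close> below it matters that units can be moved past inverses without a change of the
  measure, by conjugating the inverted normal sums.\<close>

lemma expr_normalise:
  "expr h p \<Longrightarrow> h = {#} \<and> p = 0 \<or> (\<exists>X x u q. normal_sum X h q \<and> x \<in> carrier G \<and> u \<in> U x \<and> p = u * q)"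
proof (induction rule: expr.induct)
  case (expr_add h p Y m q g)
  have g: "g \<in> carrier G" using expr_add monomial_carrier by blast
  from expr_add.IH show ?case
  proof (elim disjE conjE exE)
    assume hp: "h = {#}" "p = 0"
    obtain u where u: "u \<in> U g" using U_nonempty[OF g] by blast
    obtain v where v: "v \<in> U (inv g)" "u * v = 1" "v * u = 1" using U_inverse[OF g u] by blast
    have "normal_sum Y {#HMS m#} (v * q)"
      using monomial_unit_mult(1)[OF expr_add.hyps(2) inv_closed[OF g] v(1)] g
      by (intro normal_sum_single) auto
    moreover have "q = u * (v * q)" using v by (simp flip: mult.assoc)
    ultimately show ?thesis using hp g u by auto
  next
    fix X x u p' assume *: "normal_sum X h p'" "x \<in> carrier G" "u \<in> U x" "p = u * p'"
    obtain v where v: "v \<in> U (inv x)" "u * v = 1" "v * u = 1" using U_inverse * by blast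
    have "monomial Y m (v * q) (inv x \<otimes> g)"
      using monomial_unit_mult(1)[OF expr_add.hyps(2) _ v(1)] * by auto
    from normal_sum_add[OF *(1) this] have "normal_sum (insert (inv x \<otimes> g) (X \<union> Y)) (add_mset (HMS m) h) (p' + v * q)" .
    moreover have "p + q = u * (p' + v * q)" using * v by (simp add: distrib_left flip: mult.assoc)
    ultimately show ?thesis using * by auto
  qed
qed simp

lemma expr_single: "monomial X m p g \<Longrightarrow> expr {#HMS m#} p"
  using expr_add[OF expr_zero] by simp

lemma expr_sum: "expr h' q \<Longrightarrow> expr h p \<Longrightarrow> expr (h + h') (p + q)"
proof (induction rule: expr.induct)
  case (expr_add h' q X m r g)
  then show ?case using expr.expr_add[of "h + h'" "p + q" X m r g] by (simp add: add.assoc)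
qed simp

lemma normal_sum_expr:
  "monomial X m p g \<Longrightarrow> True" "normal_sum X h q \<Longrightarrow> expr h q"
  by (induction rule: monomial_normal_sum.inducts) (auto intro: expr_single expr_add)

lemma expr_unit_mult:
  assumes "expr h p" "x \<in> carrier G" "u \<in> U x"
  shows "expr h (u * p)" "expr h (p * u)"
proof -
  show "expr h (u * p)" using assms
  proof (induction rule: expr.induct)
    case (expr_add h p X m q g)
    then show ?case
      using expr.expr_add[of h "u * p", OF _ monomial_unit_mult(1)[of X m q g x u]] by (simp add: distrib_left)
  qed (auto intro: expr_zero)
  show "expr h (p * u)" using assms
  proof (induction rule: expr.induct)
    case (expr_add h p X m q g)
    obtain Y where "monomial Y m (q * u) (g \<otimes> x)"
      using monomial_mult_unit(1)[OF expr_add.hyps(2)] expr_add.prems by blast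
    then show ?case
      using expr.expr_add[of h "p * u"] expr_add by (simp add: distrib_right)
  qed (auto intro: expr_zero)
qed

lemma monomial_mult:
  "monomial Y n q g' \<Longrightarrow> monomial X m p g \<Longrightarrow> \<exists>Z. monomial Z (m + n) (p * q) (g \<otimes> g')"
  "normal_sum X' h q' \<Longrightarrow> True"
proof (induction rule: monomial_normal_sum.inducts)
  case (monomial_unit g' u)
  then show ?case using monomial_mult_unit(1) by simp
next
  case (monomial_div Y n q g' Z h s r)
  then obtain W where "monomial W (m + n) (p * q) (g \<otimes> g')" by blast
  from monomial_normal_sum.monomial_div[OF this monomial_div.IH(3) monomial_div.hyps]
  show ?case by (auto simp: mult.assoc)
qed auto

text \<open>The rule for inverses, freed from the condition that the inverted sum is normal.\<close>

lemma monomial_inverse: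
  assumes "expr h q" "q * r = 1" "r * q = 1"
  shows "\<exists>X g. monomial X {#HMS h#} r g"
proof -
  have "q \<noteq> 0" using assms by auto
  then obtain X x u p where q: "normal_sum X h p" "x \<in> carrier G" "u \<in> U x" "q = u * p"
    using expr_normalise[OF assms(1)] by blast
  obtain v where v: "v \<in> U (inv x)" "u * v = 1" "v * u = 1" using U_inverse q by blast
  have "p = v * q" using q v by (simp flip: mult.assoc)
  then have pr: "p * (r * u) = 1" using assms v by (metis mult.assoc mult_1_right)
  have rp: "r * u * p = 1" using q assms by (simp add: mult.assoc)
  have "monomial ({} \<union> X) (add_mset (HMS h) {#}) (1 * (r * u)) \<one>"
    by (intro monomial_div[OF _ q(1) pr rp] monomial_unit U_one) auto
  then obtain Y where "monomial Y {#HMS h#} (1 * (r * u) * v) (\<one> \<otimes> inv x)"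
    using monomial_mult_unit(1) q v by blast
  then show ?thesis using v by (auto simp: mult.assoc)
qed

definition monomial_sums :: "(hmultiset multiset \<Rightarrow> bool) \<Rightarrow> 'r set" where
  "monomial_sums Q = {p. \<exists>h. expr h p \<and> (\<forall>x\<in>#h. \<exists>m. x = HMS m \<and> Q m)}"

lemma monomial_sums_zero: "0 \<in> monomial_sums Q"
  using expr_zero by (force simp: monomial_sums_def)

lemma monomial_sums_monomial: "monomial X m p g \<Longrightarrow> Q m \<Longrightarrow> p \<in> monomial_sums Q"
  using expr_single by (force simp: monomial_sums_def)

lemma monomial_sums_add: "p \<in> monomial_sums Q \<Longrightarrow> q \<in> monomial_sums Q \<Longrightarrow> p + q \<in> monomial_sums Q"
  using expr_sum by (fastforce simp: monomial_sums_def)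

lemma monomial_sums_mono: "(\<And>m. Q m \<Longrightarrow> Q' m) \<Longrightarrow> monomial_sums Q \<subseteq> monomial_sums Q'"
  by (fastforce simp: monomial_sums_def)

lemma monomial_sums_induct [consumes 1, case_names zero add]:
  assumes "p \<in> monomial_sums Q" "P 0"
    and "\<And>p X m q g. p \<in> monomial_sums Q \<Longrightarrow> P p \<Longrightarrow> monomial X m q g \<Longrightarrow> Q m \<Longrightarrow> P (p + q)"
  shows "P p"
proof -
  obtain h where "expr h p" "\<forall>x\<in>#h. \<exists>m. x = HMS m \<and> Q m" using assms(1) by (auto simp: monomial_sums_def)
  then show ?thesis
  proof (induction rule: expr.induct)
    case (expr_add h p X m q g)
    then have "p \<in> monomial_sums Q" by (auto simp: monomial_sums_def)
    then show ?case using expr_add assms(3) by auto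
  qed (use assms in auto)
qed

lemma monomial_sums_mult:
  assumes "p \<in> monomial_sums Q" "q \<in> monomial_sums Q'" "\<And>m m'. Q m \<Longrightarrow> Q' m' \<Longrightarrow> Q'' (m + m')"
  shows "p * q \<in> monomial_sums Q''"
  using assms(1)
proof (induction rule: monomial_sums_induct)
  case (add p X m p' g)
  have "p' * q \<in> monomial_sums Q''" using assms(2)
  proof (induction rule: monomial_sums_induct)
    case (add q Y n q' g')
    obtain Z where "monomial Z (m + n) (p' * q') (g \<otimes> g')"
      using monomial_mult(1)[OF \<open>monomial Y n q' g'\<close> \<open>monomial X m p' g\<close>] by blast
    then have "p' * q' \<in> monomial_sums Q''" using assms(3) \<open>Q m\<close> \<open>Q' n\<close> by (auto intro: monomial_sums_monomial)
    then show ?case using add by (auto simp: distrib_left intro: monomial_sums_add)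
  qed (auto intro: monomial_sums_zero)
  then show ?case using add by (auto simp: distrib_right intro: monomial_sums_add)
qed (auto intro: monomial_sums_zero)

lemma monomial_sums_minus:
  assumes "p \<in> monomial_sums Q" shows "- p \<in> monomial_sums Q"
proof -
  obtain h where "expr h p" "\<forall>x\<in>#h. \<exists>m. x = HMS m \<and> Q m" using assms by (auto simp: monomial_sums_def)
  then show ?thesis
    using expr_unit_mult(1)[OF _ one_closed U_minus_one, of h p] by (auto simp: monomial_sums_def)
qed

lemma monomial_sums_conj:
  assumes "p \<in> monomial_sums Q" "x \<in> carrier G" "u \<in> U x" "y \<in> carrier G" "v \<in> U y"
  shows "u * p * v \<in> monomial_sums Q"
proof -
  obtain h where "expr h p" "\<forall>x\<in>#h. \<exists>m. x = HMS m \<and> Q m" using assms by (auto simp: monomial_sums_def)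
  then show ?thesis unfolding monomial_sums_def
    using expr_unit_mult(2)[OF expr_unit_mult(1)[OF _ assms(2,3)] assms(4,5)] by blast
qed

end

section \<open>Rational expressions are zero or invertible\<close>

definition degree_map :: "('g, 'm) monoid_scheme \<Rightarrow> 'g set \<Rightarrow> ('g \<Rightarrow> int) \<Rightarrow> bool" where
  "degree_map G H d \<longleftrightarrow> subgroup H G \<and> (\<forall>x\<in>H. \<forall>y\<in>H. d (x \<otimes>\<^bsub>G\<^esub> y) = d x + d y)"

lemma (in group) degree_mapD:
  assumes "degree_map G H d"
  shows "subgroup H G" "x \<in> H \<Longrightarrow> y \<in> H \<Longrightarrow> d (x \<otimes> y) = d x + d y" "d \<one> = 0"
    "x \<in> H \<Longrightarrow> d (inv x) = - d x" "x \<in> H \<Longrightarrow> x [^] (k::int) \<in> H" "x \<in> H \<Longrightarrow> d (x [^] (k::int)) = k * d x"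
proof -
  show H: "subgroup H G" using assms by (simp add: degree_map_def)
  show mult: "x \<in> H \<Longrightarrow> y \<in> H \<Longrightarrow> d (x \<otimes> y) = d x + d y" for x y using assms by (simp add: degree_map_def)
  show one: "d \<one> = 0" using mult[of \<one> \<one>] subgroup.one_closed[OF H] by simp
  have inv: "d (inv x) = - d x" if "x \<in> H" for x
    using mult[of x "inv x"] that subgroup.m_inv_closed[OF H that] subgroup.mem_carrier[OF H that] one by simp
  then show "x \<in> H \<Longrightarrow> d (inv x) = - d x" .
  have nat: "x [^] (n::nat) \<in> H \<and> d (x [^] n) = int n * d x" if "x \<in> H" for x n
    by (induction n)
      (use that subgroup.one_closed[OF H] one in \<open>auto simp: mult subgroup.m_closed[OF H] algebra_simps\<close>)
  have int: "x [^] (k::int) \<in> H \<and> d (x [^] k) = k * d x" if "x \<in> H" for x k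
    using nat[OF that] by (cases k rule: int_cases2)
      (auto simp: int_pow_int int_pow_neg subgroup.mem_carrier[OF H that] subgroup.m_inv_closed[OF H] inv)
  then show "x \<in> H \<Longrightarrow> x [^] (k::int) \<in> H" "x \<in> H \<Longrightarrow> d (x [^] (k::int)) = k * d x" by auto
qed

text \<open>Elements over \<open>H\<close> are expanded in powers of \<open>t\<close>, with coefficients over the kernel of \<open>d\<close>.\<close>

locale graded_adic = graded_units G U + adic T V F
  for G (structure) and U :: "'g \<Rightarrow> 'r::ring_1 set" and T :: "int \<Rightarrow> 'r" and V F +
  fixes H :: "'g set" and d :: "'g \<Rightarrow> int" and t :: 'g
  assumes deg: "degree_map G H d" and t: "t \<in> H" "d t = 1"
    and T_U: "T k \<in> U (t [^] k)"
    and U_F: "x \<in> H \<Longrightarrow> d x = 0 \<Longrightarrow> U x \<subseteq> F"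
begin

text \<open>The elements simpler than \<open>h\<close>, and a ring that contains them and the inverses of those that are
  invertible. The ring is large, but a monomial with a factor that inverts an element of measure
  \<open>h\<close> becomes smaller when this factor is replaced by an element of \<open>lower_ring h\<close>.\<close>

definition lower :: "hmultiset multiset \<Rightarrow> 'r set" where
  "lower h = {c. \<exists>h'. expr h' c \<and> (h', h) \<in> hmult}"

definition lower_ring :: "hmultiset multiset \<Rightarrow> 'r set" where
  "lower_ring h = monomial_sums (\<lambda>m. \<forall>f\<in>#m. (f, HMS h) \<in> hless)"

lemma t_carrier: "t [^] (k::int) \<in> carrier G"
  using degree_mapD(5)[OF deg t(1)] subgroup.mem_carrier[OF degree_mapD(1)[OF deg]] by blast

lemma monomial_sums_T_conj: "p \<in> monomial_sums Q \<Longrightarrow> T (- n) * p * T n \<in> monomial_sums Q"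
  using monomial_sums_conj[OF _ t_carrier T_U t_carrier T_U] .

lemma F_conj': "c \<in> F \<Longrightarrow> T (- n) * c * T n \<in> F"
  using F_conj[of c "- n"] by simp

lemma lower_zero: "h \<noteq> {#} \<Longrightarrow> 0 \<in> lower h"
  using expr_zero hmult_empty by (auto simp: lower_def)

lemma unital_subring_lower_ring: "unital_subring (F \<inter> lower_ring h)"
proof -
  have "1 \<in> lower_ring h" unfolding lower_ring_def
    by (rule monomial_sums_monomial[OF monomial_unit[OF one_closed U_one]]) simp
  moreover have "a - b \<in> lower_ring h" if "a \<in> lower_ring h" "b \<in> lower_ring h" for a b
    using monomial_sums_add[OF _ monomial_sums_minus] that unfolding lower_ring_def by force
  moreover have "a * b \<in> lower_ring h" if "a \<in> lower_ring h" "b \<in> lower_ring h" for a b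
    using that unfolding lower_ring_def by (rule monomial_sums_mult) auto
  ultimately show ?thesis using F by (auto simp: unital_subring_def)
qed

lemma lower_subset: "lower h \<subseteq> lower_ring h"
proof
  fix c assume "c \<in> lower h"
  then obtain h' where h': "expr h' c" "(h', h) \<in> hmult" by (auto simp: lower_def)
  have "\<exists>m. x = HMS m \<and> (\<forall>f\<in>#m. (f, HMS h) \<in> hless)" if "x \<in># h'" for x
  proof (cases x)
    case (HMS m)
    have "(f, HMS h) \<in> hless" if "f \<in># m" for f
      using hless_member[OF that] hless_member[OF \<open>x \<in># h'\<close>] h'(2) HMS transD[OF trans_hless]
      by (metis hless_HMS_iff)
    then show ?thesis using HMS by blast
  qed
  then show "c \<in> lower_ring h" using h'(1) by (auto simp: lower_ring_def monomial_sums_def)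
qed

lemma lower_inverse:
  assumes "c \<in> lower h" "c * c' = 1" "c' * c = 1"
  shows "c' \<in> lower_ring h"
proof -
  obtain h' where h': "expr h' c" "(h', h) \<in> hmult" using assms(1) by (auto simp: lower_def)
  obtain X g where "monomial X {#HMS h'#} c' g" using monomial_inverse[OF h'(1) assms(2,3)] by blast
  then show ?thesis unfolding lower_ring_def by (rule monomial_sums_monomial) (use h'(2) in simp)
qed

lemma cl_lower_zero_or_unit:
  assumes "q \<in> cl (F \<inter> lower h)"
    and zu: "\<And>h' c. (h', h) \<in> hmult \<Longrightarrow> expr h' c \<Longrightarrow> c = 0 \<or> invertible c"
  shows "q = 0 \<or> (\<exists>r\<in>cl (F \<inter> lower_ring h). q * r = 1 \<and> r * q = 1)"
proof (rule cl_zero_or_unit[OF assms(1)])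
  show "F \<inter> lower h \<subseteq> F \<inter> lower_ring h" using lower_subset by blast
  show "T (- n) * c * T n \<in> F \<inter> lower_ring h" if "c \<in> F \<inter> lower_ring h" for c n
    using that F_conj' monomial_sums_T_conj by (auto simp: lower_ring_def)
  show "b = 0 \<or> (\<exists>b'\<in>F \<inter> lower_ring h. b * b' = 1 \<and> b' * b = 1)" if bB: "b \<in> F \<inter> lower h" for b
  proof -
    consider "b = 0" | b' where "b * b' = 1" "b' * b = 1"
      using bB zu unfolding lower_def invertible_def by blast
    then show ?thesis
    proof cases
      case 2
      then have "b' \<in> F \<inter> lower_ring h" using bB F_inverse lower_inverse by blast
      then show ?thesis using 2 by blast
    qed simp
  qed
qed (use unital_subring_lower_ring in auto)

text \<open>The heart of the induction. If all inner degrees of an expression vanish, then it is a single term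
  with a coefficient of the same measure. Otherwise its expansion has coefficients of strictly smaller
  measure. For an inverse of \<open>q\<close> this holds because the coefficients of \<open>q\<close> are simpler than \<open>q\<close>,
  hence zero or invertible by the induction hypothesis, so that \<open>cl_zero_or_unit\<close> puts the inverse into
  \<open>cl (F \<inter> lower_ring h)\<close>. For a sum, either some summand is not a single term and the multiset decreases
  at that summand, or the summands have different degrees and are distributed among several
  coefficients.\<close>

lemma monomial_expansion:
  "monomial X m p g \<Longrightarrow> X \<subseteq> H \<Longrightarrow> g \<in> H \<Longrightarrow> \<forall>f\<in>#m. f = HMS h\<^sub>0 \<or> (f, HMS h\<^sub>0) \<in> hless \<Longrightarrow>
    (\<And>h' c. (h', h\<^sub>0) \<in> hmult \<Longrightarrow> expr h' c \<Longrightarrow> c = 0 \<or> invertible c) \<Longrightarrow>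
    (\<forall>x\<in>X. d x = 0) \<and> T (- d g) * p \<in> F \<or> p \<in> cl (F \<inter> monomial_sums (\<lambda>m'. (m', m) \<in> hmult))"
  and normal_sum_expansion:
  "normal_sum X h q \<Longrightarrow> X \<subseteq> H \<Longrightarrow> h = h\<^sub>0 \<or> (h, h\<^sub>0) \<in> hmult \<Longrightarrow>
    (\<And>h' c. (h', h\<^sub>0) \<in> hmult \<Longrightarrow> expr h' c \<Longrightarrow> c = 0 \<or> invertible c) \<Longrightarrow>
    (\<forall>x\<in>X. d x = 0) \<and> q \<in> F \<or> q \<in> cl (F \<inter> lower h)"
proof (induction rule: monomial_normal_sum.inducts)
  case (monomial_unit g u)
  note dm = degree_mapD[OF deg]
  have "t [^] (- d g) \<otimes> g \<in> H" "d (t [^] (- d g) \<otimes> g) = 0"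
    using dm(2,5,6) t monomial_unit subgroup.m_closed[OF dm(1)] by auto
  moreover have "T (- d g) * u \<in> U (t [^] (- d g) \<otimes> g)"
    using T_U t_carrier monomial_unit by (intro U_mult)
  ultimately show ?case using U_F by blast
next
  case (monomial_div X m p g Y h q r)
  have p: "(\<forall>x\<in>X. d x = 0) \<and> T (- d g) * p \<in> F \<or> p \<in> cl (F \<inter> monomial_sums (\<lambda>m'. (m', m) \<in> hmult))"
    using monomial_div.prems by (intro monomial_div.IH(2)) auto
  have h: "h = h\<^sub>0 \<or> (h, h\<^sub>0) \<in> hmult" using monomial_div.prems(3) by auto
  then have q: "(\<forall>x\<in>Y. d x = 0) \<and> q \<in> F \<or> q \<in> cl (F \<inter> lower h)"
    using monomial_div.prems by (intro monomial_div.IH(4)) auto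
  let ?M = "add_mset (HMS h) m"
  \<comment> \<open>In either case the coefficients of \<open>p\<close> are sums of monomials of measure at most \<open>m\<close>.\<close>
  define A where "A = monomial_sums (\<lambda>m'. m' = m \<or> (m', m) \<in> hmult)"
  define S where "S = F \<inter> monomial_sums (\<lambda>m'. (m', ?M) \<in> hmult)"
  note F' = unital_subringD[OF F]
  have S0: "0 \<in> S" and S_add: "a \<in> S \<Longrightarrow> b \<in> S \<Longrightarrow> a + b \<in> S" for a b
    by (auto simp: S_def monomial_sums_zero monomial_sums_add F')
  show ?case
  proof (cases "q \<in> cl (F \<inter> lower h)")
    case True
    have zu: "c = 0 \<or> invertible c" if "(h', h) \<in> hmult" "expr h' c" for h' c
      using monomial_div.prems(4)[OF _ that(2)] h that(1) hmult_trans by blast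
    obtain r' where r': "r' \<in> cl (F \<inter> lower_ring h)" "q * r' = 1" "r' * q = 1"
    proof -
      have "q = 0 \<or> (\<exists>r\<in>cl (F \<inter> lower_ring h). q * r = 1 \<and> r * q = 1)"
        using True zu by (rule cl_lower_zero_or_unit)
      then show ?thesis using that monomial_div.hyps by auto
    qed
    then have r: "r \<in> cl (F \<inter> lower_ring h)"
      using two_sided_inverse_unique[of q r r'] monomial_div.hyps by simp
    have "p \<in> cl (F \<inter> A)" using p
    proof
      assume *: "(\<forall>x\<in>X. d x = 0) \<and> T (- d g) * p \<in> F"
      obtain Z g' where "monomial Z m (T (- d g) * p) g'"
        using monomial_unit_mult(1)[OF monomial_div.IH(1) t_carrier T_U] by blast
      then have "T (- d g) * p \<in> F \<inter> A" using * by (auto simp: A_def intro: monomial_sums_monomial)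
      then have "T (d g) * (T (- d g) * p) \<in> cl (F \<inter> A)"
        by (intro laurent_cl laurent_single)
      then show ?thesis by simp
    next
      assume "p \<in> cl (F \<inter> monomial_sums (\<lambda>m'. (m', m) \<in> hmult))"
      moreover have "monomial_sums (\<lambda>m'. (m', m) \<in> hmult) \<subseteq> A"
        unfolding A_def by (rule monomial_sums_mono) simp
      ultimately show ?thesis
        using cl_mono[of "F \<inter> monomial_sums (\<lambda>m'. (m', m) \<in> hmult)" "F \<inter> A"] by blast
    qed
    then have "p * r \<in> cl S" using r
    proof (rule cl_mult)
      fix c c' n assume c: "c \<in> F \<inter> A" "c' \<in> F \<inter> lower_ring h"
      have less: "(m' + n', ?M) \<in> hmult"
        if "m' = m \<or> (m', m) \<in> hmult" "\<forall>f\<in>#n'. (f, HMS h) \<in> hless" for m' n'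
      proof -
        have "(m + n', m + {#HMS h#}) \<in> hmult" using that(2) by (intro hless_multI) auto
        moreover have "m' = m \<or> (m' + n', m + n') \<in> hmult"
          using that(1) hmult_add_right by blast
        ultimately show ?thesis using hmult_trans[of "m' + n'" "m + n'"] by auto
      qed
      have "T (- n) * c * T n * c' \<in> monomial_sums (\<lambda>m'. (m', ?M) \<in> hmult)"
      proof (rule monomial_sums_mult)
        show "T (- n) * c * T n \<in> monomial_sums (\<lambda>m'. m' = m \<or> (m', m) \<in> hmult)"
          using c monomial_sums_T_conj unfolding A_def by blast
        show "c' \<in> monomial_sums (\<lambda>m. \<forall>f\<in>#m. (f, HMS h) \<in> hless)"
          using c by (simp add: lower_ring_def)
      qed (rule less)
      then show "T (- n) * c * T n * c' \<in> S" using c F_conj' F'(4) by (auto simp: S_def)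
    qed (use S0 S_add in auto)
    then show ?thesis by (simp add: S_def)
  next
    case False
    then have Y: "\<forall>x\<in>Y. d x = 0" and "q \<in> F" using q by auto
    then have r: "r \<in> F" using F_inverse monomial_div.hyps by blast
    from p show ?thesis
    proof
      assume "(\<forall>x\<in>X. d x = 0) \<and> T (- d g) * p \<in> F"
      then show ?thesis using Y r F'(4)[of "T (- d g) * p" r] by (auto simp: mult.assoc)
    next
      assume p: "p \<in> cl (F \<inter> monomial_sums (\<lambda>m'. (m', m) \<in> hmult))"
      obtain Z g' where mr: "monomial Z {#HMS h#} r g'"
        using monomial_inverse[OF normal_sum_expr(2)[OF monomial_div.IH(3)] monomial_div.hyps] by blast
      have "p * r \<in> cl S"
      proof (rule cl_mult[OF p laurent_cl[OF laurent_single[of r "{r}" 0], simplified]])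
        fix c c' n assume c: "c \<in> F \<inter> monomial_sums (\<lambda>m'. (m', m) \<in> hmult)" "c' \<in> {r}"
        have "T (- n) * c * T n * r \<in> monomial_sums (\<lambda>m'. (m', ?M) \<in> hmult)"
        proof (rule monomial_sums_mult)
          show "T (- n) * c * T n \<in> monomial_sums (\<lambda>m'. (m', m) \<in> hmult)"
            using c monomial_sums_T_conj by blast
          show "r \<in> monomial_sums (\<lambda>n'. n' = {#HMS h#})" using mr by (rule monomial_sums_monomial) simp
        qed (use hmult_add_right[of _ m "{#HMS h#}"] in auto)
        then show "T (- n) * c * T n * c' \<in> S" using c r F_conj' F'(4) by (auto simp: S_def)
      qed (use S0 S_add r in auto)
      then show ?thesis by (simp add: S_def)
    qed
  qed
next
  case (normal_sum_single X m p)
  have "\<forall>f\<in>#m. f = HMS h\<^sub>0 \<or> (f, HMS h\<^sub>0) \<in> hless"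
  proof
    fix f assume f: "f \<in># m"
    have "(HMS m, HMS {#HMS m#}) \<in> hless" by (rule hless_singleton)
    then have "(f, HMS {#HMS m#}) \<in> hless" using hless_member[OF f] transD[OF trans_hless] by blast
    then show "f = HMS h\<^sub>0 \<or> (f, HMS h\<^sub>0) \<in> hless"
      using normal_sum_single.prems(2) transD[OF trans_hless] by (metis hless_HMS_iff)
  qed
  then have "(\<forall>x\<in>X. d x = 0) \<and> T (- d \<one>) * p \<in> F \<or> p \<in> cl (F \<inter> monomial_sums (\<lambda>m'. (m', m) \<in> hmult))"
    using normal_sum_single.prems subgroup.one_closed[OF degree_mapD(1)[OF deg]]
    by (intro normal_sum_single.IH(2)) auto
  moreover have "monomial_sums (\<lambda>m'. (m', m) \<in> hmult) \<subseteq> lower {#HMS m#}"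
    using hless_multI[of "{#HMS m#}" _ "{#}"] by (fastforce simp: monomial_sums_def lower_def)
  ultimately show ?case
    using cl_mono[of "F \<inter> monomial_sums (\<lambda>m'. (m', m) \<in> hmult)" "F \<inter> lower {#HMS m#}"] degree_mapD(3)[OF deg]
    by auto
next
  case (normal_sum_add X h p Y m q g)
  let ?h = "add_mset (HMS m) h"
  have h_less: "(h, ?h) \<in> hmult" using hless_multI[of "{#HMS m#}" "{#}" h] by simp
  then have h: "(h, h\<^sub>0) \<in> hmult" using normal_sum_add.prems(2) hmult_trans by blast
  then have p: "(\<forall>x\<in>X. d x = 0) \<and> p \<in> F \<or> p \<in> cl (F \<inter> lower h)"
    using normal_sum_add.prems by (intro normal_sum_add.IH(2)) auto
  have "\<forall>f\<in>#m. f = HMS h\<^sub>0 \<or> (f, HMS h\<^sub>0) \<in> hless"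
  proof
    fix f assume f: "f \<in># m"
    have "(HMS m, HMS ?h) \<in> hless" by (rule hless_member) simp
    then have "(f, HMS ?h) \<in> hless" using hless_member[OF f] transD[OF trans_hless] by blast
    then show "f = HMS h\<^sub>0 \<or> (f, HMS h\<^sub>0) \<in> hless"
      using normal_sum_add.prems(2) transD[OF trans_hless] by (metis hless_HMS_iff)
  qed
  then have q: "(\<forall>x\<in>Y. d x = 0) \<and> T (- d g) * q \<in> F \<or> q \<in> cl (F \<inter> monomial_sums (\<lambda>m'. (m', m) \<in> hmult))"
    using normal_sum_add.prems by (intro normal_sum_add.IH(4)) auto
  have ex_p: "expr h p" using normal_sum_add.IH(1) by (rule normal_sum_expr)
  have h_ne: "h \<noteq> {#}" using normal_sum_add.IH(1) by (rule normal_sum_nonempty)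
  define q' where "q' = T (- d g) * q"
  obtain Z g' where "monomial Z m q' g'"
    using monomial_unit_mult(1)[OF normal_sum_add.IH(3) t_carrier T_U] unfolding q'_def by blast
  then have ex_q': "expr {#HMS m#} q'" by (rule expr_single)
  have q_q': "q = T (d g) * q'" by (simp add: q'_def)
  note F' = unital_subringD[OF F]
  have M_less: "monomial_sums (\<lambda>m'. (m', m) \<in> hmult) \<subseteq> {c. \<exists>h'. expr h' c \<and> (h', {#HMS m#}) \<in> hmult}"
    using hless_multI[of "{#HMS m#}" _ "{#}"] by (fastforce simp: monomial_sums_def)
  have sum_less: "c + c' \<in> lower ?h"
    if "expr h' c" "expr h'' c'" "h' = h \<or> (h', h) \<in> hmult"
      "h'' = {#HMS m#} \<or> (h'', {#HMS m#}) \<in> hmult" "h' \<noteq> h \<or> h'' \<noteq> {#HMS m#}" for c c' h' h''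
  proof -
    have "h' = h \<or> (h' + h'', h + h'') \<in> hmult" using that(3) hmult_add_right by blast
    moreover have "h'' = {#HMS m#} \<or> (h + h'', h + {#HMS m#}) \<in> hmult"
      using that(4) hmult_add_left by blast
    ultimately have "(h' + h'', ?h) \<in> hmult"
      using that(5) hmult_trans[of "h' + h''" "h + h''"] by auto
    then show ?thesis using expr_sum[OF that(2,1)] by (auto simp: lower_def)
  qed
  have p_lower: "p \<in> lower ?h" using ex_p h_less by (auto simp: lower_def)
  have q'_lower: "q' \<in> lower ?h"
    using ex_q' hless_multI[of h "{#}" "{#HMS m#}"] h_ne by (auto simp: lower_def)
  from p q show ?case
  proof (elim disjE)
    assume p: "(\<forall>x\<in>X. d x = 0) \<and> p \<in> F" and q: "(\<forall>x\<in>Y. d x = 0) \<and> T (- d g) * q \<in> F"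
    show ?thesis
    proof (cases "d g = 0")
      case True
      then show ?thesis using p q F'(6) by auto
    next
      case False
      have "(\<Sum>n\<in>{0, d g}. T n * (if n = 0 then p else q')) \<in> laurent (F \<inter> lower ?h)"
        by (rule laurentI) (use p q p_lower q'_lower in \<open>auto simp: q'_def\<close>)
      then have "p + q \<in> laurent (F \<inter> lower ?h)" using False q_q' by simp
      then show ?thesis by (simp add: laurent_cl)
    qed
  next
    assume p: "(\<forall>x\<in>X. d x = 0) \<and> p \<in> F" and q: "q \<in> cl (F \<inter> monomial_sums (\<lambda>m'. (m', m) \<in> hmult))"
    have "T 0 * p \<in> cl {0, p}" by (intro laurent_cl laurent_single) simp
    then have "p + q \<in> cl (F \<inter> lower ?h)"
    proof (intro cl_add[OF _ q])
      fix c c' assume c: "c \<in> {0, p}" "c' \<in> F \<inter> monomial_sums (\<lambda>m'. (m', m) \<in> hmult)"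
      then obtain h'' where "expr h'' c'" "(h'', {#HMS m#}) \<in> hmult" using M_less by blast
      moreover have "\<exists>h'. expr h' c \<and> (h' = h \<or> (h', h) \<in> hmult)"
        using c ex_p expr_zero hmult_empty[OF h_ne] by auto
      ultimately have "c + c' \<in> lower ?h"
        using sum_less wf_mult[OF wf_hless] by (metis wf_not_refl)
      then show "c + c' \<in> F \<inter> lower ?h" using c p F' by auto
    qed (auto simp: F' monomial_sums_zero)
    then show ?thesis by blast
  next
    assume p: "p \<in> cl (F \<inter> lower h)" and q: "(\<forall>x\<in>Y. d x = 0) \<and> T (- d g) * q \<in> F"
    have "T (d g) * q' \<in> cl {0, q'}" by (intro laurent_cl laurent_single) simp
    then have "p + T (d g) * q' \<in> cl (F \<inter> lower ?h)"
    proof (rule cl_add[OF p])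
      fix c c' assume c: "c \<in> F \<inter> lower h" "c' \<in> {0, q'}"
      then obtain h' where "expr h' c" "(h', h) \<in> hmult" by (auto simp: lower_def)
      moreover have "\<exists>h''. expr h'' c' \<and> (h'' = {#HMS m#} \<or> (h'', {#HMS m#}) \<in> hmult)"
        using c ex_q' expr_zero hmult_empty[of "{#HMS m#}"] by auto
      ultimately have "c + c' \<in> lower ?h"
        using sum_less wf_mult[OF wf_hless] by (metis wf_not_refl)
      then show "c + c' \<in> F \<inter> lower ?h" using c q F' by (auto simp: q'_def)
    qed (auto simp: F' lower_zero h_ne)
    then show ?thesis by (simp add: q_q')
  next
    assume p: "p \<in> cl (F \<inter> lower h)" and q: "q \<in> cl (F \<inter> monomial_sums (\<lambda>m'. (m', m) \<in> hmult))"
    have "p + q \<in> cl (F \<inter> lower ?h)"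
    proof (rule cl_add[OF p q])
      fix c c' assume c: "c \<in> F \<inter> lower h" "c' \<in> F \<inter> monomial_sums (\<lambda>m'. (m', m) \<in> hmult)"
      then obtain h' where "expr h' c" "(h', h) \<in> hmult" by (auto simp: lower_def)
      moreover obtain h'' where "expr h'' c'" "(h'', {#HMS m#}) \<in> hmult" using c M_less by blast
      ultimately have "c + c' \<in> lower ?h"
        using sum_less wf_mult[OF wf_hless] by (metis wf_not_refl)
      then show "c + c' \<in> F \<inter> lower ?h" using c F' by auto
    qed (auto simp: F' lower_zero h_ne monomial_sums_zero)
    then show ?thesis by blast
  qed
qed

end

definition indicable_subgroups :: "('g, 'm) monoid_scheme \<Rightarrow> bool" where
  "indicable_subgroups G \<longleftrightarrow>
     (\<forall>H. nontrivial_fg_subgroup H G \<longrightarrow> (\<exists>d. degree_map G H d \<and> (\<exists>t\<in>H. d t = 1)))"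

text \<open>For every degree map, elements can be expanded in powers of \<open>t\<close>; for products of division rings
  this is the form in which Hughes-freeness is used.\<close>

definition adically_graded :: "('g, 'm) monoid_scheme \<Rightarrow> ('g \<Rightarrow> 'r::ring_1 set) \<Rightarrow> bool" where
  "adically_graded G U \<longleftrightarrow>
     (\<forall>H d t. nontrivial_fg_subgroup H G \<and> degree_map G H d \<and> t \<in> H \<and> d t = 1 \<longrightarrow>
       (\<exists>T V F. adic T V F \<and> (\<forall>k::int. T k \<in> U (t [^]\<^bsub>G\<^esub> k)) \<and> (\<forall>x\<in>H. d x = 0 \<longrightarrow> U x \<subseteq> F)))"

context graded_units
begin

lemma monomial_trivial_support:
  "monomial X m p g \<Longrightarrow> X \<subseteq> {\<one>} \<Longrightarrow> p \<in> U g"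
  "normal_sum X h q \<Longrightarrow> X \<subseteq> {\<one>} \<Longrightarrow> q \<in> insert 0 (U \<one>)"
proof (induction rule: monomial_normal_sum.inducts)
  case (monomial_div X m p g Y h q r)
  have "q \<in> U \<one>" using monomial_div by auto
  then obtain v where "v \<in> U \<one>" "q * v = 1" "v * q = 1" using U_inverse[OF one_closed] by auto
  then have "r \<in> U \<one>" using two_sided_inverse_unique[of q r v] monomial_div.hyps by simp
  moreover have "p \<in> U g" "g \<in> carrier G" using monomial_div monomial_carrier by auto
  ultimately show ?case using U_mult[of g \<one> p r] by simp
next
  case (normal_sum_add X h p Y m q g)
  then show ?case using U_add by auto
qed auto

text \<open>After normalising, the degrees that occur generate a group \<open>H\<close>. If \<open>H\<close> is trivial, the element
  lies in the coefficient division ring. Otherwise take a degree map on \<open>H\<close>: since the degrees that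
  occur generate \<open>H\<close>, not all of them are mapped to zero, and the expansion has simpler coefficients.\<close>

theorem expr_zero_or_unit:
  assumes "indicable_subgroups G" "adically_graded G U" "expr h p"
  shows "p = 0 \<or> invertible p"
  using wf_mult[OF wf_hless] assms(3)
proof (induction h arbitrary: p rule: wf_induct_rule)
  case (less h)
  note IH = less.IH
  from expr_normalise[OF less.prems] show ?case
  proof (elim disjE conjE exE)
    fix X x u q assume q: "normal_sum X h q" "x \<in> carrier G" "u \<in> U x" "p = u * q"
    have unit_u: "invertible u" using U_inverse[OF q(2,3)] by (auto simp: invertible_def)
    have "q = 0 \<or> invertible q"
    proof (cases "X \<subseteq> {\<one>}")
      case True
      then show ?thesis
        using monomial_trivial_support(2)[OF q(1)] U_inverse[OF one_closed] by (auto simp: invertible_def)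
    next
      case False
      define H where "H = generate G X"
      have X: "finite X" "X \<subseteq> carrier G" using normal_sum_carrier[OF q(1)] by auto
      have XH: "X \<subseteq> H" by (auto simp: H_def intro: generate.incl)
      have H: "nontrivial_fg_subgroup H G"
        using X XH False generate_is_subgroup[OF X(2)] unfolding nontrivial_fg_subgroup_def H_def by blast
      then obtain d t where d: "degree_map G H d" "t \<in> H" "d t = 1"
        using assms(1) by (auto simp: indicable_subgroups_def)
      have "\<exists>T V F. adic T V F \<and> (\<forall>k::int. T k \<in> U (t [^] k)) \<and> (\<forall>x\<in>H. d x = 0 \<longrightarrow> U x \<subseteq> F)"
        by (rule assms(2)[unfolded adically_graded_def, rule_format]) (use H d in simp)
      then obtain T V F where TVF: "adic T V F" "\<forall>k::int. T k \<in> U (t [^] k)"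
          "\<forall>x\<in>H. d x = 0 \<longrightarrow> U x \<subseteq> F"
        by blast
      interpret adic T V F by fact
      interpret graded_adic G U T V F H d t
        by unfold_locales (use d TVF in auto)
      from normal_sum_expansion[OF q(1) XH, of h] IH
      have "(\<forall>x\<in>X. d x = 0) \<and> q \<in> F \<or> q \<in> cl (F \<inter> lower h)" by blast
      moreover have "\<not> (\<forall>x\<in>X. d x = 0)"
      proof
        assume *: "\<forall>x\<in>X. d x = 0"
        note dm = degree_mapD[OF d(1)]
        have "d y = 0 \<and> y \<in> H" if "y \<in> generate G X" for y using that
        proof (induction rule: generate.induct)
          case (eng y z)
          then show ?case using dm subgroup.m_closed[OF dm(1)] by auto
        qed (use * dm XH subgroup.one_closed[OF dm(1)] subgroup.m_inv_closed[OF dm(1)] in auto)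
        then show False using d(2,3) by (auto simp: H_def)
      qed
      ultimately show ?thesis
        using cl_lower_zero_or_unit[of q h] IH by (auto simp: invertible_def)
    qed
    then show ?thesis
    proof
      assume "invertible q"
      then obtain u' q' where "u * u' = 1" "u' * u = 1" "q * q' = 1" "q' * q = 1"
        using unit_u by (auto simp: invertible_def)
      then have "u * q * (q' * u') = 1" "q' * u' * (u * q) = 1"
        by (metis mult.assoc mult_1_left)+
      then show ?thesis using q(4) by (auto simp: invertible_def)
    qed (use q in simp)
  qed simp
qed

end

section \<open>The valuation of a division ring at a free power sequence\<close>

lemma division_subringD:
  fixes F :: "'d::division_ring set"
  assumes "division_subring F"
  shows "unital_subring F" "c \<in> F \<Longrightarrow> inverse c \<in> F"
proof -
  show F: "unital_subring F" using assms by (simp add: division_subring_def)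
  show "inverse c \<in> F" if "c \<in> F"
  proof (cases "c = 0")
    case False
    then obtain v where "v \<in> F" "c * v = 1"
      using assms \<open>c \<in> F\<close> unfolding division_subring_def ring_units_def by blast
    then show ?thesis by (metis inverse_unique)
  qed (use unital_subringD[OF F] in simp)
qed

lemma division_subringI:
  fixes F :: "'d::division_ring set"
  assumes "unital_subring F" "\<And>c. c \<in> F \<Longrightarrow> inverse c \<in> F"
  shows "division_subring F"
  unfolding division_subring_def
proof (intro conjI subsetI)
  fix x assume x: "x \<in> F - {0}"
  then have "x * inverse x = 1" "inverse x * x = 1" by simp_all
  then show "x \<in> ring_units F" using x assms(2) unfolding ring_units_def by blast
qed (rule assms)

text \<open>By the independence of the powers of \<open>t\<close>, the ring generated by \<open>F\<close> and \<open>t\<close> is a skew polynomial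
  ring. Its localisation at the polynomials with nonzero constant term is the valuation ring.\<close>

locale skew_polynomials =
  fixes t :: "'d::division_ring" and F :: "'d set"
  assumes F: "division_subring F" and t0: "t \<noteq> 0"
    and conj: "c \<in> F \<Longrightarrow> t * c * inverse t \<in> F" "c \<in> F \<Longrightarrow> inverse t * c * t \<in> F"
    and independent: "(\<And>n. b n \<in> F) \<Longrightarrow> (\<Sum>n<m. t ^ n * b n) = 0 \<Longrightarrow> n < (m :: nat) \<Longrightarrow> b n = 0"
begin

lemmas F_ring = unital_subringD[OF division_subringD(1)[OF F]]

lemma t_cancel [simp]: "t * (inverse t * x) = x" "inverse t * (t * x) = x"
  using t0 by (simp_all flip: mult.assoc)

definition poly :: "nat \<Rightarrow> 'd \<Rightarrow> bool" where
  "poly m p \<longleftrightarrow> (\<exists>c. (\<forall>n. c n \<in> F) \<and> p = (\<Sum>n<m. t ^ n * c n))"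

definition P :: "'d set" where "P = {p. \<exists>m. poly m p}"

lemma poly_0 [simp]: "poly 0 p \<longleftrightarrow> p = 0"
  using F_ring(1) by (auto simp: poly_def)

lemma poly_Suc: "poly (Suc m) p \<longleftrightarrow> (\<exists>p' c. poly m p' \<and> c \<in> F \<and> p = p' + t ^ m * c)"
proof
  assume "\<exists>p' c. poly m p' \<and> c \<in> F \<and> p = p' + t ^ m * c"
  then obtain b c where b: "\<forall>n. b n \<in> F" "c \<in> F" "p = (\<Sum>n<m. t ^ n * b n) + t ^ m * c"
    by (auto simp: poly_def)
  have "p = (\<Sum>n<Suc m. t ^ n * (b(m := c)) n)" using b(3) by simp
  moreover have "\<forall>n. (b(m := c)) n \<in> F" using b by simp
  ultimately show "poly (Suc m) p" unfolding poly_def by blast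
qed (auto simp: poly_def)

lemma poly_Suc_low: "poly (Suc m) p \<longleftrightarrow> (\<exists>c p'. c \<in> F \<and> poly m p' \<and> p = c + t * p')"
proof
  assume "poly (Suc m) p"
  then obtain c where c: "\<forall>n. c n \<in> F" "p = (\<Sum>n<Suc m. t ^ n * c n)" by (auto simp: poly_def)
  have "p = c 0 + t * (\<Sum>n<m. t ^ n * c (Suc n))"
    unfolding c(2) by (subst sum.lessThan_Suc_shift) (simp add: sum_distrib_left mult.assoc)
  moreover have "poly m (\<Sum>n<m. t ^ n * c (Suc n))"
    unfolding poly_def using c(1) by (intro exI[of _ "\<lambda>n. c (Suc n)"]) simp
  ultimately show "\<exists>c p'. c \<in> F \<and> poly m p' \<and> p = c + t * p'" using c(1) by blast
next
  assume "\<exists>c p'. c \<in> F \<and> poly m p' \<and> p = c + t * p'"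
  then obtain b c where b: "\<forall>n. b n \<in> F" "c \<in> F" "p = c + t * (\<Sum>n<m. t ^ n * b n)"
    by (auto simp: poly_def)
  define b' where "b' n = (case n of 0 \<Rightarrow> c | Suc k \<Rightarrow> b k)" for n
  have "p = (\<Sum>n<Suc m. t ^ n * b' n)"
    unfolding b(3) by (subst sum.lessThan_Suc_shift) (simp add: b'_def sum_distrib_left mult.assoc)
  moreover have "\<forall>n. b' n \<in> F" using b by (simp add: b'_def split: nat.split)
  ultimately show "poly (Suc m) p" unfolding poly_def by blast
qed

lemma poly_zero [simp]: "poly m 0"
proof (induction m)
  case (Suc m)
  moreover have "(0::'d) = 0 + t ^ m * 0" by simp
  ultimately show ?case unfolding poly_Suc using F_ring(1) by blast
qed simp

lemma poly_mono: "m \<le> n \<Longrightarrow> poly m p \<Longrightarrow> poly n p"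
proof (induction n rule: dec_induct)
  case (step n)
  then show ?case using F_ring(1) poly_Suc[of n p] by force
qed

lemma poly_add: "poly m p \<Longrightarrow> poly m q \<Longrightarrow> poly m (p + q)"
proof -
  assume "poly m p" "poly m q"
  then obtain b c where "\<forall>n. b n \<in> F" "p = (\<Sum>n<m. t ^ n * b n)" "\<forall>n. c n \<in> F" "q = (\<Sum>n<m. t ^ n * c n)"
    by (auto simp: poly_def)
  then show ?thesis unfolding poly_def
    by (intro exI[of _ "\<lambda>n. b n + c n"]) (simp add: F_ring sum.distrib distrib_left)
qed

lemma poly_mult_const: "poly m p \<Longrightarrow> a \<in> F \<Longrightarrow> poly m (p * a)"
proof -
  assume "poly m p" "a \<in> F"
  then obtain b where "\<forall>n. b n \<in> F" "p = (\<Sum>n<m. t ^ n * b n)" by (auto simp: poly_def)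
  then show ?thesis unfolding poly_def using \<open>a \<in> F\<close>
    by (intro exI[of _ "\<lambda>n. b n * a"]) (simp add: F_ring sum_distrib_right mult.assoc)
qed

lemma poly_conj: "poly m p \<Longrightarrow> poly m (t * p * inverse t)" "poly m p \<Longrightarrow> poly m (inverse t * p * t)"
proof (induction m arbitrary: p)
  case (Suc m)
  {
    case 1
    then obtain c p' where "c \<in> F" "poly m p'" "p = c + t * p'" by (auto simp: poly_Suc_low)
    then show ?case unfolding poly_Suc_low using Suc(1)[of p'] conj(1)[of c]
      by (intro exI[of _ "t * c * inverse t"] exI[of _ "t * p' * inverse t"])
        (simp add: algebra_simps)
  next
    case 2
    then obtain c p' where "c \<in> F" "poly m p'" "p = c + t * p'" by (auto simp: poly_Suc_low)
    then show ?case unfolding poly_Suc_low using Suc(2)[of p'] conj(2)[of c]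
      by (intro exI[of _ "inverse t * c * t"] exI[of _ "inverse t * p' * t"])
        (simp add: distrib_left distrib_right mult.assoc)
  }
qed auto

lemma poly_mult_t: "poly m p \<Longrightarrow> poly (Suc m) (p * t)"
proof -
  assume "poly m p"
  then have "poly m (inverse t * p * t)" by (rule poly_conj)
  moreover have "p * t = 0 + t * (inverse t * p * t)" by (simp add: mult.assoc)
  ultimately show ?thesis unfolding poly_Suc_low using F_ring(1) by blast
qed

lemma poly_mult_t_power: "poly m p \<Longrightarrow> poly (k + m) (p * t ^ k)"
proof (induction k arbitrary: p m)
  case (Suc k)
  then show ?case using Suc.IH[of "Suc m" "p * t"] poly_mult_t by (simp add: mult.assoc)
qed simp

lemma P_add: "p \<in> P \<Longrightarrow> q \<in> P \<Longrightarrow> p + q \<in> P"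
proof -
  assume "p \<in> P" "q \<in> P"
  then obtain m n where "poly m p" "poly n q" by (auto simp: P_def)
  then have "poly (max m n) p" "poly (max m n) q" by (auto intro: poly_mono[rotated])
  then show ?thesis using poly_add by (auto simp: P_def)
qed

lemma P_mult: "p \<in> P \<Longrightarrow> q \<in> P \<Longrightarrow> p * q \<in> P"
proof -
  assume p: "p \<in> P" and "q \<in> P"
  then obtain m where "poly m q" by (auto simp: P_def)
  then show ?thesis using p
  proof (induction m arbitrary: p q)
    case 0
    then show ?case using poly_zero by (auto simp: P_def)
  next
    case (Suc m)
    then obtain c q' where q: "c \<in> F" "poly m q'" "q = c + t * q'" by (auto simp: poly_Suc_low)
    have "p * c \<in> P" "p * t \<in> P" using Suc(3) q(1) poly_mult_const poly_mult_t unfolding P_def by blast+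
    then have "p * c + p * t * q' \<in> P" using Suc.IH[OF q(2)] by (intro P_add)
    then show ?case by (simp add: q distrib_left mult.assoc)
  qed
qed

lemma F_P: "c \<in> F \<Longrightarrow> c \<in> P"
  using poly_Suc_low[of 0 c] by (auto simp: P_def)

lemma t_P: "t \<in> P"
proof -
  have "poly (Suc 0) 1" unfolding poly_Suc_low using F_ring(2) by simp
  from poly_mult_t[OF this] show ?thesis unfolding P_def by auto
qed

lemma unital_subring_P: "unital_subring P"
proof -
  have "p - q \<in> P" if "p \<in> P" "q \<in> P" for p q
    using P_add[OF that(1) P_mult[OF F_P[of "- 1"] that(2)]] F_ring by simp
  then show ?thesis using P_mult F_P F_ring(2) by (auto simp: unital_subring_def)
qed

lemmas P_ring = unital_subringD[OF unital_subring_P]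

lemma P_conj: "p \<in> P \<Longrightarrow> t * p * inverse t \<in> P" "p \<in> P \<Longrightarrow> inverse t * p * t \<in> P"
  using poly_conj unfolding P_def by blast+

lemma P_low: "p \<in> P \<longleftrightarrow> (\<exists>c p'. c \<in> F \<and> p' \<in> P \<and> p = c + t * p')"
proof
  assume "p \<in> P"
  then obtain m where "poly m p" by (auto simp: P_def)
  then have "poly (Suc m) p" using poly_mono by (meson le_SucI order_refl)
  then show "\<exists>c p'. c \<in> F \<and> p' \<in> P \<and> p = c + t * p'" unfolding poly_Suc_low P_def by blast
next
  assume "\<exists>c p'. c \<in> F \<and> p' \<in> P \<and> p = c + t * p'"
  then obtain c p' where "c \<in> F" "p' \<in> P" "p = c + t * p'" by blast
  then show "p \<in> P" using P_ring(6)[OF F_P P_ring(4)[OF t_P]] by simp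
qed

lemma constant_term_zero:
  assumes "c \<in> F" "p \<in> P" "c + t * p = 0"
  shows "c = 0"
proof -
  obtain m where "poly m p" using assms(2) by (auto simp: P_def)
  then obtain b where b: "\<forall>n. b n \<in> F" "p = (\<Sum>n<m. t ^ n * b n)" by (auto simp: poly_def)
  define b' where "b' n = (case n of 0 \<Rightarrow> c | Suc k \<Rightarrow> b k)" for n
  have "(\<Sum>n<Suc m. t ^ n * b' n) = c + t * p"
    unfolding b(2) by (subst sum.lessThan_Suc_shift) (simp add: b'_def sum_distrib_left mult.assoc)
  then have "b' 0 = 0" using assms b
    by (intro independent[of b' "Suc m" 0]) (auto simp: b'_def split: nat.split)
  then show ?thesis by (simp add: b'_def)
qed

text \<open>One step of right division with remainder.\<close>

lemma poly_reduce:
  assumes "poly (Suc m) p" "poly (Suc n) q" "n \<le> m"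
  shows "poly n q \<or> (\<exists>e\<in>P. poly m (p - q * e))"
proof -
  obtain p' c where p: "poly m p'" "c \<in> F" "p = p' + t ^ m * c" using assms(1) by (auto simp: poly_Suc)
  obtain q' d where q: "poly n q'" "d \<in> F" "q = q' + t ^ n * d" using assms(2) by (auto simp: poly_Suc)
  show ?thesis
  proof (cases "d = 0")
    case False
    define e where "e = inverse d * t ^ (m - n) * c"
    have "t ^ k \<in> P" for k by (induction k) (auto intro!: P_ring t_P)
    then have "e \<in> P" unfolding e_def
      using q(2) p(2) division_subringD(2)[OF F] P_ring(4) F_P \<open>\<And>k. t ^ k \<in> P\<close> by simp
    have "t ^ n * d * e = t ^ n * (d * inverse d) * t ^ (m - n) * c"
      by (simp only: e_def mult.assoc)
    also have "\<dots> = t ^ (n + (m - n)) * c" using False by (simp add: power_add)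
    finally have "t ^ n * d * e = t ^ m * c" using assms(3) by simp
    then have eq: "p - q * e = p' + (q' * (- inverse d)) * t ^ (m - n) * c"
      by (simp add: p q distrib_right e_def mult.assoc)
    have "poly m ((q' * (- inverse d)) * t ^ (m - n) * c)"
      using poly_mult_const[OF poly_mult_t_power[OF poly_mult_const[OF q(1), of "- inverse d"], of "m - n"] p(2)]
        division_subringD(2)[OF F q(2)] F_ring assms(3) by simp
    then have "poly m (p - q * e)" unfolding eq by (rule poly_add[OF p(1)])
    then show ?thesis using \<open>e \<in> P\<close> by blast
  qed (use q in simp)
qed

text \<open>Euclid's algorithm. The pair of cofactors is only required to be nonzero, so that the claim holds for
  \<open>p = 0\<close> and \<open>q = 0\<close> as well.\<close>

lemma common_multiple:
  "poly m p \<Longrightarrow> poly n q \<Longrightarrow> \<exists>s\<in>P. \<exists>s'\<in>P. (s \<noteq> 0 \<or> s' \<noteq> 0) \<and> p * s = q * s'"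
proof (induction "m + n" arbitrary: m n p q rule: less_induct)
  case less
  show ?case
  proof (cases "m = 0 \<or> n = 0")
    case True
    then have "p = 0 \<or> q = 0" using less.prems by auto
    then show ?thesis using P_ring(1,2) by (metis mult_zero_left mult_zero_right zero_neq_one)
  next
    case False
    then obtain m' n' where mn: "m = Suc m'" "n = Suc n'" by (metis not0_implies_Suc)
    consider "poly n' q" | e where "e \<in> P" "poly m' (p - q * e)" | "poly m' p"
      | e where "e \<in> P" "poly n' (q - p * e)"
      using poly_reduce[of m' p n' q] poly_reduce[of n' q m' p] less.prems mn
      by (cases "n' \<le> m'") auto
    then show ?thesis
    proof cases
      case 1
      then show ?thesis using less.hyps[of m n' p q] less.prems mn by auto
    next
      case 2
      obtain s s' where s: "s \<in> P" "s' \<in> P" "s \<noteq> 0 \<or> s' \<noteq> 0" "(p - q * e) * s = q * s'"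
        using less.hyps[OF _ 2(2) less.prems(2)] mn by auto
      have "p * s = q * (s' + e * s)" using s(4) by (simp add: algebra_simps)
      moreover have "s \<noteq> 0 \<or> s' + e * s \<noteq> 0" using s(3) by auto
      moreover have "s' + e * s \<in> P" using s 2 P_ring by auto
      ultimately show ?thesis using s(1) by blast
    next
      case 3
      then show ?thesis using less.hyps[of m' n p q] less.prems mn by auto
    next
      case 4
      obtain s s' where s: "s \<in> P" "s' \<in> P" "s \<noteq> 0 \<or> s' \<noteq> 0" "p * s = (q - p * e) * s'"
        using less.hyps[OF _ less.prems(1) 4(2)] mn by auto
      have "p * (s + e * s') = q * s'" using s(4) by (simp add: algebra_simps)
      moreover have "s + e * s' \<noteq> 0 \<or> s' \<noteq> 0" using s(3) by auto
      moreover have "s + e * s' \<in> P" using s 4 P_ring by auto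
      ultimately show ?thesis using s(2) by blast
    qed
  qed
qed

text \<open>The denominators of the valuation ring.\<close>

definition S :: "'d set" where "S = {c + t * p | c p. c \<in> F \<and> c \<noteq> 0 \<and> p \<in> P}"

lemma S_E:
  assumes "q \<in> S"
  obtains c p where "c \<in> F" "c \<noteq> 0" "p \<in> P" "q = c + t * p"
  using assms unfolding S_def by blast

lemma S_P: "q \<in> S \<Longrightarrow> q \<in> P"
proof -
  assume "q \<in> S"
  then obtain c p where *: "c \<in> F" "p \<in> P" "q = c + t * p" unfolding S_def by blast
  show ?thesis unfolding *(3) by (rule P_ring(6)[OF F_P[OF *(1)] P_ring(4)[OF t_P *(2)]])
qed

lemma S_or_t: "p \<in> P \<Longrightarrow> p \<in> S \<or> (\<exists>p'\<in>P. p = t * p')"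
proof -
  assume "p \<in> P"
  then obtain c p' where "c \<in> F" "p' \<in> P" "p = c + t * p'" using P_low by blast
  then show ?thesis by (cases "c = 0") (auto simp: S_def)
qed

lemma S_not_t: "t * p \<in> S \<Longrightarrow> p \<in> P \<Longrightarrow> False"
proof -
  assume "t * p \<in> S" "p \<in> P"
  obtain c p' where *: "c \<in> F" "c \<noteq> 0" "p' \<in> P" "t * p = c + t * p'"
    using \<open>t * p \<in> S\<close> by (rule S_E)
  have "c + t * (p' - p) = 0" using *(4) by (simp add: right_diff_distrib)
  then show False using constant_term_zero[OF *(1) P_ring(3)[OF *(3) \<open>p \<in> P\<close>]] *(2) by simp
qed

lemma S_nonzero: "q \<in> S \<Longrightarrow> q \<noteq> 0"
  using S_not_t[OF _ P_ring(1)] by fastforce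

lemma S_add_t: "q \<in> S \<Longrightarrow> p \<in> P \<Longrightarrow> q + t * p \<in> S"
proof -
  assume "q \<in> S" "p \<in> P"
  obtain c p' where *: "c \<in> F" "c \<noteq> 0" "p' \<in> P" "q = c + t * p'"
    using \<open>q \<in> S\<close> by (rule S_E)
  have "q + t * p = c + t * (p' + p)" using *(4) by (simp add: distrib_left)
  then show ?thesis using * P_ring(6)[OF *(3) \<open>p \<in> P\<close>] unfolding S_def by blast
qed

lemma S_cancel: "q \<in> S \<Longrightarrow> inverse q * (q * x) = x" "q \<in> S \<Longrightarrow> q * (inverse q * x) = x"
  using S_nonzero by (simp_all flip: mult.assoc)

lemma S_one: "1 \<in> S"
  unfolding S_def using F_ring P_ring by (intro CollectI exI[of _ 1] exI[of _ 0]) simp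

lemma mult_t_left: "p \<in> P \<Longrightarrow> p' \<in> P \<Longrightarrow> \<exists>r\<in>P. p * (t * p') = t * r"
  using P_conj(2)[of p] P_ring(4)[of "inverse t * p * t" p']
  by (intro bexI[of _ "inverse t * p * t * p'"]) (simp_all add: mult.assoc)

lemma S_mult: "p \<in> S \<Longrightarrow> q \<in> S \<Longrightarrow> p * q \<in> S"
proof -
  assume "p \<in> S" "q \<in> S"
  obtain b p' where b: "b \<in> F" "b \<noteq> 0" "p' \<in> P" "p = b + t * p'"
    using \<open>p \<in> S\<close> by (rule S_E)
  obtain c q' where c: "c \<in> F" "c \<noteq> 0" "q' \<in> P" "q = c + t * q'"
    using \<open>q \<in> S\<close> by (rule S_E)
  obtain r where r: "r \<in> P" "p * (t * q') = t * r" using mult_t_left[OF S_P[OF \<open>p \<in> S\<close>] c(3)] by blast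
  have "p * q = p * c + p * (t * q')" unfolding c(4) by (rule distrib_left)
  also have "p * c = b * c + t * (p' * c)" unfolding b(4) by (simp add: distrib_right mult.assoc)
  finally have "p * q = b * c + t * (p' * c + r)" unfolding r(2) by (simp add: distrib_left add.assoc)
  moreover have "b * c \<in> F" "b * c \<noteq> 0" using b c F_ring(4) by auto
  moreover have "p' * c + r \<in> P" using P_ring(6)[OF P_ring(4)[OF b(3) F_P[OF c(1)]] r(1)] .
  ultimately show ?thesis unfolding S_def by blast
qed

lemma S_factor_right: "p \<in> P \<Longrightarrow> q \<in> P \<Longrightarrow> p * q \<in> S \<Longrightarrow> q \<in> S"
proof (rule ccontr)
  assume *: "p \<in> P" "q \<in> P" "p * q \<in> S" "q \<notin> S"
  then obtain q' where "q' \<in> P" "q = t * q'" using S_or_t by blast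
  then obtain r where "r \<in> P" "p * q = t * r" using mult_t_left[OF *(1)] by blast
  then show False using S_not_t *(3) by simp
qed

lemma S_conj: "q \<in> S \<Longrightarrow> t * q * inverse t \<in> S" "q \<in> S \<Longrightarrow> inverse t * q * t \<in> S"
proof -
  assume "q \<in> S"
  then obtain c p where *: "c \<in> F" "c \<noteq> 0" "p \<in> P" "q = c + t * p" by (rule S_E)
  have "t * q * inverse t = t * c * inverse t + t * (t * p * inverse t)"
    unfolding *(4) by (simp add: distrib_left distrib_right mult.assoc)
  moreover have "t * c * inverse t \<noteq> 0" using * t0 by simp
  ultimately show "t * q * inverse t \<in> S"
    unfolding S_def using P_conj(1)[OF *(3)] conj(1)[OF *(1)] by blast
  have "inverse t * q * t = inverse t * c * t + t * (inverse t * p * t)"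
    unfolding *(4) by (simp add: distrib_left distrib_right mult.assoc)
  moreover have "inverse t * c * t \<noteq> 0" using * t0 by simp
  ultimately show "inverse t * q * t \<in> S"
    unfolding S_def using P_conj(2)[OF *(3)] conj(2)[OF *(1)] by blast
qed

lemma factor_t_power: "p \<in> P \<Longrightarrow> p \<noteq> 0 \<Longrightarrow> \<exists>k. \<exists>q\<in>S. p = t ^ k * q"
proof -
  assume "p \<in> P" "p \<noteq> 0"
  then obtain m where "poly m p" by (auto simp: P_def)
  then show ?thesis using \<open>p \<noteq> 0\<close>
  proof (induction m arbitrary: p)
    case (Suc m)
    then obtain c p' where p: "c \<in> F" "poly m p'" "p = c + t * p'" by (auto simp: poly_Suc_low)
    show ?case
    proof (cases "c = 0")
      case True
      then obtain k q where "q \<in> S" "p' = t ^ k * q" using Suc p by fastforce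
      then have "p = t ^ Suc k * q" using p True by (simp add: mult.assoc)
      then show ?thesis using \<open>q \<in> S\<close> by blast
    next
      case False
      then have "p \<in> S" using p by (auto simp: S_def P_def)
      then show ?thesis by (intro exI[of _ 0]) auto
    qed
  qed simp
qed

lemma t_power_left_cancel:
  "q \<in> S \<Longrightarrow> r \<in> P \<Longrightarrow> p \<in> P \<Longrightarrow> q * r = p * t ^ k \<Longrightarrow> \<exists>r'\<in>P. r = r' * t ^ k"
proof (induction k arbitrary: r p)
  case (Suc k)
  obtain p' where p': "p' \<in> P" "p * t = t * p'" using mult_t_left[OF Suc.prems(3) P_ring(2)] by auto
  have eq: "q * r = (p * t) * t ^ k" using Suc.prems by (simp add: mult.assoc)
  then obtain r' where r': "r' \<in> P" "r = r' * t ^ k"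
    using Suc.IH[OF Suc.prems(1,2) _ eq] P_ring(4)[OF Suc.prems(3) t_P] by blast
  have "q * r' * t ^ k = t * p' * t ^ k" using eq r' p' by (simp add: mult.assoc)
  then have "q * r' = t * p'" using t0 by simp
  moreover have "q * r' \<in> S" if "r' \<in> S" using S_mult Suc.prems(1) that by blast
  ultimately have "r' \<notin> S" using S_not_t p'(1) by metis
  then obtain r'' where r'': "r'' \<in> P" "r' = t * r''" using S_or_t r' by blast
  have "r = (t * r'' * inverse t) * t ^ Suc k" using r' r'' t0 by (simp add: mult.assoc)
  then show ?case using P_conj(1)[OF r''(1)] by blast
qed auto

text \<open>The right Ore condition for the denominators \<open>S\<close>.\<close>

lemma ore:
  assumes "p \<in> P" "q \<in> S"
  shows "\<exists>s\<in>S. \<exists>r\<in>P. p * s = q * r"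
proof -
  obtain m n where "poly m p" "poly n q" using assms(1) S_P[OF assms(2)] by (auto simp: P_def)
  then obtain s r where s: "s \<in> P" "r \<in> P" "s \<noteq> 0 \<or> r \<noteq> 0" "p * s = q * r"
    using common_multiple by blast
  have "s \<noteq> 0" using s S_nonzero[OF assms(2)] by auto
  then obtain k s' where k: "s' \<in> S" "s = t ^ k * s'" using factor_t_power s(1) by blast
  define s'' where "s'' = t ^ k * s' * inverse t ^ k"
  have s'': "s'' \<in> S"
  proof -
    have "t ^ k * x * inverse t ^ k \<in> S" if "x \<in> S" for x
    proof (induction k)
      case (Suc k)
      have "t ^ Suc k * x * inverse t ^ Suc k = t * (t ^ k * x * inverse t ^ k) * inverse t"
        by (simp add: mult.assoc power_commutes)
      then show ?case using S_conj(1)[OF Suc] by simp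
    qed (use that in simp)
    then show ?thesis using k by (simp add: s''_def)
  qed
  have "s = s'' * t ^ k" using t0 k by (simp add: s''_def power_inverse mult.assoc)
  then have "q * r = (p * s'') * t ^ k" using s by (simp add: mult.assoc)
  then obtain r' where r': "r' \<in> P" "r = r' * t ^ k"
    using t_power_left_cancel[OF assms(2) s(2)] P_ring(4)[OF assms(1) S_P[OF s'']] by blast
  have "p * s'' * t ^ k = q * r' * t ^ k" using \<open>q * r = _\<close> r' by (simp add: mult.assoc)
  then have "p * s'' = q * r'" using t0 by simp
  then show ?thesis using s'' r' by blast
qed

definition V :: "'d set" where "V = {p * inverse q | p q. p \<in> P \<and> q \<in> S}"

lemma V_I: "p \<in> P \<Longrightarrow> q \<in> S \<Longrightarrow> p * inverse q \<in> V"
  by (auto simp: V_def)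

lemma P_V: "p \<in> P \<Longrightarrow> p \<in> V"
  using V_I[OF _ S_one] by simp

lemma fraction_expand:
  assumes "s \<in> S" "q \<in> S" "q * r = s"
  shows "inverse q = r * inverse s"
proof -
  have "r \<noteq> 0" "q \<noteq> 0" using assms(3) S_nonzero[OF assms(1)] S_nonzero[OF assms(2)] by auto
  then show ?thesis using assms(3) by (auto simp: nonzero_inverse_mult_distrib simp flip: mult.assoc)
qed

lemma unital_subring_V: "unital_subring V"
  unfolding unital_subring_def
proof (intro conjI ballI)
  show "1 \<in> V" using P_V P_ring(2) by blast
next
  fix v w assume "v \<in> V" "w \<in> V"
  then obtain p q p' q' where *: "v = p * inverse q" "w = p' * inverse q'" "p \<in> P" "p' \<in> P" "q \<in> S" "q' \<in> S"
    unfolding V_def by blast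
  obtain s r where s: "s \<in> S" "r \<in> P" "q * s = q' * r" using ore[OF S_P[OF *(5)] *(6)] by blast
  have qs: "q * s \<in> S" using * s S_mult by blast
  have "v - w = (p * s - p' * r) * inverse (q * s)"
    using fraction_expand[OF qs *(5) refl] fraction_expand[OF qs *(6) s(3)[symmetric]]
    by (simp add: * left_diff_distrib mult.assoc)
  moreover have "p * s - p' * r \<in> P" using * s S_P by (intro P_ring) auto
  ultimately show "v - w \<in> V" using V_I qs by metis
  obtain s' r' where s': "s' \<in> S" "r' \<in> P" "p' * s' = q * r'" using ore[OF *(4,5)] by blast
  have qp': "inverse q * p' = inverse q * (p' * s') * inverse s'"
    using S_nonzero[OF s'(1)] by (simp add: mult.assoc)
  have "v * w = p * (inverse q * p') * inverse q'" by (simp add: * mult.assoc)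
  also have "\<dots> = p * (r' * inverse s') * inverse q'"
    unfolding qp' s'(3) by (simp add: mult.assoc S_cancel *(5))
  finally have "v * w = (p * r') * inverse (q' * s')"
    using S_nonzero[OF s'(1)] S_nonzero[OF *(6)] by (simp add: nonzero_inverse_mult_distrib mult.assoc)
  moreover have "p * r' \<in> P" "q' * s' \<in> S" using * s' P_ring S_mult by auto
  ultimately show "v * w \<in> V" using V_I by metis
qed

lemma V_conj: "v \<in> V \<Longrightarrow> t * v * inverse t \<in> V" "v \<in> V \<Longrightarrow> inverse t * v * t \<in> V"
proof -
  assume "v \<in> V"
  then obtain p q where *: "v = p * inverse q" "p \<in> P" "q \<in> S" unfolding V_def by blast
  have q0: "q \<noteq> 0" using * S_nonzero by blast
  have "t * v * inverse t = (t * p * inverse t) * inverse (t * q * inverse t)"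
    using q0 t0 by (simp add: *(1) nonzero_inverse_mult_distrib mult.assoc)
  then show "t * v * inverse t \<in> V" using V_I P_conj(1) S_conj(1) * by metis
  have "inverse t * v * t = (inverse t * p * t) * inverse (inverse t * q * t)"
    using q0 t0 by (simp add: *(1) nonzero_inverse_mult_distrib mult.assoc)
  then show "inverse t * v * t \<in> V" using V_I P_conj(2) S_conj(2) * by metis
qed

lemma power_conj:
  assumes "\<And>x. x \<in> X \<Longrightarrow> t * x * inverse t \<in> X" "\<And>x. x \<in> X \<Longrightarrow> inverse t * x * t \<in> X" "x \<in> X"
  shows "t powi n * x * t powi (- n) \<in> X"
proof (induction n rule: int_induct[where k = 0])
  case (step1 i)
  have "t powi (i + 1) = t * t powi i" "t powi (- (i + 1)) = t powi (- i) * inverse t"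
    using t0 power_int_add[of t 1 i] power_int_add[of t "- i" "- 1"] by (auto simp: add.commute power_int_minus)
  then show ?case using assms(1)[OF step1(2)] by (simp add: mult.assoc)
next
  case (step2 i)
  have "t powi (i - 1) = inverse t * t powi i" "t powi (- (i - 1)) = t powi (- i) * t"
    using t0 power_int_add[of t "- 1" i] power_int_add[of t "- i" 1] by (auto simp: add.commute power_int_minus)
  then show ?case using assms(2)[OF step2(2)] by (simp add: mult.assoc)
qed (use assms in simp)

text \<open>A fraction is a power \<open>t ^ k\<close> times a unit of \<open>V\<close>; if it were divisible by \<open>t ^ Suc k\<close> too, then \<open>t\<close>
  would divide an element of \<open>S\<close>.\<close>

lemma V_separated:
  assumes "\<And>k. \<exists>v\<in>V. x = t ^ k * v"
  shows "x = 0"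
proof (rule ccontr)
  assume "x \<noteq> 0"
  obtain p q where x: "x = p * inverse q" "p \<in> P" "q \<in> S" using assms[of 0] by (auto simp: V_def)
  then obtain k \<sigma> where k: "\<sigma> \<in> S" "p = t ^ k * \<sigma>" using factor_t_power[of p] \<open>x \<noteq> 0\<close> by auto
  obtain p' q' where x': "x = t ^ Suc k * (p' * inverse q')" "p' \<in> P" "q' \<in> S"
    using assms[of "Suc k"] by (auto simp: V_def)
  have "t ^ k * (\<sigma> * inverse q) = t ^ k * (t * p' * inverse q')"
    using x(1) x'(1) k(2) unfolding power_Suc2 by (auto simp: mult.assoc)
  then have eq: "\<sigma> * inverse q = t * p' * inverse q'" using t0 by simp
  obtain s r where s: "s \<in> S" "r \<in> P" "q' * s = q * r" using ore[OF S_P[OF x'(3)] x(3)] by blast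
  have "r \<in> S" using S_factor_right[OF S_P[OF x(3)] s(2)] S_mult[OF x'(3) s(1)] s(3) by simp
  have "\<sigma> * r = \<sigma> * inverse q * (q * r)" by (simp add: mult.assoc S_cancel x(3))
  also have "\<dots> = t * p' * (inverse q' * q') * s" unfolding eq s(3)[symmetric] by (simp only: mult.assoc)
  also have "\<dots> = t * (p' * s)" using S_nonzero[OF x'(3)] by (simp add: mult.assoc)
  finally show False
    using S_not_t[of "p' * s"] S_mult[OF k(1) \<open>r \<in> S\<close>] P_ring(4)[OF x'(2) S_P[OF s(1)]] by simp
qed

lemma adic_V: "adic (\<lambda>k. t powi k) V F"
proof
  fix v assume "v \<in> V"
  then obtain p q where *: "v = p * inverse q" "p \<in> P" "q \<in> S" unfolding V_def by blast
  have qp: "q + t * p \<in> S" using S_add_t * by blast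
  have "1 + t * v = (q + t * p) * inverse q"
    using S_nonzero[OF *(3)] by (simp add: * distrib_right mult.assoc)
  then have "(1 + t * v) * (q * inverse (q + t * p)) = 1" "q * inverse (q + t * p) * (1 + t * v) = 1"
    using S_nonzero[OF *(3)] S_nonzero[OF qp] S_cancel[OF *(3)] S_cancel(1)[OF qp]
    by (simp_all add: mult.assoc)
  then show "\<exists>w\<in>V. (1 + t powi 1 * v) * w = 1 \<and> w * (1 + t powi 1 * v) = 1"
    using V_I[OF S_P[OF *(3)] qp] by auto
next
  fix x assume *: "\<And>n. \<exists>v\<in>V. x = t powi n * v"
  have "\<exists>v\<in>V. x = t ^ k * v" for k using *[of "int k"] by simp
  then show "x = 0" by (rule V_separated)
next
  fix c c' assume "c \<in> F" "c * c' = 1"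
  then show "c' \<in> F" using division_subringD(2)[OF F] by (metis inverse_unique)
qed (use t0 unital_subring_V division_subringD(1)[OF F] F_P P_V t_P V_conj conj power_conj
      in \<open>auto simp: power_int_add\<close>)

end

section \<open>Degree maps and unique products\<close>

text \<open>Degree maps are a convenient form of normal subgroups with infinite cyclic quotient and a
  chosen generator; this lemma and the next one translate between the two.\<close>

lemma (in group) infinite_cyclic_quotient_degree:
  assumes "N \<lhd> G" "infinite_cyclic (G Mod N)"
  shows "\<exists>d. (\<forall>x\<in>carrier G. \<forall>y\<in>carrier G. d (x \<otimes> y) = d x + d y) \<and> (\<exists>t\<in>carrier G. d t = (1::int))"
proof -
  interpret N: normal N G by fact
  interpret Q: group "G Mod N" by (rule N.factorgroup_is_group)
  obtain c where c: "c \<in> carrier (G Mod N)" "subgroup_generated (G Mod N) {c} = G Mod N"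
    using assms(2) by (auto simp: infinite_cyclic_def cyclic_group_def)
  have "infinite (carrier (subgroup_generated (G Mod N) {c}))"
    using assms(2) c(2) by (simp add: infinite_cyclic_def)
  then have inj: "c [^]\<^bsub>G Mod N\<^esub> i = c [^]\<^bsub>G Mod N\<^esub> j \<Longrightarrow> i = j" for i j :: int
    using Q.infinite_cyclic_subgroup_int[OF c(1)] by blast
  have range: "carrier (G Mod N) = range (\<lambda>n::int. c [^]\<^bsub>G Mod N\<^esub> n)"
    using Q.carrier_subgroup_generated_by_singleton[OF c(1)] c(2) by simp
  define d where "d x = (THE n::int. N #> x = c [^]\<^bsub>G Mod N\<^esub> n)" for x
  have d: "N #> x = c [^]\<^bsub>G Mod N\<^esub> d x" if "x \<in> carrier G" for x
  proof -
    have "N #> x \<in> range (\<lambda>n::int. c [^]\<^bsub>G Mod N\<^esub> n)"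
      using that unfolding range[symmetric] carrier_FactGroup by blast
    then obtain n where n: "N #> x = c [^]\<^bsub>G Mod N\<^esub> (n::int)" by blast
    then show ?thesis unfolding d_def by (rule theI) (use n inj in auto)
  qed
  have "d (x \<otimes> y) = d x + d y" if "x \<in> carrier G" "y \<in> carrier G" for x y
  proof (rule inj)
    have "c [^]\<^bsub>G Mod N\<^esub> d (x \<otimes> y) = (N #> x) <#> (N #> y)"
      using that d[of "x \<otimes> y"] by (simp add: N.rcos_sum)
    also have "\<dots> = c [^]\<^bsub>G Mod N\<^esub> (d x + d y)"
      using that d c(1) by (simp add: Q.int_pow_mult)
    finally show "c [^]\<^bsub>G Mod N\<^esub> d (x \<otimes> y) = c [^]\<^bsub>G Mod N\<^esub> (d x + d y)" .
  qed
  moreover obtain t where t: "t \<in> carrier G" "c = N #> t" using c(1) by (auto simp: carrier_FactGroup)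
  moreover have "d t = 1"
  proof (rule inj)
    show "c [^]\<^bsub>G Mod N\<^esub> d t = c [^]\<^bsub>G Mod N\<^esub> (1::int)"
      using d[OF t(1)] t(2) c(1) by (simp add: Q.int_pow_1)
  qed
  ultimately show ?thesis by blast
qed

lemma (in group) degree_kernel_quotient:
  assumes hom: "\<And>x y. x \<in> carrier G \<Longrightarrow> y \<in> carrier G \<Longrightarrow> d (x \<otimes> y) = d x + (d y :: int)"
    and t: "t \<in> carrier G" "d t = 1" and N: "N = {x \<in> carrier G. d x = 0}"
  shows "N \<lhd> G" "infinite_cyclic (G Mod N)" "carrier (G Mod N) = generate (G Mod N) {N #> t}"
proof -
  interpret d: group_hom G integer_group d
    unfolding group_hom_def group_hom_axioms_def hom_def
    using is_group group_integer_group hom by simp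
  have ker: "N = kernel G integer_group d" by (auto simp: N kernel_def)
  show norm: "N \<lhd> G" unfolding ker by (rule d.normal_kernel)
  interpret N: normal N G by fact
  interpret Q: group "G Mod N" by (rule N.factorgroup_is_group)
  have dt: "d (t [^] (k::int)) = k" for k
    using d.hom_int_pow[OF t(1), of k] t(2) by simp
  have "d ` carrier G = carrier integer_group"
    using dt t(1) by (auto intro!: image_eqI[of _ _ "t [^] (_::int)"])
  then have iso: "G Mod N \<cong> integer_group" unfolding ker by (rule d.FactGroup_iso)
  have "infinite (carrier (G Mod N))"
    using iso_same_card[OF iso] iso unfolding is_iso_def iso_def
    by (auto dest: bij_betw_finite simp: infinite_UNIV_int)
  then show "infinite_cyclic (G Mod N)"
    using isomorphic_group_cyclicity[OF iso Q.is_group] by (simp add: infinite_cyclic_def)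
  have Nt: "N #> t \<in> carrier (G Mod N)" using t(1) by (auto simp: carrier_FactGroup)
  have "N #> x = (N #> t) [^]\<^bsub>G Mod N\<^esub> d x" if x: "x \<in> carrier G" for x
  proof -
    have "d (x \<otimes> inv (t [^] d x)) = 0" using x t(1) dt by (simp add: hom d.hom_inv)
    then have "x \<otimes> inv (t [^] d x) \<in> N"
      unfolding N using x t(1) by (intro CollectI conjI m_closed inv_closed int_pow_closed)
    then have "x \<in> N #> (t [^] d x)" using x t(1) by (intro N.rcos_module_rev) (auto simp: is_group)
    then have "N #> x = N #> (t [^] d x)"
      using repr_independence[of x N "t [^] d x"] t(1) N.is_subgroup by simp
    then show ?thesis using N.FactGroup_int_pow[OF t(1)] by simp
  qed
  then have "carrier (G Mod N) \<subseteq> {(N #> t) [^]\<^bsub>G Mod N\<^esub> (k::int) | k. k \<in> UNIV}"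
    unfolding carrier_FactGroup by blast
  moreover have "generate (G Mod N) {N #> t} \<subseteq> carrier (G Mod N)"
    using Nt by (intro Q.generate_incl) simp
  ultimately show "carrier (G Mod N) = generate (G Mod N) {N #> t}"
    unfolding Q.generate_pow[OF Nt] by blast
qed

lemma locally_indicable_subgroups:
  assumes "locally_indicable G"
  shows "indicable_subgroups G"
  unfolding indicable_subgroups_def
proof (intro allI impI)
  fix H assume H: "nontrivial_fg_subgroup H G"
  interpret group G using assms by (simp add: locally_indicable_def)
  have sub: "subgroup H G" using H by (simp add: nontrivial_fg_subgroup_def)
  interpret H: group "G\<lparr>carrier := H\<rparr>" using sub by (rule subgroup_imp_group)
  obtain N where "N \<lhd> G\<lparr>carrier := H\<rparr>" "infinite_cyclic (G\<lparr>carrier := H\<rparr> Mod N)"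
    using assms H unfolding locally_indicable_def by blast
  from H.infinite_cyclic_quotient_degree[OF this] sub
  show "\<exists>d. degree_map G H d \<and> (\<exists>t\<in>H. d t = 1)" by (simp add: degree_map_def)
qed

definition (in group) unique_product :: "'a set \<Rightarrow> 'a set \<Rightarrow> 'a \<Rightarrow> 'a \<Rightarrow> bool" where
  "unique_product X Y x y \<longleftrightarrow>
     x \<in> X \<and> y \<in> Y \<and> (\<forall>a\<in>X. \<forall>b\<in>Y. a \<otimes> b = x \<otimes> y \<longrightarrow> a = x \<and> b = y)"

text \<open>After translating both sets to contain the identity, they generate a group with a nonzero degree
  map. The products of largest degree are products of elements of largest degree, and by induction one of
  them is unique; likewise for the smallest degree. These two products are different, since the degree
  is not constant on at least one of the sets.\<close>

lemma (in group) two_unique_products: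
  assumes ind: "indicable_subgroups G"
    and "finite X" "finite Y" "X \<noteq> {}" "Y \<noteq> {}" "X \<subseteq> carrier G" "Y \<subseteq> carrier G"
  shows "\<exists>x y x' y'. unique_product X Y x y \<and> unique_product X Y x' y' \<and>
           (card X + card Y > 2 \<longrightarrow> x \<otimes> y \<noteq> x' \<otimes> y')"
  using assms(2-)
proof (induction "card X + card Y" arbitrary: X Y rule: less_induct)
  case less
  note IH = less.hyps and fin = less.prems(1,2) and ne = less.prems(3,4) and sub = less.prems(5,6)
  obtain x\<^sub>0 y\<^sub>0 where xy0: "x\<^sub>0 \<in> X" "y\<^sub>0 \<in> Y" using ne by blast
  have car: "x \<in> X \<Longrightarrow> x \<in> carrier G" "y \<in> Y \<Longrightarrow> y \<in> carrier G" for x y using sub by auto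
  show ?case
  proof (cases "X = {x\<^sub>0} \<and> Y = {y\<^sub>0}")
    case True
    then show ?thesis by (auto simp: unique_product_def)
  next
    case False
    define Z where "Z = (\<lambda>x. inv x\<^sub>0 \<otimes> x) ` X \<union> (\<lambda>y. y \<otimes> inv y\<^sub>0) ` Y"
    define H where "H = generate G Z"
    have Z: "finite Z" "Z \<subseteq> carrier G" using fin car xy0 by (auto simp: Z_def)
    have ZH: "Z \<subseteq> H" by (auto simp: H_def intro: generate.incl)
    have "\<exists>z\<in>Z. z \<noteq> \<one>"
    proof (cases "X = {x\<^sub>0}")
      case True
      then obtain y where y: "y \<in> Y" "y \<noteq> y\<^sub>0" using False xy0 by blast
      then have "y \<otimes> inv y\<^sub>0 \<noteq> \<one>" using car xy0 inv_equality[of y "inv y\<^sub>0"] by fastforce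
      then show ?thesis using y by (auto simp: Z_def)
    next
      case False
      then obtain x where x: "x \<in> X" "x \<noteq> x\<^sub>0" using xy0 by blast
      then have "inv x\<^sub>0 \<otimes> x \<noteq> \<one>" using car xy0 by (metis inv_closed inv_equality inv_inv)
      then show ?thesis using x by (auto simp: Z_def)
    qed
    then have "nontrivial_fg_subgroup H G"
      using Z ZH generate_is_subgroup[OF Z(2)] unfolding nontrivial_fg_subgroup_def H_def by blast
    then obtain d t where d: "degree_map G H d" "t \<in> H" "d t = 1"
      using ind by (auto simp: indicable_subgroups_def)
    note dm = degree_mapD[OF d(1)]
    define a where "a x = d (inv x\<^sub>0 \<otimes> x)" for x
    define b where "b y = d (y \<otimes> inv y\<^sub>0)" for y
    have H_mem: "x \<in> X \<Longrightarrow> inv x\<^sub>0 \<otimes> x \<in> H" "y \<in> Y \<Longrightarrow> y \<otimes> inv y\<^sub>0 \<in> H" for x y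
      using ZH by (auto simp: Z_def)
    have ab0: "a x\<^sub>0 = 0" "b y\<^sub>0 = 0" using car xy0 dm(3) by (auto simp: a_def b_def)
    have nonzero: "\<not> ((\<forall>x\<in>X. a x = 0) \<and> (\<forall>y\<in>Y. b y = 0))"
    proof
      assume *: "(\<forall>x\<in>X. a x = 0) \<and> (\<forall>y\<in>Y. b y = 0)"
      have "d z = 0 \<and> z \<in> H" if "z \<in> generate G Z" for z using that
      proof (induction rule: generate.induct)
        case (eng y z)
        then show ?case using dm subgroup.m_closed[OF dm(1)] by auto
      next
        case (incl z)
        then show ?case using * ZH by (auto simp: Z_def a_def b_def)
      next
        case (inv z)
        then have "d z = 0" "z \<in> H" using * ZH by (auto simp: Z_def a_def b_def)
        then show ?case using dm(4) subgroup.m_inv_closed[OF dm(1)] by auto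
      qed (use dm(3) subgroup.one_closed[OF dm(1)] in auto)
      then show False using d(2,3) by (auto simp: H_def)
    qed
    have ab: "a x + b y = a x' + b y'"
      if "x \<in> X" "y \<in> Y" "x' \<in> X" "y' \<in> Y" "x \<otimes> y = x' \<otimes> y'" for x y x' y'
    proof -
      have "a x + b y = d (inv x\<^sub>0 \<otimes> (x \<otimes> y) \<otimes> inv y\<^sub>0)" if "x \<in> X" "y \<in> Y" for x y
        using dm(2)[OF H_mem(1)[OF that(1)] H_mem(2)[OF that(2)]] that car xy0
        by (simp add: a_def b_def m_assoc)
      then show ?thesis using that by metis
    qed
    \<comment> \<open>The sign \<open>e\<close> selects the largest or the smallest degree.\<close>
    have extremal: "\<exists>x y. unique_product X Y x y \<and> e * a x = m \<and> e * b y = n"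
      if e: "e = 1 \<or> e = - 1" and m: "m = Max ((\<lambda>x. e * a x) ` X)" and n: "n = Max ((\<lambda>y. e * b y) ` Y)" for e m n :: int
    proof -
      define X' where "X' = {x \<in> X. e * a x = m}"
      define Y' where "Y' = {y \<in> Y. e * b y = n}"
      have m_in: "m \<in> (\<lambda>x. e * a x) ` X" "n \<in> (\<lambda>y. e * b y) ` Y"
        unfolding m n using fin ne by (auto intro!: Max_in)
      have m_max: "x \<in> X \<Longrightarrow> e * a x \<le> m" "y \<in> Y \<Longrightarrow> e * b y \<le> n" for x y
        using fin unfolding m n by (auto intro!: Max_ge)
      have ne': "X' \<noteq> {}" "Y' \<noteq> {}" using m_in by (auto simp: X'_def Y'_def)
      have "\<not> (X' = X \<and> Y' = Y)"
      proof
        assume *: "X' = X \<and> Y' = Y"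
        then have "m = 0" "n = 0" using xy0 ab0 by (auto simp: X'_def Y'_def)
        moreover have "\<forall>x\<in>X. e * a x = m" "\<forall>y\<in>Y. e * b y = n" using * by (auto simp: X'_def Y'_def)
        ultimately show False using nonzero e by auto
      qed
      moreover have "X' \<subseteq> X" "Y' \<subseteq> Y" by (auto simp: X'_def Y'_def)
      ultimately have "card X' + card Y' < card X + card Y"
        using fin by (metis add_less_le_mono add_le_less_mono card_mono psubset_card_mono psubsetI)
      from IH[OF this] obtain x y where xy: "unique_product X' Y' x y"
        using ne' fin sub by (auto simp: X'_def Y'_def)
      then have "x \<in> X" "y \<in> Y" "e * a x = m" "e * b y = n"
        by (auto simp: unique_product_def X'_def Y'_def)
      moreover have "x' = x \<and> y' = y" if "x' \<in> X" "y' \<in> Y" "x' \<otimes> y' = x \<otimes> y" for x' y'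
      proof -
        have "a x' + b y' = a x + b y" using ab that calculation by blast
        then have "e * a x' + e * b y' = m + n" using e calculation(3,4) by auto
        then have "e * a x' = m" "e * b y' = n" using m_max(1)[OF that(1)] m_max(2)[OF that(2)] by auto
        then show ?thesis using xy that by (auto simp: unique_product_def X'_def Y'_def)
      qed
      ultimately show ?thesis by (auto simp: unique_product_def)
    qed
    define M\<^sub>X where "M\<^sub>X e = Max ((\<lambda>x. e * a x) ` X)" for e
    define M\<^sub>Y where "M\<^sub>Y e = Max ((\<lambda>y. e * b y) ` Y)" for e
    have M_le: "x \<in> X \<Longrightarrow> e * a x \<le> M\<^sub>X e" "y \<in> Y \<Longrightarrow> e * b y \<le> M\<^sub>Y e" for x y e
      using fin unfolding M\<^sub>X_def M\<^sub>Y_def by (auto intro!: Max_ge)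
    obtain x y where xy: "unique_product X Y x y" "a x = M\<^sub>X 1" "b y = M\<^sub>Y 1"
      using extremal[of 1 "M\<^sub>X 1" "M\<^sub>Y 1"] by (auto simp: M\<^sub>X_def M\<^sub>Y_def)
    obtain x' y' where xy': "unique_product X Y x' y'" "- a x' = M\<^sub>X (- 1)" "- b y' = M\<^sub>Y (- 1)"
      using extremal[of "- 1" "M\<^sub>X (- 1)" "M\<^sub>Y (- 1)"] by (auto simp: M\<^sub>X_def M\<^sub>Y_def)
    have "x \<otimes> y \<noteq> x' \<otimes> y'"
    proof
      assume "x \<otimes> y = x' \<otimes> y'"
      then have eq: "x = x'" "y = y'" using xy(1) xy'(1) by (auto simp: unique_product_def)
      have "a z = a x" if "z \<in> X" for z
        using M_le(1)[OF that, of 1] M_le(1)[OF that, of "- 1"] xy xy' eq by simp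
      moreover have "b z = b y" if "z \<in> Y" for z
        using M_le(2)[OF that, of 1] M_le(2)[OF that, of "- 1"] xy xy' eq by simp
      ultimately show False using nonzero ab0 xy0 by metis
    qed
    then show ?thesis using xy xy' by blast
  qed
qed

section \<open>Trivial units of a crossed product\<close>

locale division_crossed_product = crossed_product G K bar \<tau> \<sigma>
  for G (structure) and K :: "'a::ring_1 set" and bar :: "'g \<Rightarrow> 'a" and \<tau> \<sigma> +
  assumes K_division: "division_subring K"
begin

lemmas K_ring = unital_subringD[OF subring]

lemma K_inverse:
  assumes "a \<in> K" "a \<noteq> 0"
  obtains b where "b \<in> K" "a * b = 1" "b * a = 1"
  using assms K_division unfolding division_subring_def ring_units_def by blast

lemma K_mult_nonzero: "a \<in> K \<Longrightarrow> a \<noteq> 0 \<Longrightarrow> b \<noteq> 0 \<Longrightarrow> a * b \<noteq> 0"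
  using K_inverse[of a] by (metis mult.assoc mult_1_left mult_zero_right)

lemma twist: "x \<in> carrier G \<Longrightarrow> y \<in> carrier G \<Longrightarrow> \<tau> x y \<in> K \<and> \<tau> x y \<noteq> 0"
  using twist_unit[of x y] by (auto simp: ring_units_def)

lemma action:
  assumes "x \<in> carrier G" "a \<in> K"
  shows "\<sigma> x a \<in> K" "a \<noteq> 0 \<Longrightarrow> \<sigma> x a \<noteq> 0"
proof -
  have bij: "bij_betw (\<sigma> x) K K" and add: "\<And>a b. a \<in> K \<Longrightarrow> b \<in> K \<Longrightarrow> \<sigma> x (a + b) = \<sigma> x a + \<sigma> x b"
    using action_aut[OF assms(1)] by (auto simp: ring_automorphism_on_def)
  show "\<sigma> x a \<in> K" using bij assms(2) by (auto simp: bij_betw_def)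
  have "\<sigma> x 0 = 0" using add[of 0 0] K_ring(1) by simp
  then show "\<sigma> x a \<noteq> 0" if "a \<noteq> 0"
    using bij assms(2) K_ring(1) that by (metis bij_betw_imp_inj_on inj_onD)
qed

definition line :: "'g \<Rightarrow> 'a set" where
  "line x = {bar x * a | a. a \<in> K}"

definition triv :: "'g \<Rightarrow> 'a set" where
  "triv x = {bar x * a | a. a \<in> K \<and> a \<noteq> 0}"

lemma line_zero: "0 \<in> line x"
  using K_ring(1) by (force simp: line_def)

lemma line_add: "u \<in> line x \<Longrightarrow> v \<in> line x \<Longrightarrow> u + v \<in> line x"
  using K_ring(6) by (auto simp: line_def simp flip: distrib_left)

lemma line_minus: "u \<in> line x \<Longrightarrow> - u \<in> line x"
  using K_ring(5) by (force simp: line_def)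

lemma bar_triv: "bar x \<in> triv x"
  using K_ring(2) by (force simp: triv_def)

lemma triv_line: "triv x \<subseteq> line x"
  by (auto simp: line_def triv_def)

lemma product_formula:
  assumes "x \<in> carrier G" "y \<in> carrier G" "a \<in> K"
  shows "bar x * a * (bar y * b) = bar (x \<otimes> y) * (\<tau> x y * \<sigma> y a * b)"
proof -
  have "bar x * a * (bar y * b) = bar x * (a * bar y) * b" by (simp add: mult.assoc)
  also have "\<dots> = (bar x * bar y) * \<sigma> y a * b" using mult_bar assms by (simp add: mult.assoc)
  finally show ?thesis using bar_mult assms by (simp add: mult.assoc)
qed

lemma line_mult:
  assumes "x \<in> carrier G" "y \<in> carrier G" "u \<in> line x" "v \<in> line y"
  shows "u * v \<in> line (x \<otimes> y)"
proof -
  obtain a b where ab: "u = bar x * a" "v = bar y * b" "a \<in> K" "b \<in> K"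
    using assms(3,4) by (auto simp: line_def)
  have "\<tau> x y * \<sigma> y a * b \<in> K"
    using ab twist[OF assms(1,2)] action(1)[OF assms(2) ab(3)] by (simp add: K_ring(4))
  then show ?thesis unfolding ab product_formula[OF assms(1,2) ab(3)] line_def by blast
qed

lemma triv_mult:
  assumes "x \<in> carrier G" "y \<in> carrier G" "u \<in> triv x" "v \<in> triv y"
  shows "u * v \<in> triv (x \<otimes> y)"
proof -
  obtain a b where ab: "u = bar x * a" "v = bar y * b" "a \<in> K" "b \<in> K" "a \<noteq> 0" "b \<noteq> 0"
    using assms by (auto simp: triv_def)
  have "\<tau> x y * \<sigma> y a * b \<in> K" "\<tau> x y * \<sigma> y a * b \<noteq> 0"
    using ab twist[OF assms(1,2)] action[OF assms(2) ab(3)] by (simp_all add: K_ring(4) K_mult_nonzero)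
  then show ?thesis using product_formula ab assms unfolding triv_def by blast
qed

lemma triv_right_inverse:
  assumes "x \<in> carrier G" "u \<in> triv x"
  shows "\<exists>v\<in>triv (inv x). u * v = 1"
proof -
  obtain a where a: "u = bar x * a" "a \<in> K" "a \<noteq> 0" using assms by (auto simp: triv_def)
  have x': "inv x \<in> carrier G" using assms by simp
  define c where "c = \<tau> x (inv x) * \<sigma> (inv x) a"
  have c: "c \<in> K" "c \<noteq> 0"
    using a twist[OF assms(1) x'] action[OF x' a(2)] by (simp_all add: c_def K_ring(4) K_mult_nonzero)
  then obtain b where b: "b \<in> K" "c * b = 1" by (rule K_inverse)
  then have "b \<noteq> 0" by auto
  then have "bar (inv x) * b \<in> triv (inv x)" using b by (auto simp: triv_def)
  moreover have "u * (bar (inv x) * b) = 1"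
    using product_formula[OF assms(1) x' a(2), of b] assms(1) a(1) b bar_one by (simp add: c_def)
  ultimately show ?thesis by blast
qed

lemma triv_inverse:
  assumes "x \<in> carrier G" "u \<in> triv x"
  shows "\<exists>v\<in>triv (inv x). u * v = 1 \<and> v * u = 1"
proof -
  obtain v where v: "v \<in> triv (inv x)" "u * v = 1" using triv_right_inverse[OF assms] by blast
  obtain w where w: "v * w = 1" using triv_right_inverse[OF _ v(1)] assms by auto
  have "u = w" using two_sided_inverse_unique[OF w v(2)] by simp
  then show ?thesis using v w by blast
qed

lemma triv_one: "triv \<one> = K - {0}" "line \<one> = K"
  by (auto simp: triv_def line_def bar_one)

sublocale graded_units G triv
proof
  show "triv x \<noteq> {}" for x using bar_triv by blast
  show "- 1 \<in> triv \<one>" using K_ring by (simp add: triv_one)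
  show "u + v \<in> insert 0 (triv \<one>)" if "u \<in> triv \<one>" "v \<in> triv \<one>" for u v
    using that K_ring(6) by (auto simp: triv_one)
qed (rule triv_mult triv_inverse; assumption)+

lemma lines_independent:
  assumes "finite X" "X \<subseteq> carrier G" "\<And>x. x \<in> X \<Longrightarrow> w x \<in> line x" "(\<Sum>x\<in>X. w x) = 0" "x \<in> X"
  shows "w x = 0"
proof -
  have "\<exists>a. \<forall>x\<in>X. a x \<in> K \<and> w x = bar x * a x"
    using assms(3) by (intro bchoice) (auto simp: line_def)
  then obtain a where a: "\<And>x. x \<in> X \<Longrightarrow> a x \<in> K" "\<And>x. x \<in> X \<Longrightarrow> w x = bar x * a x" by blast
  have inj: "inj_on bar X" using bar_inj assms(2) by (rule inj_on_subset)
  define c where "c b = a (the_inv_into X bar b)" for b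
  have c: "c (bar x) = a x" if "x \<in> X" for x using the_inv_into_f_f[OF inj that] by (simp add: c_def)
  have "(\<Sum>b\<in>bar ` X. b * c b) = (\<Sum>x\<in>X. bar x * c (bar x))" by (rule sum.reindex_cong[OF inj]) auto
  also have "\<dots> = 0" using assms(4) a(2) c by simp
  finally have "(\<Sum>b\<in>bar ` X. b * c b) = 0" .
  moreover have "c ` bar ` X \<subseteq> K" using a(1) c by auto
  ultimately have "\<forall>b\<in>bar ` X. c b = 0"
    using bar_independent assms(1,2) unfolding right_independent_def by (meson finite_imageI image_mono)
  then show ?thesis using a(2) c assms(5) by auto
qed

lemma lines_disjoint:
  assumes "x \<in> carrier G" "y \<in> carrier G" "u \<in> line x" "u \<in> line y" "u \<noteq> 0"
  shows "x = y"
proof (rule ccontr)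
  assume "x \<noteq> y"
  then have "(\<Sum>z\<in>{x, y}. if z = x then u else - u) = 0" by simp
  then have "(if x = x then u else - u) = 0"
    by (rule lines_independent[rotated 3]) (use assms line_minus in auto)
  then show False using assms by simp
qed

lemma sub_crossed_product_sum:
  assumes "N \<subseteq> carrier G" "u \<in> sub_crossed_product K bar N"
  shows "\<exists>X w. finite X \<and> X \<subseteq> N \<and> (\<forall>x\<in>X. w x \<in> line x) \<and> u = (\<Sum>x\<in>X. w x)"
proof -
  obtain S c where S: "finite S" "S \<subseteq> bar ` N" "c ` S \<subseteq> K" "u = (\<Sum>b\<in>S. b * c b)"
    using assms(2) by (auto simp: sub_crossed_product_def right_span_def)
  obtain X where X: "X \<subseteq> N" "S = bar ` X" using S(2) by (meson subset_image_iff)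
  have inj: "inj_on bar X" using bar_inj assms(1) X(1) by (meson inj_on_subset subset_trans)
  have fin: "finite X" using S(1) X(2) inj by (simp add: finite_image_iff)
  have u: "u = (\<Sum>x\<in>X. bar x * c (bar x))"
    unfolding S(4) X(2) by (rule sum.reindex_cong[OF inj]) auto
  have "bar x * c (bar x) \<in> line x" if "x \<in> X" for x using S(3) X(2) that by (auto simp: line_def)
  with fin X(1) u show ?thesis by (intro exI[of _ X] exI[of _ "\<lambda>x. bar x * c (bar x)"]) simp
qed

lemma line_sub_crossed_product:
  assumes "x \<in> N"
  shows "line x \<subseteq> sub_crossed_product K bar N"
proof
  fix u assume "u \<in> line x"
  then obtain a where "a \<in> K" "u = bar x * a" by (auto simp: line_def)
  then show "u \<in> sub_crossed_product K bar N" using assms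
    unfolding sub_crossed_product_def right_span_def
    by (intro CollectI exI[of _ "{bar x}"] exI[of _ "\<lambda>_. a"]) auto
qed

lemma sum_of_trivial_units:
  "\<exists>X w. finite X \<and> X \<subseteq> carrier G \<and> (\<forall>x\<in>X. w x \<in> triv x) \<and> u = (\<Sum>x\<in>X. w x)"
proof -
  have "u \<in> sub_crossed_product K bar (carrier G)" using bar_span by (simp add: sub_crossed_product_def)
  then obtain X w where X: "finite X" "X \<subseteq> carrier G" "\<forall>x\<in>X. w x \<in> line x" "u = (\<Sum>x\<in>X. w x)"
    using sub_crossed_product_sum[OF order_refl, of u] by blast
  have u: "u = (\<Sum>x\<in>{x \<in> X. w x \<noteq> 0}. w x)"
    unfolding X(4) using X(1) by (intro sum.mono_neutral_right) auto
  have "w x \<in> triv x" if "x \<in> {x \<in> X. w x \<noteq> 0}" for x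
    using bspec[OF X(3), of x] that by (auto simp: line_def triv_def)
  moreover have "finite {x \<in> X. w x \<noteq> 0}" "{x \<in> X. w x \<noteq> 0} \<subseteq> carrier G" using X by auto
  ultimately show ?thesis using u by (intro exI[of _ "{x \<in> X. w x \<noteq> 0}"] exI[of _ w]) simp
qed

text \<open>If one of the factors had two terms, then two different products of degrees would occur only once in
  \<open>u * v\<close>, and one of them would contribute a nonzero term of degree other than one.\<close>

lemma unit_is_trivial:
  assumes ind: "indicable_subgroups G" and uv: "u * v = 1"
  shows "\<exists>x\<in>carrier G. u \<in> triv x"
proof -
  obtain X f where X: "finite X" "X \<subseteq> carrier G" "\<forall>x\<in>X. f x \<in> triv x" "u = (\<Sum>x\<in>X. f x)"
    using sum_of_trivial_units[of u] by blast
  obtain Y g where Y: "finite Y" "Y \<subseteq> carrier G" "\<forall>y\<in>Y. g y \<in> triv y" "v = (\<Sum>y\<in>Y. g y)"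
    using sum_of_trivial_units[of v] by blast
  have ne: "X \<noteq> {}" "Y \<noteq> {}" using uv X(4) Y(4) by auto
  have "card X + card Y \<le> 2"
  proof (rule ccontr)
    assume "\<not> card X + card Y \<le> 2"
    then obtain x y x' y' where up: "unique_product X Y x y" "unique_product X Y x' y'" "x \<otimes> y \<noteq> x' \<otimes> y'"
      using two_unique_products[OF ind X(1) Y(1) ne X(2) Y(2)] by auto
    then obtain x y where xy: "unique_product X Y x y" "x \<otimes> y \<noteq> \<one>" by metis
    then have mem: "x \<in> X" "y \<in> Y" by (auto simp: unique_product_def)
    define Z where "Z = insert \<one> ((\<lambda>(a, b). a \<otimes> b) ` (X \<times> Y))"
    define w where "w z = (\<Sum>p\<in>{p \<in> X \<times> Y. fst p \<otimes> snd p = z}. f (fst p) * g (snd p)) + (if z = \<one> then - 1 else 0)" for z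
    have Z: "finite Z" "Z \<subseteq> carrier G" using X Y by (auto simp: Z_def)
    have "(\<Sum>z\<in>Z. \<Sum>p\<in>{p \<in> X \<times> Y. fst p \<otimes> snd p = z}. f (fst p) * g (snd p))
        = (\<Sum>p\<in>X \<times> Y. f (fst p) * g (snd p))"
      using X(1) Y(1) Z(1) by (intro sum.group) (auto simp: Z_def)
    also have "\<dots> = u * v" unfolding X(4) Y(4) by (simp add: sum_product sum.cartesian_product case_prod_beta)
    finally have sum_w: "(\<Sum>z\<in>Z. w z) = 0"
      using Z(1) uv by (simp add: w_def sum.distrib) (simp add: Z_def)
    have w_line: "w z \<in> line z" if "z \<in> Z" for z
    proof -
      have "(\<Sum>p\<in>P. f (fst p) * g (snd p)) \<in> line z" if "P \<subseteq> {p \<in> X \<times> Y. fst p \<otimes> snd p = z}" "finite P" for P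
        using that(2,1)
      proof (induction P)
        case (insert p P)
        have "f (fst p) * g (snd p) \<in> line (fst p \<otimes> snd p)"
          using insert.prems X(2,3) Y(2,3) by (intro line_mult subsetD[OF triv_line]) auto
        then show ?case using insert by (auto intro: line_add)
      qed (simp add: line_zero)
      from this[OF order_refl] have "(\<Sum>p\<in>{p \<in> X \<times> Y. fst p \<otimes> snd p = z}. f (fst p) * g (snd p)) \<in> line z"
        using X(1) Y(1) by simp
      moreover have "(if z = \<one> then - 1 else 0) \<in> line z"
        using line_zero K_ring by (simp add: triv_one)
      ultimately show ?thesis unfolding w_def by (rule line_add)
    qed
    have "x \<otimes> y \<in> Z" using mem by (auto simp: Z_def)
    with Z w_line sum_w have "w (x \<otimes> y) = 0" by (rule lines_independent)
    moreover have "{p \<in> X \<times> Y. fst p \<otimes> snd p = x \<otimes> y} = {(x, y)}"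
      using xy(1) by (auto simp: unique_product_def)
    ultimately have "f x * g y = 0" using xy(2) by (simp add: w_def)
    moreover have "f x * g y \<in> triv (x \<otimes> y)" using mem X(2,3) Y(2,3) by (intro triv_mult) auto
    ultimately have "0 \<in> triv (x \<otimes> y)" by simp
    then obtain v where "0 * v = (1::'a)" using triv_right_inverse[of "x \<otimes> y" 0] mem X(2) Y(2) by auto
    then show False by simp
  qed
  moreover have "card X > 0" "card Y > 0" using ne X(1) Y(1) by (simp_all add: card_gt_0_iff)
  ultimately have "card X = 1" by linarith
  then obtain x where "X = {x}" by (auto simp: card_1_singleton_iff)
  then show ?thesis using X by auto
qed

end

section \<open>Products and opposites of rings\<close>

instantiation prod :: (ring_1, ring_1) ring_1
begin

definition one_prod :: "'a \<times> 'b" where "one_prod = (1, 1)"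

definition times_prod :: "'a \<times> 'b \<Rightarrow> 'a \<times> 'b \<Rightarrow> 'a \<times> 'b" where
  "times_prod x y = (fst x * fst y, snd x * snd y)"

instance
  by standard (simp_all add: one_prod_def times_prod_def prod_eq_iff algebra_simps)

end

text \<open>Antihomomorphisms into a ring are homomorphisms into its opposite.\<close>

datatype 'a opp = Opp (unop: 'a)

lemma eq_Opp_iff: "x = Opp a \<longleftrightarrow> unop x = a"
  by (cases x) auto

instantiation opp :: (division_ring) division_ring
begin

definition "0 = Opp 0"
definition "1 = Opp 1"
definition "x + y = Opp (unop x + unop y)"
definition "x - y = Opp (unop x - unop y)"
definition "- x = Opp (- unop x)"
definition "x * y = Opp (unop y * unop x)"
definition "inverse x = Opp (inverse (unop x))"
definition "x div y = Opp (inverse (unop y) * unop x)"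

instance
  by standard
    (auto simp: zero_opp_def one_opp_def plus_opp_def minus_opp_def uminus_opp_def times_opp_def
      inverse_opp_def divide_opp_def eq_Opp_iff algebra_simps)

end

lemma unop_simps [simp]:
  "unop 0 = 0" "unop 1 = 1" "unop (x + y) = unop x + unop y" "unop (x - y) = unop x - unop y"
  "unop (x * y) = unop y * unop x" "unop (inverse x) = inverse (unop x)"
  by (simp_all add: zero_opp_def one_opp_def plus_opp_def minus_opp_def times_opp_def inverse_opp_def)

lemma opp_eq_iff: "x = y \<longleftrightarrow> unop x = unop y"
  using opp.expand by auto

lemma adic_product:
  assumes "adic T V F" "adic T' V' F'"
  shows "adic (\<lambda>k. (T k, T' k)) (V \<times> V') (F \<times> F')"
proof -
  interpret A: adic T V F by fact
  interpret B: adic T' V' F' by fact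
  show ?thesis
  proof
    show "unital_subring (V \<times> V')" "unital_subring (F \<times> F')"
      using A.V B.V A.F B.F by (auto simp: unital_subring_def one_prod_def times_prod_def)
    fix v assume "v \<in> V \<times> V'"
    then obtain w w' where "w \<in> V" "(1 + T 1 * fst v) * w = 1" "w * (1 + T 1 * fst v) = 1"
      "w' \<in> V'" "(1 + T' 1 * snd v) * w' = 1" "w' * (1 + T' 1 * snd v) = 1"
      using A.V_unit[of "fst v"] B.V_unit[of "snd v"] by auto
    then show "\<exists>w\<in>V \<times> V'. (1 + (T 1, T' 1) * v) * w = 1 \<and> w * (1 + (T 1, T' 1) * v) = 1"
      by (intro bexI[of _ "(w, w')"]) (auto simp: one_prod_def times_prod_def)
  next
    fix x assume *: "\<And>n. \<exists>v\<in>V \<times> V'. x = (T n, T' n) * v"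
    have "\<exists>v\<in>V. fst x = T n * v" "\<exists>v\<in>V'. snd x = T' n * v" for n
      using *[of n] by (auto simp: times_prod_def)
    then show "x = 0" using A.separated[of "fst x"] B.separated[of "snd x"] by (simp add: prod_eq_iff)
  next
    show "c' \<in> F \<times> F'" if "c \<in> F \<times> F'" "c * c' = 1" "c' * c = 1" for c c'
      using that A.F_inverse[of "fst c" "fst c'"] B.F_inverse[of "snd c" "snd c'"]
      by (auto simp: times_prod_def one_prod_def mem_Times_iff)
  qed (use A.F_V B.F_V A.T_V B.T_V A.V_conj B.V_conj A.F_conj B.F_conj A.T_add B.T_add
        in \<open>auto simp: one_prod_def times_prod_def\<close>)
qed

text \<open>As \<open>V\<close> is stable under conjugation by \<open>T n\<close>, its left and its right multiples by \<open>T n\<close> agree.\<close>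

lemma adic_opposite:
  fixes T :: "int \<Rightarrow> 'd::division_ring"
  assumes "adic T V F"
  shows "adic (\<lambda>k. Opp (T k)) (Opp ` V) (Opp ` F)"
proof -
  interpret A: adic T V F by fact
  have mem: "x \<in> Opp ` X \<longleftrightarrow> unop x \<in> X" for x :: "'d opp" and X by (cases x) auto
  have conj_V: "T (- n) * v * T n \<in> V" if "v \<in> V" for n v using A.V_conj[OF that, of "- n"] by simp
  have conj_F: "T (- n) * v * T n \<in> F" if "v \<in> F" for n v using A.F_conj[OF that, of "- n"] by simp
  have swap: "v * T n = T n * (T (- n) * v * T n)" for v n by (simp add: mult.assoc)
  show ?thesis
  proof
    show "unital_subring (Opp ` V)" "unital_subring (Opp ` F)"
      using A.V A.F by (auto simp: unital_subring_def mem)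
    show "Opp (T (m + n)) = Opp (T m) * Opp (T n)" for m n
      using A.T_add[of n m] by (simp add: opp_eq_iff add.commute)
    fix v assume "v \<in> Opp ` V"
    then have "T (- 1) * unop v * T 1 \<in> V" using conj_V by (simp add: mem)
    then obtain w where "w \<in> V" "(1 + unop v * T 1) * w = 1" "w * (1 + unop v * T 1) = 1"
      using A.V_unit swap by metis
    then show "\<exists>w\<in>Opp ` V. (1 + Opp (T 1) * v) * w = 1 \<and> w * (1 + Opp (T 1) * v) = 1"
      by (intro bexI[of _ "Opp w"]) (auto simp: opp_eq_iff)
  next
    fix x assume *: "\<And>n. \<exists>v\<in>Opp ` V. x = Opp (T n) * v"
    have "\<exists>v\<in>V. unop x = T n * v" for n
    proof -
      obtain v where "v \<in> V" "unop x = v * T n" using *[of n] by (auto simp: opp_eq_iff)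
      then show ?thesis using swap conj_V by metis
    qed
    then show "x = 0" using A.separated by (simp add: opp_eq_iff)
  next
    show "c' \<in> Opp ` F" if "c \<in> Opp ` F" "c * c' = 1" "c' * c = 1" for c c'
      using that A.F_inverse[of "unop c" "unop c'"] by (simp add: mem opp_eq_iff)
  qed (use A.F_V A.T_V conj_V conj_F in \<open>auto simp: mem opp_eq_iff mult.assoc\<close>)
qed

text \<open>Multiplying the powers of \<open>t\<close> by units of \<open>F\<close> changes neither \<open>V\<close> nor \<open>F\<close>. This allows the
  powers to be prescribed in the crossed product, where \<open>bar t\<close> is not preserved by the
  involution.\<close>

lemma adic_change_uniformizer:
  assumes "adic T V F" "T' 0 = 1" "\<And>m n. T' (m + n) = T' m * T' n"
    and T': "\<And>n. T (- n) * T' n \<in> F"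
  shows "adic T' V F"
proof -
  interpret A: adic T V F by fact
  define f where "f n = T (- n) * T' n" for n
  define g where "g n = T' (- n) * T n" for n
  have T'_f: "T' n = T n * f n" "T' (- n) = g n * T (- n)" for n
    by (simp_all add: f_def g_def mult.assoc)
  have inv: "T' n * T' (- n) = 1" "T' (- n) * T' n = 1" for n
    using assms(3)[of n "- n"] assms(3)[of "- n" n] assms(2) by auto
  have inv': "T n * (T (- n) * x) = x" "T' n * (T' (- n) * x) = x" for n x
    using inv by (simp_all flip: mult.assoc)
  have "f n * g n = 1" "g n * f n = 1" for n
    using inv(2)[of n] by (simp_all add: f_def g_def mult.assoc inv')
  then have fg: "f n \<in> F" "g n \<in> F" for n
    using T'[of n] A.F_inverse[of "f n" "g n"] by (auto simp: f_def)
  then have fgV: "f n \<in> V" "g n \<in> V" for n using A.F_V by auto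
  note R = unital_subringD(4)[OF A.V] unital_subringD(4)[OF A.F]
  show ?thesis
  proof
    show "T' 1 \<in> V" using T'_f(1)[of 1] A.T_V fgV R by simp
    show "T' n * v * T' (- n) \<in> V" if "v \<in> V" for n v
      using A.V_conj[OF R(1)[OF R(1)[OF fgV(1) that] fgV(2)], of n n n] unfolding T'_f(1)[of n] T'_f(2)[of n] by (simp add: mult.assoc)
    show "T' n * v * T' (- n) \<in> F" if "v \<in> F" for n v
      using A.F_conj[OF R(2)[OF R(2)[OF fg(1) that] fg(2)], of n n n] unfolding T'_f(1)[of n] T'_f(2)[of n] by (simp add: mult.assoc)
    show "\<exists>w\<in>V. (1 + T' 1 * v) * w = 1 \<and> w * (1 + T' 1 * v) = 1" if "v \<in> V" for v
      using A.V_unit[OF R(1)[OF fgV(1)[of 1] that]] by (simp add: T'_f mult.assoc)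
    show "x = 0" if *: "\<And>n. \<exists>v\<in>V. x = T' n * v" for x
    proof (rule A.separated)
      fix n
      obtain v where "v \<in> V" "x = T' n * v" using * by blast
      then show "\<exists>v\<in>V. x = T n * v" using R(1)[OF fgV(1)[of n]] by (auto simp: T'_f mult.assoc)
    qed
  qed (use assms A.V A.F A.F_V A.F_inverse in auto)
qed

section \<open>Hughes-free embeddings are adic\<close>

lemma division_subring_division_subring_generated:
  "division_subring (division_subring_generated X)" "X \<subseteq> division_subring_generated X"
proof -
  note D = division_subringD
  show "division_subring (division_subring_generated X)"
  proof (rule division_subringI)
    show "unital_subring (division_subring_generated X)"
      unfolding division_subring_generated_def unital_subring_def
      using unital_subringD(2-4)[OF D(1)] by blast
    show "inverse c \<in> division_subring_generated X" if "c \<in> division_subring_generated X" for c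
      using that D(2) unfolding division_subring_generated_def by blast
  qed
qed (auto simp: division_subring_generated_def)

lemma division_subring_generated_subset:
  "division_subring R \<Longrightarrow> X \<subseteq> R \<Longrightarrow> division_subring_generated X \<subseteq> R"
  by (auto simp: division_subring_generated_def)

lemma division_subring_conj:
  fixes t :: "'d::division_ring"
  assumes "division_subring F" "t * s = 1" "s * t = 1"
  shows "division_subring {x. t * x * s \<in> F}"
proof (rule division_subringI)
  note R = unital_subringD[OF division_subringD(1)[OF assms(1)]]
  have mult: "t * (a * b) * s = (t * a * s) * (t * b * s)" for a b
  proof -
    have "(t * a * s) * (t * b * s) = t * a * (s * t) * b * s" by (simp only: mult.assoc)
    also have "\<dots> = t * (a * b) * s" unfolding assms(3) by (simp add: mult.assoc)
    finally show ?thesis by (rule sym)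
  qed
  have diff: "t * (a - b) * s = t * a * s - t * b * s" for a b
    by (simp add: right_diff_distrib left_diff_distrib)
  show "unital_subring {x. t * x * s \<in> F}"
    unfolding unital_subring_def mem_Collect_eq mult diff using R(2-4) assms(2) by simp
  show "inverse c \<in> {x. t * x * s \<in> F}" if "c \<in> {x. t * x * s \<in> F}" for c
  proof (cases "c = 0")
    case False
    have "(t * c * s) * (t * inverse c * s) = t * c * (s * t) * inverse c * s" by (simp only: mult.assoc)
    also have "\<dots> = 1" using False assms by (simp add: mult.assoc)
    finally have "inverse (t * c * s) = t * inverse c * s" by (rule inverse_unique)
    then show ?thesis using division_subringD(2)[OF assms(1)] that by (metis mem_Collect_eq)
  qed (use R in simp)
qed

lemma ring_embeddingD:
  assumes "ring_embedding f"
  shows "f (a + b) = f a + f b" "f (a * b) = f a * f b" "f 1 = 1" "inj f" "f 0 = 0" "f (- a) = - f a"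
    "f (a - b) = f a - f b" "f (sum g I) = (\<Sum>i\<in>I. f (g i))" "f a = 0 \<longleftrightarrow> a = 0"
proof -
  show add: "f (a + b) = f a + f b" and "f (a * b) = f a * f b" "f 1 = 1" and inj: "inj f" for a b
    using assms by (auto simp: ring_embedding_def)
  show zero: "f 0 = 0" using add[of 0 0] by simp
  show minus: "f (- a) = - f a" for a using add[of a "- a"] zero by (simp add: eq_neg_iff_add_eq_0 add.commute)
  show "f (a - b) = f a - f b" using add[of a "- b"] minus by simp
  show "f (sum g I) = (\<Sum>i\<in>I. f (g i))"
    by (induction I rule: infinite_finite_induct) (simp_all add: zero add)
  show "f a = 0 \<longleftrightarrow> a = 0" using inj zero by (metis injD)
qed

lemma graded_units_image:
  fixes f :: "'a::ring_1 \<Rightarrow> 'b::ring_1"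
  assumes "graded_units G U" "ring_embedding f"
  shows "graded_units G (\<lambda>x. f ` U x)"
proof -
  interpret graded_units G U by fact
  note f = ring_embeddingD[OF assms(2)]
  show ?thesis
  proof
    fix x y u v
    show "u * v \<in> f ` U (x \<otimes>\<^bsub>G\<^esub> y)"
      if "x \<in> carrier G" "y \<in> carrier G" "u \<in> f ` U x" "v \<in> f ` U y"
      using that U_mult[OF that(1,2)] by (auto simp flip: f(2))
    show "\<exists>v\<in>f ` U (inv\<^bsub>G\<^esub> x). u * v = 1 \<and> v * u = 1" if xu: "x \<in> carrier G" "u \<in> f ` U x"
    proof -
      obtain a where a: "a \<in> U x" "u = f a" using xu by blast
      obtain b where b: "b \<in> U (inv\<^bsub>G\<^esub> x)" "a * b = 1" "b * a = 1" using U_inverse[OF xu(1) a(1)] by blast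
      have "u * f b = 1" "f b * u = 1" using a b f(3) by (simp_all flip: f(2))
      then show ?thesis using b by blast
    qed
    show "f ` U x \<noteq> {}" if "x \<in> carrier G" using U_nonempty that by blast
    show "- 1 \<in> f ` U \<one>\<^bsub>G\<^esub>"
      using U_minus_one f(6)[of 1] f(3) by (metis imageI)
    show "u + v \<in> insert 0 (f ` U \<one>\<^bsub>G\<^esub>)" if uv: "u \<in> f ` U \<one>\<^bsub>G\<^esub>" "v \<in> f ` U \<one>\<^bsub>G\<^esub>"
    proof -
      obtain a b where "a \<in> U \<one>\<^bsub>G\<^esub>" "b \<in> U \<one>\<^bsub>G\<^esub>" "u = f a" "v = f b" using uv by blast
      then show ?thesis using U_add[of a b] f(1,5) by (metis imageI insert_iff)
    qed
  qed
qed

text \<open>The powers \<open>T\<close> are taken in the source of \<open>f\<close> and are arbitrary there, so that two embeddings can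
  be expanded along the same powers, and so that the condition is inherited by the composition of \<open>f\<close>
  with an involution of its source.\<close>

definition adic_embedding ::
  "('g, 'm) monoid_scheme \<Rightarrow> ('g \<Rightarrow> 'a::ring_1 set) \<Rightarrow> ('a \<Rightarrow> 'b::ring_1) \<Rightarrow> bool" where
  "adic_embedding G U f \<longleftrightarrow> ring_embedding f \<and>
     (\<forall>H d t T. nontrivial_fg_subgroup H G \<and> degree_map G H d \<and> t \<in> H \<and> d t = 1 \<and>
        T 0 = 1 \<and> (\<forall>m n. T (m + n) = T m * T n) \<and> (\<forall>k::int. T k \<in> U (t [^]\<^bsub>G\<^esub> k)) \<longrightarrow>
        (\<exists>V F. adic (\<lambda>k. f (T k)) V F \<and> (\<forall>x\<in>H. d x = 0 \<longrightarrow> f ` U x \<subseteq> F)))"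

lemma (in graded_units) U_nat_power:
  assumes "x \<in> carrier G" "u \<in> U x"
  shows "u ^ n \<in> U (x [^] n)"
proof (induction n)
  case (Suc n)
  then have "u ^ n * u \<in> U (x [^] n \<otimes> x)" using assms by (intro U_mult) auto
  then show ?case by (simp add: power_commutes)
qed (simp add: U_one)

lemma graded_units_int_power:
  fixes U :: "'g \<Rightarrow> 'd::division_ring set"
  assumes "graded_units G U" "x \<in> carrier G" "u \<in> U x"
  shows "u powi k \<in> U (x [^]\<^bsub>G\<^esub> (k::int))"
proof -
  interpret graded_units G U by fact
  show ?thesis
  proof (cases k rule: int_cases2)
    case (nonneg n)
    then show ?thesis using U_nat_power[OF assms(2,3)] by (simp add: int_pow_int)
  next
    case (nonpos n)
    obtain v where v: "v \<in> U (inv\<^bsub>G\<^esub> (x [^]\<^bsub>G\<^esub> n))" "u ^ n * v = 1"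
      using U_inverse[OF _ U_nat_power[OF assms(2,3)]] assms(2) by (meson nat_pow_closed)
    have "inverse (u ^ n) = v" using v(2) by (rule inverse_unique)
    then show ?thesis using v(1) nonpos assms(2) by (simp add: power_int_minus int_pow_neg_int)
  qed
qed

context division_crossed_product
begin

lemma conj_sub_crossed_product:
  fixes f :: "'a \<Rightarrow> 'd::division_ring"
  assumes "N \<subseteq> carrier G" "x \<in> carrier G" "u \<in> triv x" "v \<in> triv (inv x)"
    and N: "\<And>y. y \<in> N \<Longrightarrow> x \<otimes> y \<otimes> inv x \<in> N"
    and a: "a \<in> sub_crossed_product K bar N" and f: "ring_embedding f"
    and F: "division_subring F" "f ` sub_crossed_product K bar N \<subseteq> F"
  shows "f u * f a * f v \<in> F"
proof -
  note f = ring_embeddingD[OF f]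
  obtain X w where X: "finite X" "X \<subseteq> N" "\<forall>x\<in>X. w x \<in> line x" "a = (\<Sum>x\<in>X. w x)"
    using sub_crossed_product_sum[OF assms(1) a] by blast
  have "f (u * w y * v) \<in> F" if "y \<in> X" for y
  proof -
    have y: "y \<in> N" "y \<in> carrier G" using that X(2) assms(1) by auto
    have "u * w y * v \<in> line (x \<otimes> y \<otimes> inv x)"
      using assms(2-4) y that X(3) triv_line by (intro line_mult) auto
    then show ?thesis using line_sub_crossed_product[OF N[OF y(1)]] F(2) by blast
  qed
  then have "(\<Sum>y\<in>X. f (u * w y * v)) \<in> F"
    by (intro unital_subring_sum[OF division_subringD(1)[OF F(1)]])
  also have "(\<Sum>y\<in>X. f (u * w y * v)) = f u * f a * f v"
    unfolding X(4) f(8) by (simp add: f(2) sum_distrib_left sum_distrib_right)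
  finally show ?thesis .
qed

lemma bar_power_distinct:
  assumes f: "ring_embedding f" and d: "degree_map G H d" "t \<in> H" "d t = 1" and eq: "f (bar t) ^ m = f (bar t) ^ n"
  shows "m = n"
proof -
  note f = ring_embeddingD[OF f] and dm = degree_mapD[OF d(1)]
  have t: "t \<in> carrier G" using d(2) subgroup.mem_carrier[OF dm(1)] by blast
  have "f (bar t) ^ k = f (bar t ^ k)" for k by (induction k) (simp_all add: f(2,3))
  then have "bar t ^ m = bar t ^ n" using eq f(4) by (metis injD)
  moreover have "bar t ^ k \<in> line (t [^] k)" for k
    using U_nat_power[OF t bar_triv] triv_line by blast
  moreover have "bar t ^ m \<noteq> 0"
    using triv_inverse[OF _ U_nat_power[OF t bar_triv, of m]] t by fastforce
  ultimately have "t [^] m = t [^] n" using t by (metis lines_disjoint nat_pow_closed)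
  then have "d (t [^] int m) = d (t [^] int n)" by (simp add: int_pow_int)
  then show ?thesis using dm(6)[OF d(2)] d(3) by simp
qed

text \<open>Hughes-freeness is the independence that is required for the valuation of
  \<open>skew_polynomials\<close>, over the division ring generated by the kernel \<open>N\<close>. The definition speaks of the
  set of powers of \<open>bar t\<close>, which are pairwise distinct by \<open>bar_power_distinct\<close>.\<close>

lemma hughes_free_adic_embedding:
  fixes \<phi> :: "'a \<Rightarrow> 'd::division_ring"
  assumes "hughes_free_embedding G K bar \<phi>"
  shows "adic_embedding G triv \<phi>"
  unfolding adic_embedding_def
proof (intro conjI allI impI; (elim conjE)?)
  show \<phi>: "ring_embedding \<phi>" using assms by (simp add: hughes_free_embedding_def)
  note \<phi>' = ring_embeddingD[OF \<phi>]
  fix H d t T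
  assume H: "nontrivial_fg_subgroup H G" and d: "degree_map G H d" "t \<in> H" "d t = 1"
    and T: "T 0 = 1" "\<forall>m n. T (m + n) = T m * T n" "\<forall>k::int. T k \<in> triv (t [^] k)"
  note dm = degree_mapD[OF d(1)]
  interpret H: group "G\<lparr>carrier := H\<rparr>" using dm(1) by (rule subgroup_imp_group)
  define N where "N = {x \<in> H. d x = 0}"
  have H_car: "x \<in> H \<Longrightarrow> x \<in> carrier G" for x using subgroup.mem_carrier[OF dm(1)] .
  have NG: "N \<subseteq> carrier G" using H_car by (auto simp: N_def)
  define F where "F = division_closure K bar \<phi> N"
  have F: "division_subring F" and F_sub: "\<phi> ` sub_crossed_product K bar N \<subseteq> F"
    unfolding F_def division_closure_def by (rule division_subring_division_subring_generated)+
  define u where "u = \<phi> (bar t)"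
  have t: "t \<in> carrier G" "inv t \<in> carrier G" using H_car d(2) by auto
  obtain v where v: "v \<in> triv (inv t)" "bar t * v = 1" "v * bar t = 1"
    using triv_inverse[OF t(1) bar_triv] by blast
  have u_inv: "inverse u = \<phi> v"
    by (rule inverse_unique) (simp add: u_def \<phi>'(3) v flip: \<phi>'(2))
  have u0: "u \<noteq> 0" using v(2) \<phi>'(9) by (auto simp: u_def)
  have N_conj: "x \<otimes> y \<otimes> inv x \<in> N" if "x \<in> H" "y \<in> N" for x y
    using that dm(2,4) subgroup.m_closed[OF dm(1)] subgroup.m_inv_closed[OF dm(1)] by (auto simp: N_def)
  have conj: "\<phi> a * c * \<phi> b \<in> F"
    if "c \<in> F" "x \<in> H" "a \<in> triv x" "b \<in> triv (inv x)" "a * b = 1" "b * a = 1" for a b c x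
  proof -
    have "division_subring {c. \<phi> a * c * \<phi> b \<in> F}"
      using that \<phi>'(3) by (intro division_subring_conj[OF F]) (simp_all flip: \<phi>'(2))
    moreover have "\<phi> ` sub_crossed_product K bar N \<subseteq> {c. \<phi> a * c * \<phi> b \<in> F}"
      using conj_sub_crossed_product[OF NG H_car[OF that(2)] that(3,4) N_conj[OF that(2)] _ \<phi> F F_sub] by blast
    ultimately have "F \<subseteq> {c. \<phi> a * c * \<phi> b \<in> F}"
      unfolding F_def division_closure_def by (rule division_subring_generated_subset)
    then show ?thesis using that(1) by blast
  qed
  have "right_independent F {u ^ n | n. True}"
  proof -
    have *: "N \<lhd> G\<lparr>carrier := H\<rparr>" "infinite_cyclic (G\<lparr>carrier := H\<rparr> Mod N)"
      "carrier (G\<lparr>carrier := H\<rparr> Mod N) = generate (G\<lparr>carrier := H\<rparr> Mod N) {N #>\<^bsub>G\<lparr>carrier := H\<rparr>\<^esub> t}"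
      using H.degree_kernel_quotient[of d t N] dm(2) d by (auto simp: N_def)
    moreover have "N #>\<^bsub>G\<lparr>carrier := H\<rparr>\<^esub> t = N #> t" by (simp add: r_coset_def)
    ultimately show ?thesis using assms H d(2) unfolding hughes_free_embedding_def u_def F_def by metis
  qed
  then have independent: "b n = 0"
    if b: "\<And>n. b n \<in> F" "(\<Sum>n<m. u ^ n * b n) = 0" "n < m" for b and m n :: nat
  proof -
    have inj: "inj_on (\<lambda>n. u ^ n) {..<m}"
      by (rule inj_onI) (use bar_power_distinct[OF \<phi> d] in \<open>auto simp: u_def\<close>)
    define c where "c x = b (the_inv_into {..<m} (\<lambda>n. u ^ n) x)" for x
    have c: "c (u ^ n) = b n" if "n < m" for n
      using the_inv_into_f_f[OF inj, of n] that by (simp add: c_def)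
    have "(\<Sum>x\<in>(\<lambda>n. u ^ n) ` {..<m}. x * c x) = (\<Sum>n<m. u ^ n * c (u ^ n))"
      by (rule sum.reindex_cong[OF inj]) auto
    then have "(\<Sum>x\<in>(\<lambda>n. u ^ n) ` {..<m}. x * c x) = 0" using b(2) c by simp
    moreover have "c ` (\<lambda>n. u ^ n) ` {..<m} \<subseteq> F" using b(1) by (auto simp: c_def)
    moreover have "(\<lambda>n. u ^ n) ` {..<m} \<subseteq> {u ^ n | n. True}" by auto
    ultimately have "\<forall>x\<in>(\<lambda>n. u ^ n) ` {..<m}. c x = 0"
      using \<open>right_independent F _\<close> unfolding right_independent_def by (meson finite_imageI finite_lessThan)
    then show ?thesis using c b(3) by auto
  qed
  interpret skew_polynomials u F
  proof
    show "u * c * inverse u \<in> F" if "c \<in> F" for c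
      using conj[OF that d(2) bar_triv v] unfolding u_inv u_def[symmetric] .
    show "inverse u * c * u \<in> F" if "c \<in> F" for c
      using conj[OF that, of "inv t" v "bar t"] v bar_triv t subgroup.m_inv_closed[OF dm(1) d(2)]
      unfolding u_inv u_def[symmetric] by simp
  qed (use F u0 independent in blast)+
  have triv_F: "\<phi> ` triv x \<subseteq> F" if "x \<in> N" for x
    using triv_line line_sub_crossed_product[OF that] F_sub by blast
  have grad: "graded_units G (\<lambda>x. \<phi> ` triv x)"
    by (rule graded_units_image[OF graded_units_axioms \<phi>])
  have "adic (\<lambda>k. \<phi> (T k)) V F"
  proof (rule adic_change_uniformizer[OF adic_V])
    fix n
    have "u powi (- n) \<in> \<phi> ` triv (t [^] (- n))"
      using graded_units_int_power[OF grad t(1)] bar_triv by (auto simp: u_def)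
    then have "u powi (- n) * \<phi> (T n) \<in> \<phi> ` triv (t [^] (- n) \<otimes> t [^] n)"
      using graded_units.U_mult[OF grad] T(3) t(1) by (meson imageI int_pow_closed)
    moreover have "t [^] (- n) \<otimes> t [^] n = \<one>" using t(1) by (simp flip: int_pow_mult)
    moreover have "\<one> \<in> N" using subgroup.one_closed[OF dm(1)] dm(3) by (simp add: N_def)
    ultimately show "u powi (- n) * \<phi> (T n) \<in> F" using triv_F by auto
  qed (use T \<phi>'(2,3) in auto)
  then show "\<exists>V F. adic (\<lambda>k. \<phi> (T k)) V F \<and> (\<forall>x\<in>H. d x = 0 \<longrightarrow> \<phi> ` triv x \<subseteq> F)"
    using triv_F by (intro exI[of _ V] exI[of _ F]) (simp add: N_def)
qed

end

section \<open>Uniqueness of Hughes-free division rings of fractions\<close>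

context division_crossed_product
begin

lemma image_subring_contains:
  assumes "ring_embedding f" "unital_subring R" "\<And>x. x \<in> carrier G \<Longrightarrow> f ` triv x \<subseteq> R"
  shows "range f \<subseteq> R"
proof
  fix y assume "y \<in> range f"
  then obtain a where a: "y = f a" by blast
  obtain X w where X: "finite X" "X \<subseteq> carrier G" "\<forall>x\<in>X. w x \<in> triv x" "a = (\<Sum>x\<in>X. w x)"
    using sum_of_trivial_units[of a] by blast
  have "y = (\<Sum>x\<in>X. f (w x))" unfolding a X(4) by (rule ring_embeddingD(8)[OF assms(1)])
  also have "\<dots> \<in> R" using X assms(3) by (intro unital_subring_sum[OF assms(2)]) blast
  finally show "y \<in> R" .
qed

text \<open>The elements of \<open>D \<times> D'\<close> that are given by rational expressions in the diagonal image are zero or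
  invertible, so a pair with one vanishing entry vanishes. Therefore they form the graph of a map; it is
  defined everywhere because its domain is a division ring that contains the image of \<open>\<phi>\<close>.\<close>

theorem hughes_uniqueness:
  fixes \<phi> :: "'a \<Rightarrow> 'd::division_ring" and \<psi> :: "'a \<Rightarrow> 'e::division_ring"
  assumes ind: "indicable_subgroups G"
    and \<phi>: "adic_embedding G triv \<phi>" and \<psi>: "adic_embedding G triv \<psi>"
    and gen: "division_subring_generated (range \<phi>) = UNIV"
  shows "\<exists>f. ring_embedding f \<and> (\<forall>a. f (\<phi> a) = \<psi> a)"
proof -
  have re: "ring_embedding \<phi>" "ring_embedding \<psi>" using \<phi> \<psi> by (auto simp: adic_embedding_def)
  note \<phi>' = ring_embeddingD[OF re(1)] and \<psi>' = ring_embeddingD[OF re(2)]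
  define \<delta> where "\<delta> a = (\<phi> a, \<psi> a)" for a
  have \<delta>: "ring_embedding \<delta>"
    using \<phi>'(1-3) \<psi>'(1-3) injD[OF \<phi>'(4)]
    by (auto simp: ring_embedding_def \<delta>_def one_prod_def times_prod_def inj_def)
  interpret P: graded_units G "\<lambda>x. \<delta> ` triv x"
    by (rule graded_units_image[OF graded_units_axioms \<delta>])
  have "adically_graded G (\<lambda>x. \<delta> ` triv x)"
    unfolding adically_graded_def
  proof (intro allI impI, elim conjE)
    fix H d t assume H: "nontrivial_fg_subgroup H G" "degree_map G H d" "t \<in> H" "d t = 1"
    have t: "t \<in> carrier G" using subgroup.mem_carrier[OF degree_mapD(1)[OF H(2)] H(3)] .
    obtain v where "bar t * v = 1" using triv_inverse[OF t bar_triv] by blast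
    then have u0: "\<phi> (bar t) \<noteq> 0" using \<phi>'(9)[of "bar t"] by auto
    have "\<phi> (bar t) powi k \<in> \<phi> ` triv (t [^] k)" for k
      using graded_units_int_power[OF graded_units_image[OF graded_units_axioms re(1)] t imageI[OF bar_triv]] .
    then have "\<forall>k. \<exists>a. a \<in> triv (t [^] k) \<and> \<phi> (bar t) powi k = \<phi> a" by blast
    then obtain T where T': "\<forall>k. T k \<in> triv (t [^] k) \<and> \<phi> (bar t) powi k = \<phi> (T k)"
      by (rule choice[THEN exE])
    then have T: "T k \<in> triv (t [^] k)" "\<phi> (T k) = \<phi> (bar t) powi k" for k by simp_all
    have T0: "T 0 = 1" by (rule injD[OF \<phi>'(4)]) (simp add: T(2) \<phi>'(3))
    have T_add: "T (m + n) = T m * T n" for m n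
      by (rule injD[OF \<phi>'(4)]) (simp add: T(2) \<phi>'(2) power_int_add u0)
    have T_all: "nontrivial_fg_subgroup H G \<and> degree_map G H d \<and> t \<in> H \<and> d t = 1 \<and>
        T 0 = 1 \<and> (\<forall>m n. T (m + n) = T m * T n) \<and> (\<forall>k. T k \<in> triv (t [^] k))"
      using H T(1) T0 T_add by simp
    obtain V F where VF: "adic (\<lambda>k. \<phi> (T k)) V F" "\<forall>x\<in>H. d x = 0 \<longrightarrow> \<phi> ` triv x \<subseteq> F"
      using \<phi>[unfolded adic_embedding_def, THEN conjunct2, rule_format, OF T_all] by blast
    obtain V' F' where VF': "adic (\<lambda>k. \<psi> (T k)) V' F'" "\<forall>x\<in>H. d x = 0 \<longrightarrow> \<psi> ` triv x \<subseteq> F'"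
      using \<psi>[unfolded adic_embedding_def, THEN conjunct2, rule_format, OF T_all] by blast
    have "adic (\<lambda>k. \<delta> (T k)) (V \<times> V') (F \<times> F')"
      unfolding \<delta>_def by (rule adic_product[OF VF(1) VF'(1)])
    moreover have "\<forall>x\<in>H. d x = 0 \<longrightarrow> \<delta> ` triv x \<subseteq> F \<times> F'"
    proof (intro ballI impI subsetI)
      fix x y assume x: "x \<in> H" "d x = 0" and "y \<in> \<delta> ` triv x"
      then obtain a where "a \<in> triv x" "y = (\<phi> a, \<psi> a)" by (auto simp: \<delta>_def)
      moreover have "\<phi> ` triv x \<subseteq> F" "\<psi> ` triv x \<subseteq> F'" using VF(2) VF'(2) x by simp_all
      ultimately show "y \<in> F \<times> F'" by blast
    qed
    ultimately show "\<exists>T V F. adic T V F \<and> (\<forall>k::int. T k \<in> \<delta> ` triv (t [^] k)) \<and>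
        (\<forall>x\<in>H. d x = 0 \<longrightarrow> \<delta> ` triv x \<subseteq> F)"
      using T(1) by (intro exI[of _ "\<lambda>k. \<delta> (T k)"] exI[of _ "V \<times> V'"] exI[of _ "F \<times> F'"]) simp
  qed
  note zero_or_unit = P.expr_zero_or_unit[OF ind this]
  define E where "E = P.monomial_sums (\<lambda>_. True)"
  have E_expr: "p \<in> E \<longleftrightarrow> (\<exists>h. P.expr h p)" for p
  proof -
    have "\<exists>m. x = HMS m" for x by (cases x) blast
    then show ?thesis by (simp add: E_def P.monomial_sums_def)
  qed
  have E: "unital_subring E" unfolding unital_subring_def
  proof (intro conjI ballI)
    show "1 \<in> E" unfolding E_def
      by (rule P.monomial_sums_monomial[OF P.monomial_unit[OF one_closed P.U_one]]) simp
    fix p q assume pq: "p \<in> E" "q \<in> E"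
    have "p + - q \<in> E" using pq unfolding E_def by (intro P.monomial_sums_add P.monomial_sums_minus)
    then show "p - q \<in> E" by simp
    show "p * q \<in> E" using pq unfolding E_def by (rule P.monomial_sums_mult) simp
  qed
  note E' = unital_subringD[OF E]
  have E_unit: "a \<noteq> 0 \<and> b \<noteq> 0" if ab: "(a, b) \<in> E" "(a, b) \<noteq> 0" for a b
  proof -
    obtain h where "P.expr h (a, b)" using ab(1) unfolding E_expr by blast
    from zero_or_unit[OF this] ab(2) obtain c where "(a, b) * c = 1" by (auto simp: invertible_def)
    then have "a * fst c = 1" "b * snd c = 1" by (simp_all add: times_prod_def one_prod_def)
    then show ?thesis by auto
  qed
  have E_inverse: "(inverse a, inverse b) \<in> E" if ab: "(a, b) \<in> E" for a b
  proof (cases "(a, b) = 0")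
    case False
    then have inv: "(a, b) * (inverse a, inverse b) = 1" "(inverse a, inverse b) * (a, b) = 1"
      using E_unit[OF ab] by (auto simp: times_prod_def one_prod_def)
    obtain h where h: "P.expr h (a, b)" using ab unfolding E_expr by blast
    obtain X g where "P.monomial X {#HMS h#} (inverse a, inverse b) g"
      using P.monomial_inverse[OF h inv] by blast
    then show ?thesis unfolding E_def by (rule P.monomial_sums_monomial) simp
  qed (use ab in \<open>simp add: zero_prod_def\<close>)
  have \<delta>_E: "range \<delta> \<subseteq> E"
  proof (rule image_subring_contains[OF \<delta> E])
    show "\<delta> ` triv x \<subseteq> E" if "x \<in> carrier G" for x
    proof
      fix u assume "u \<in> \<delta> ` triv x"
      then have "P.monomial {} {#} u x" by (rule P.monomial_unit[OF that])
      then show "u \<in> E" unfolding E_def by (rule P.monomial_sums_monomial) simp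
    qed
  qed
  have "division_subring (fst ` E)"
  proof (rule division_subringI)
    show "unital_subring (fst ` E)" unfolding unital_subring_def
    proof (intro conjI ballI)
      show "1 \<in> fst ` E" using E'(2) by (force simp: one_prod_def)
      fix a b assume "a \<in> fst ` E" "b \<in> fst ` E"
      then obtain p q where "p \<in> E" "q \<in> E" "a = fst p" "b = fst q" by blast
      then show "a - b \<in> fst ` E" "a * b \<in> fst ` E"
        using E'(3)[of p q] E'(4)[of p q] by (force simp: times_prod_def)+
    qed
    show "inverse c \<in> fst ` E" if "c \<in> fst ` E" for c
      using that E_inverse by force
  qed
  moreover have "range \<phi> \<subseteq> fst ` E" using \<delta>_E by (force simp: \<delta>_def)
  ultimately have "fst ` E = UNIV" using gen division_subring_generated_subset by blast
  then have "\<forall>x. \<exists>y. (x, y) \<in> E" by (metis UNIV_I imageE prod.collapse)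
  then obtain f where f: "\<And>x. (x, f x) \<in> E" by metis
  have f_eq: "y = f x" if "(x, y) \<in> E" for x y
    using E_unit[of 0 "y - f x"] E'(3)[OF that f[of x]] by (auto simp: zero_prod_def)
  have "f (a + b) = f a + f b" "f (a * b) = f a * f b" for a b
    using f_eq[of "a + b" "f a + f b"] f_eq[of "a * b" "f a * f b"] E'(6)[OF f[of a] f[of b]]
      E'(4)[OF f[of a] f[of b]] by (simp_all add: times_prod_def)
  moreover have "f 1 = 1" using f_eq[of 1 1] E'(2) by (simp add: one_prod_def)
  moreover have "inj f"
  proof (rule injI)
    fix a b assume "f a = f b"
    then show "a = b" using E_unit[of "a - b" 0] E'(3)[OF f[of a] f[of b]] by (auto simp: zero_prod_def)
  qed
  moreover have "f (\<phi> a) = \<psi> a" for a using f_eq[of "\<phi> a" "\<psi> a"] subsetD[OF \<delta>_E rangeI[of \<delta> a]] by (simp add: \<delta>_def)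
  ultimately show ?thesis unfolding ring_embedding_def by blast
qed

end

section \<open>Involutions\<close>

locale involutive_crossed_product = division_crossed_product G K bar \<tau> \<sigma>
  for G (structure) and K :: "'a::ring_1 set" and bar :: "'g \<Rightarrow> 'a" and \<tau> \<sigma> +
  fixes star :: "'a \<Rightarrow> 'a"
  assumes star: "involution star" and ind: "indicable_subgroups G"
begin

lemma star_simps [simp]:
  "star (a + b) = star a + star b" "star (a * b) = star b * star a" "star (star a) = a"
  using star by (auto simp: involution_def)

lemma star_one [simp]: "star 1 = 1"
  by (metis mult_1_left mult_1_right star_simps(2,3))

lemma star_zero [simp]: "star 0 = 0"
  using star_simps(1)[of 0 0] by simp

lemma star_minus_one: "star (- 1) = - 1"
  using star_simps(1)[of 1 "- 1"] by (simp add: eq_neg_iff_add_eq_0 add.commute)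

lemma star_unit:
  assumes "x \<in> carrier G" "u \<in> triv x"
  shows "\<exists>y\<in>carrier G. star u \<in> triv y"
proof -
  obtain v where "v * u = 1" using triv_inverse[OF assms] by blast
  then have "star u * star v = 1" by (metis star_one star_simps(2))
  then show ?thesis by (rule unit_is_trivial[OF ind])
qed

text \<open>For \<open>a\<close> in \<open>K\<close> other than \<open>0\<close> and \<open>- 1\<close> the units \<open>star a\<close> and \<open>star a + 1 = star (a + 1)\<close> are both trivial, hence
  homogeneous. This is only possible if \<open>star a\<close> has degree one.\<close>

lemma star_K:
  assumes "a \<in> triv \<one>"
  shows "star a \<in> triv \<one>"
proof (cases "a = - 1")
  case True
  then show ?thesis using assms star_minus_one by simp
next
  case False
  then have "a + 1 \<noteq> 0" by (simp add: eq_neg_iff_add_eq_0)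
  then have "a + 1 \<in> triv \<one>" using assms K_ring by (auto simp: triv_one)
  from star_unit[OF one_closed this] obtain y where y: "y \<in> carrier G" "star a + 1 \<in> triv y" by auto
  obtain x where x: "x \<in> carrier G" "star a \<in> triv x" using star_unit[OF one_closed assms] by blast
  have "x = \<one>"
  proof (rule ccontr)
    assume "x \<noteq> \<one>"
    define b where "b = - (star a + 1)"
    have b: "b \<in> line y" unfolding b_def using y(2) triv_line line_minus by blast
    have a: "star a \<in> line x" using x(2) triv_line by blast
    have one: "1 \<in> line \<one>" using K_ring(2) by (simp add: triv_one)
    define w where "w z = (if z = x then star a else 0) + (if z = \<one> then 1 else 0) + (if z = y then b else 0)" for z
    have sum0: "(\<Sum>z\<in>{x, \<one>, y}. w z) = 0" by (simp add: w_def sum.distrib b_def)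
    have line: "w z \<in> line z" if "z \<in> {x, \<one>, y}" for z
      unfolding w_def by (intro line_add) (simp_all add: a b one line_zero)
    have fin: "finite {x, \<one>, y}" "{x, \<one>, y} \<subseteq> carrier G" using x y by auto
    have w0: "w z = 0" if "z \<in> {x, \<one>, y}" for z
      using fin line sum0 that by (rule lines_independent)
    have a0: "star a \<noteq> 0" using assms by (metis star_zero star_simps(3) triv_one(1) DiffE singletonI)
    show False
    proof (cases "y = x")
      case True
      then show ?thesis using w0[of \<one>] \<open>x \<noteq> \<one>\<close> by (simp add: w_def)
    next
      case False
      then show ?thesis using w0[of x] \<open>x \<noteq> \<one>\<close> a0 by (simp add: w_def)
    qed
  qed
  then show ?thesis using x by simp
qed

text \<open>The antiautomorphism of the group that is induced by the involution.\<close>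

definition \<alpha> where "\<alpha> x = (SOME y. y \<in> carrier G \<and> star (bar x) \<in> triv y)"

lemma star_triv:
  assumes "x \<in> carrier G"
  shows "\<alpha> x \<in> carrier G" "u \<in> triv x \<Longrightarrow> star u \<in> triv (\<alpha> x)"
proof -
  have *: "\<alpha> x \<in> carrier G \<and> star (bar x) \<in> triv (\<alpha> x)"
  proof -
    have "\<exists>y. y \<in> carrier G \<and> star (bar x) \<in> triv y" using star_unit[OF assms bar_triv] by blast
    then show ?thesis unfolding \<alpha>_def by (rule someI_ex)
  qed
  then show "\<alpha> x \<in> carrier G" by simp
  assume "u \<in> triv x"
  then obtain a where a: "u = bar x * a" "a \<in> K - {0}" unfolding triv_def by blast
  then have "star u = star a * star (bar x)" by simp
  also have "\<dots> \<in> triv (\<one> \<otimes> \<alpha> x)" using * star_K[OF a(2)[folded triv_one(1)]] by (intro triv_mult) auto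
  finally show "star u \<in> triv (\<alpha> x)" using * by simp
qed

lemma triv_disjoint:
  assumes "x \<in> carrier G" "y \<in> carrier G" "u \<in> triv x" "u \<in> triv y"
  shows "x = y"
proof -
  have "u \<noteq> 0" using triv_inverse[OF assms(1,3)] by auto
  then show ?thesis using lines_disjoint assms triv_line by blast
qed

lemma \<alpha>_mult: "x \<in> carrier G \<Longrightarrow> y \<in> carrier G \<Longrightarrow> \<alpha> (x \<otimes> y) = \<alpha> y \<otimes> \<alpha> x"
proof -
  assume xy: "x \<in> carrier G" "y \<in> carrier G"
  have "bar x * bar y \<in> triv (x \<otimes> y)" using xy bar_triv by (intro triv_mult)
  then have "star (bar y) * star (bar x) \<in> triv (\<alpha> (x \<otimes> y))"
    using star_triv(2)[of "x \<otimes> y" "bar x * bar y"] xy by simp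
  moreover have "star (bar y) * star (bar x) \<in> triv (\<alpha> y \<otimes> \<alpha> x)"
    using xy star_triv bar_triv by (intro triv_mult) auto
  ultimately show ?thesis using xy star_triv(1) by (intro triv_disjoint) auto
qed

lemma \<alpha>_involutive: "x \<in> carrier G \<Longrightarrow> \<alpha> (\<alpha> x) = x"
proof -
  assume x: "x \<in> carrier G"
  have "star (star (bar x)) \<in> triv (\<alpha> (\<alpha> x))" using x star_triv bar_triv by blast
  then show ?thesis using x star_triv(1) bar_triv[of x] by (intro triv_disjoint) auto
qed

lemma \<alpha>_one: "\<alpha> \<one> = \<one>"
  using \<alpha>_mult[OF one_closed one_closed] star_triv(1)[OF one_closed] by (metis l_one l_cancel_one' one_closed)

lemma \<alpha>_inv: "x \<in> carrier G \<Longrightarrow> \<alpha> (inv x) = inv (\<alpha> x)"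
  using \<alpha>_mult[of x "inv x"] \<alpha>_one star_triv(1) by (intro inv_equality[symmetric]) auto

lemma \<alpha>_subgroup:
  assumes "nontrivial_fg_subgroup H G"
  shows "nontrivial_fg_subgroup (\<alpha> ` H) G"
proof -
  obtain S where S: "finite S" "S \<subseteq> carrier G" "H = generate G S" and H: "subgroup H G" "H \<noteq> {\<one>}"
    using assms by (auto simp: nontrivial_fg_subgroup_def)
  have H_car: "x \<in> H \<Longrightarrow> x \<in> carrier G" for x using subgroup.mem_carrier[OF H(1)] .
  define \<beta> where "\<beta> x = \<alpha> (inv x)" for x
  interpret \<beta>: group_hom G G \<beta>
    unfolding group_hom_def group_hom_axioms_def hom_def \<beta>_def
    using is_group star_triv(1) by (simp add: \<alpha>_mult inv_mult_group Pi_def)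
  have "\<alpha> ` H = \<beta> ` H"
  proof (intro equalityI subsetI)
    fix y assume "y \<in> \<alpha> ` H"
    then obtain x where "x \<in> H" "y = \<alpha> x" by blast
    then show "y \<in> \<beta> ` H"
      using subgroup.m_inv_closed[OF H(1)] H_car by (intro image_eqI[of _ _ "inv x"]) (auto simp: \<beta>_def)
  next
    fix y assume "y \<in> \<beta> ` H"
    then show "y \<in> \<alpha> ` H" using subgroup.m_inv_closed[OF H(1)] by (auto simp: \<beta>_def)
  qed
  also have "\<dots> = generate G (\<beta> ` S)" using \<beta>.generate_img[OF S(2)] S(3) by simp
  finally have gen: "\<alpha> ` H = generate G (\<beta> ` S)" .
  have S': "finite (\<beta> ` S)" "\<beta> ` S \<subseteq> carrier G" using S by auto
  have "\<alpha> ` H \<noteq> {\<one>}"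
  proof
    assume *: "\<alpha> ` H = {\<one>}"
    have "x = \<one>" if "x \<in> H" for x
      using * that \<alpha>_involutive[OF H_car[OF that]] \<alpha>_one by (metis imageI singletonD)
    then show False using H(2) subgroup.one_closed[OF H(1)] by blast
  qed
  then show ?thesis unfolding nontrivial_fg_subgroup_def
    using gen S' generate_is_subgroup[OF S'(2)] by auto
qed

text \<open>The degree map \<open>d\<close> on \<open>H\<close> for the new embedding corresponds to the degree map \<open>d \<circ> \<alpha>\<close> on \<open>\<alpha> ` H\<close>
  for \<open>\<phi>\<close>. The latter is additive although \<open>\<alpha>\<close> reverses products, because the integers commute.\<close>

lemma adic_embedding_opposite:
  fixes \<phi> :: "'a \<Rightarrow> 'd::division_ring"
  assumes "adic_embedding G triv \<phi>"
  shows "adic_embedding G triv (\<lambda>a. Opp (\<phi> (star a)))"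
  unfolding adic_embedding_def
proof (intro conjI allI impI; (elim conjE)?)
  have re: "ring_embedding \<phi>" using assms by (simp add: adic_embedding_def)
  note \<phi> = ring_embeddingD[OF re]
  have "inj star" by (rule injI) (metis star_simps(3))
  then show "ring_embedding (\<lambda>a. Opp (\<phi> (star a)))"
    using \<phi>(1-4) by (simp add: ring_embedding_def opp_eq_iff inj_def)
  fix H d t T
  assume H: "nontrivial_fg_subgroup H G" and d: "degree_map G H d" "t \<in> H" "d t = 1"
    and T: "T 0 = 1" "\<forall>m n. T (m + n) = T m * T n" "\<forall>k::int. T k \<in> triv (t [^] k)"
  note dm = degree_mapD[OF d(1)]
  have H_car: "x \<in> H \<Longrightarrow> x \<in> carrier G" for x using subgroup.mem_carrier[OF dm(1)] .
  have t: "t \<in> carrier G" using H_car d(2) .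
  have H': "nontrivial_fg_subgroup (\<alpha> ` H) G" using H by (rule \<alpha>_subgroup)
  have invol: "\<alpha> (\<alpha> x) = x" if "x \<in> H" for x using \<alpha>_involutive[OF H_car[OF that]] .
  have d': "degree_map G (\<alpha> ` H) (\<lambda>x. d (\<alpha> x))"
    unfolding degree_map_def
  proof (intro conjI ballI)
    show "subgroup (\<alpha> ` H) G" using H' by (simp add: nontrivial_fg_subgroup_def)
    fix x y assume "x \<in> \<alpha> ` H" "y \<in> \<alpha> ` H"
    then obtain a b where ab: "a \<in> H" "b \<in> H" "x = \<alpha> a" "y = \<alpha> b" by blast
    then show "d (\<alpha> (x \<otimes> y)) = d (\<alpha> x) + d (\<alpha> y)"
      using \<alpha>_mult star_triv(1) H_car dm(2) invol by simp
  qed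
  have pow: "\<alpha> (t [^] (k::int)) = \<alpha> t [^] k" for k
  proof -
    have nat: "\<alpha> (t [^] (n::nat)) = \<alpha> t [^] n" for n
    proof (induction n)
      case (Suc n)
      have "\<alpha> (t [^] Suc n) = \<alpha> t \<otimes> \<alpha> (t [^] n)" using t by (simp add: \<alpha>_mult)
      also have "\<dots> = \<alpha> t [^] Suc n" using star_triv(1)[OF t] unfolding Suc by (rule nat_pow_Suc2[symmetric])
      finally show ?case .
    qed (simp add: \<alpha>_one)
    show ?thesis
      by (cases k rule: int_cases2) (use t star_triv(1) in \<open>simp_all add: int_pow_int int_pow_neg_int nat \<alpha>_inv\<close>)
  qed
  have T0: "star (T 0) = 1" and T_add: "\<forall>m n. star (T (m + n)) = star (T m) * star (T n)"
    using T(1,2) by (simp, metis add.commute star_simps(2))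
  have T_triv: "\<forall>k::int. star (T k) \<in> triv (\<alpha> t [^] k)"
    unfolding pow[symmetric] using T(3) star_triv(2) t by (meson int_pow_closed)
  have t': "\<alpha> t \<in> \<alpha> ` H" "d (\<alpha> (\<alpha> t)) = 1" using d invol by auto
  have T': "nontrivial_fg_subgroup (\<alpha> ` H) G \<and> degree_map G (\<alpha> ` H) (\<lambda>x. d (\<alpha> x)) \<and> \<alpha> t \<in> \<alpha> ` H \<and>
      d (\<alpha> (\<alpha> t)) = 1 \<and> star (T 0) = 1 \<and> (\<forall>m n. star (T (m + n)) = star (T m) * star (T n)) \<and>
      (\<forall>k. star (T k) \<in> triv (\<alpha> t [^] k))"
    using H' d' t' T0 T_add T_triv by blast
  obtain V F where VF: "adic (\<lambda>k. \<phi> (star (T k))) V F" "\<forall>x\<in>\<alpha> ` H. d (\<alpha> x) = 0 \<longrightarrow> \<phi> ` triv x \<subseteq> F"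
    using assms[unfolded adic_embedding_def, THEN conjunct2, rule_format, OF T'] by blast
  have "(\<lambda>a. Opp (\<phi> (star a))) ` triv x \<subseteq> Opp ` F" if "x \<in> H" "d x = 0" for x
  proof -
    have "\<phi> ` triv (\<alpha> x) \<subseteq> F" using VF(2) that invol by auto
    then show ?thesis using star_triv(2)[OF H_car[OF that(1)]] by blast
  qed
  then show "\<exists>V F. adic (\<lambda>k. Opp (\<phi> (star (T k)))) V F \<and>
      (\<forall>x\<in>H. d x = 0 \<longrightarrow> (\<lambda>a. Opp (\<phi> (star a))) ` triv x \<subseteq> F)"
    using adic_opposite[OF VF(1)] by (intro exI[of _ "Opp ` V"] exI[of _ "Opp ` F"]) simp
qed

end

text \<open>The set on which two homomorphisms agree is a division subring.\<close>

lemma ring_embedding_agree: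
  fixes f g :: "'d::division_ring \<Rightarrow> 'e::division_ring"
  assumes "ring_embedding f" "ring_embedding g" "division_subring_generated X = UNIV"
    and "\<And>x. x \<in> X \<Longrightarrow> f x = g x"
  shows "f = g"
proof -
  note f = ring_embeddingD[OF assms(1)] and g = ring_embeddingD[OF assms(2)]
  have inverse: "h (inverse x) = inverse (h x)" if h: "ring_embedding h" for h :: "'d \<Rightarrow> 'e" and x
  proof (cases "x = 0")
    case False
    then have "h x * h (inverse x) = 1"
      using ring_embeddingD(2,3)[OF h] by (metis right_inverse)
    then show ?thesis by (metis inverse_unique)
  qed (use ring_embeddingD(5)[OF h] in simp)
  have "division_subring {x. f x = g x}"
    by (rule division_subringI)
      (simp_all add: unital_subring_def f(2,3,7) g(2,3,7) inverse assms(1,2))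
  then have "division_subring_generated X \<subseteq> {x. f x = g x}"
    using assms(4) by (intro division_subring_generated_subset) auto
  then show ?thesis using assms(3) by auto
qed

lemma involution_ring_embedding:
  fixes s :: "'d::division_ring \<Rightarrow> 'd"
  assumes "involution s"
  shows "ring_embedding (\<lambda>x. Opp (s x))"
proof -
  have s: "s (a + b) = s a + s b" "s (a * b) = s b * s a" "s (s a) = a" for a b
    using assms by (auto simp: involution_def)
  have "s 1 = 1" by (metis mult_1_left mult_1_right s(2,3))
  moreover have "inj (\<lambda>x. Opp (s x))" by (rule injI) (metis s(3) opp.inject)
  ultimately show ?thesis
    by (simp add: ring_embedding_def opp_eq_iff s(1,2))
qed

text \<open>Hughes' theorem gives an embedding of the division ring into its opposite that extends \<open>star\<close>. It is its
  own inverse, and it is the only one, because embeddings are determined by their values on the image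
  of \<open>\<phi>\<close>.\<close>

theorem theorem2p9:
  fixes G :: "('g, 'm) monoid_scheme"
    and K :: "'a::ring_1 set"
    and bar :: "'g \<Rightarrow> 'a"
    and \<tau> :: "'g \<Rightarrow> 'g \<Rightarrow> 'a"
    and \<sigma> :: "'g \<Rightarrow> 'a \<Rightarrow> 'a"
    and \<phi> :: "'a \<Rightarrow> 'd::division_ring"
    and star :: "'a \<Rightarrow> 'a"
  assumes "division_subring K"
    and "locally_indicable G"
    and "crossed_product G K bar \<tau> \<sigma>"
    and "hughes_free_division_ring_of_fractions G K bar \<phi>"
    and "involution star"
  shows "\<exists>!s :: 'd \<Rightarrow> 'd. involution s \<and> (\<forall>a. s (\<phi> a) = \<phi> (star a))"
proof -
  interpret crossed_product G K bar \<tau> \<sigma> by fact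
  interpret involutive_crossed_product G K bar \<tau> \<sigma> star
    by unfold_locales (use assms locally_indicable_subgroups in auto)
  have hf: "hughes_free_embedding G K bar \<phi>"
    and "division_closure K bar \<phi> (carrier G) = UNIV"
    using assms(4) by (auto simp: hughes_free_division_ring_of_fractions_def)
  then have gen: "division_subring_generated (range \<phi>) = UNIV"
    using bar_span by (simp add: division_closure_def sub_crossed_product_def)
  have adic: "adic_embedding G triv \<phi>" using hf by (rule hughes_free_adic_embedding)
  then have \<phi>: "ring_embedding \<phi>" by (simp add: adic_embedding_def)
  obtain f where f: "ring_embedding f" "\<And>a. f (\<phi> a) = Opp (\<phi> (star a))"
    using hughes_uniqueness[OF ind adic adic_embedding_opposite[OF adic] gen] by blast
  note f' = ring_embeddingD[OF f(1)]
  define s where "s x = unop (f x)" for x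
  have s: "s (a + b) = s a + s b" "s (a * b) = s b * s a" "s (\<phi> c) = \<phi> (star c)" for a b c
    by (simp_all add: s_def f'(1,2) f(2))
  have "inj s" by (rule injI) (metis s_def f'(4) injD opp_eq_iff)
  moreover have "s 1 = 1" by (simp add: s_def f'(3))
  ultimately have "ring_embedding (\<lambda>x. s (s x))"
    by (simp add: ring_embedding_def s(1,2) inj_def)
  moreover have "ring_embedding (\<lambda>x::'d. x)" by (simp add: ring_embedding_def inj_def)
  ultimately have "(\<lambda>x. s (s x)) = (\<lambda>x. x)"
    by (rule ring_embedding_agree[OF _ _ gen]) (auto simp: s(3))
  then have inv: "involution s" using s unfolding involution_def by metis
  show ?thesis
  proof (rule ex1I)
    show "involution s \<and> (\<forall>a. s (\<phi> a) = \<phi> (star a))" using inv s(3) by blast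
    fix r assume r: "involution r \<and> (\<forall>a. r (\<phi> a) = \<phi> (star a))"
    have "(\<lambda>x. Opp (r x)) = (\<lambda>x. Opp (s x))"
      using r inv s(3) by (intro ring_embedding_agree[OF _ _ gen] involution_ring_embedding) auto
    then show "r = s" by (auto simp: fun_eq_iff dest!: fun_cong)
  qed
qed

end
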